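(* There exist $\epsilon_0>0$ and a constant $C_1>0$ (depending on $\epsilon_0$) such that for every $0<\epsilon<\epsilon_0$ there is a smooth function $\psi_\epsilon$ on $\mathbb{T}^2$ satisfying $\psi_\epsilon=\Delta^{-1}(F_\epsilon(\psi_\epsilon))$ and $$\|\psi_\epsilon-\psi_0\|_{C^1(\mathbb{T}^2)}\le C_1\sqrt{\epsilon}\sqrt{-\ln\epsilon},$$ and moreover, for every $\alpha\in[0,1)$, $$\lim_{\epsilon\to0}\|\psi_\epsilon-\psi_0\|_{C^{1,\alpha}(\mathbb{T}^2)}=0.$$
   Context: $\mathbb{T}^2=[-\tfrac12,\tfrac12]^2$ with opposite sides identified. $\Delta^{-1}$ is the inverse Laplacian on mean-zero functions on $\mathbb{T}^2$ (convolution with the torus Green's function $G(x,y)=\frac1{2\pi}\ln|x-y|+f(x-y)$, $f$ smooth). $\mathrm{sgn}(t)=1$ for $t>0$, $-1$ for $t\le 0$. $\psi_0=\Delta^{-1}[\mathrm{sgn}(x)\mathrm{sgn}(y)]$ (Bahouri–Chemin stream function). Let $K$ be a smooth nonnegative even function on $\mathbb{R}$ supported in $(-1,1)$ with $\int K=1$, $K_\epsilon(x)=\frac1\epsilon K(x/\epsilon)$, and $F_\epsilon=-\,\mathrm{sgn}*K_\epsilon$. *)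

theory Defs
  imports "HOL-Analysis.Analysis"
begin

type_synonym R2 = "real \<times> real"

text \<open>Paper's sign convention: sgn t = 1 for t > 0, -1 for t <= 0.\<close>
definition sgnp :: "real \<Rightarrow> real" where
  "sgnp t = (if t > 0 then 1 else -1)"

text \<open>Functions on the torus are 1-periodic functions on the plane.\<close>
definition periodic2 :: "(R2 \<Rightarrow> real) \<Rightarrow> bool" where
  "periodic2 u \<longleftrightarrow> (\<forall>x y. u (x + 1, y) = u (x, y) \<and> u (x, y + 1) = u (x, y))"

definition px :: "(R2 \<Rightarrow> real) \<Rightarrow> R2 \<Rightarrow> real" where
  "px u p = deriv (\<lambda>t. u (t, snd p)) (fst p)"

definition py :: "(R2 \<Rightarrow> real) \<Rightarrow> R2 \<Rightarrow> real" where
  "py u p = deriv (\<lambda>t. u (fst p, t)) (snd p)"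

definition pd :: "bool \<Rightarrow> (R2 \<Rightarrow> real) \<Rightarrow> R2 \<Rightarrow> real" where
  "pd b u = (if b then px u else py u)"

definition has_partials :: "(R2 \<Rightarrow> real) \<Rightarrow> bool" where
  "has_partials u \<longleftrightarrow> (\<forall>p. (\<lambda>t. u (t, snd p)) differentiable (at (fst p))
                          \<and> (\<lambda>t. u (fst p, t)) differentiable (at (snd p)))"

definition C1 :: "(R2 \<Rightarrow> real) \<Rightarrow> bool" where
  "C1 u \<longleftrightarrow> continuous_on UNIV u \<and> has_partials u
            \<and> continuous_on UNIV (px u) \<and> continuous_on UNIV (py u)"

definition smooth2 :: "(R2 \<Rightarrow> real) \<Rightarrow> bool" where
  "smooth2 u \<longleftrightarrow> (\<forall>ds::bool list. continuous_on UNIV (fold pd ds u) \<and> has_partials (fold pd ds u))"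

definition smooth1 :: "(real \<Rightarrow> real) \<Rightarrow> bool" where
  "smooth1 K \<longleftrightarrow> (\<forall>n x. ((deriv ^^ n) K) differentiable (at x))"

definition unit_sq :: "R2 set" where
  "unit_sq = cbox (0, 0) (1, 1)"

text \<open>u = \<Delta>^{-1} g (inverse Laplacian on mean-zero functions on the torus), in the
  weak sense: u is a C^1 periodic mean-zero function with
  \<integral> \<nabla>u \<cdot> \<nabla>\<phi> = - \<integral> g \<phi> for all smooth periodic test functions \<phi>.\<close>
definition is_inv_lap :: "(R2 \<Rightarrow> real) \<Rightarrow> (R2 \<Rightarrow> real) \<Rightarrow> bool" where
  "is_inv_lap g u \<longleftrightarrow>
     periodic2 u \<and> C1 u \<and> integral unit_sq u = 0 \<and> g integrable_on unit_sq \<and>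
     (\<forall>\<phi>. smooth2 \<phi> \<and> periodic2 \<phi> \<longrightarrow>
        integral unit_sq (\<lambda>p. px u p * px \<phi> p + py u p * py \<phi> p)
          = - integral unit_sq (\<lambda>p. g p * \<phi> p))"

definition inv_lap :: "(R2 \<Rightarrow> real) \<Rightarrow> (R2 \<Rightarrow> real)" where
  "inv_lap g = (THE u. is_inv_lap g u)"

text \<open>sgn(x) sgn(y) on [-1/2,1/2]^2, extended periodically.\<close>
definition bc_vort :: "R2 \<Rightarrow> real" where
  "bc_vort p = sgnp (fst p - round (fst p)) * sgnp (snd p - round (snd p))"

definition psi0 :: "R2 \<Rightarrow> real" where
  "psi0 = inv_lap bc_vort"

definition Keps :: "(real \<Rightarrow> real) \<Rightarrow> real \<Rightarrow> real \<Rightarrow> real" where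
  "Keps K \<epsilon> x = K (x / \<epsilon>) / \<epsilon>"

definition Feps :: "(real \<Rightarrow> real) \<Rightarrow> real \<Rightarrow> real \<Rightarrow> real" where
  "Feps K \<epsilon> t = - integral UNIV (\<lambda>s. sgnp (t - s) * Keps K \<epsilon> s)"

text \<open>C^1 and C^{1,\<alpha>} norms (extended-real valued, so infinite norms are not junk).\<close>
definition c1_norm :: "(R2 \<Rightarrow> real) \<Rightarrow> ereal" where
  "c1_norm u = (SUP p. ereal \<bar>u p\<bar>) + (SUP p. ereal \<bar>px u p\<bar>) + (SUP p. ereal \<bar>py u p\<bar>)"

definition holder_semi :: "real \<Rightarrow> (R2 \<Rightarrow> real) \<Rightarrow> ereal" where
  "holder_semi \<alpha> v = (SUP pq \<in> {pq. fst pq \<noteq> snd pq}.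
       ereal (\<bar>v (fst pq) - v (snd pq)\<bar> / dist (fst pq) (snd pq) powr \<alpha>))"

definition c1a_norm :: "real \<Rightarrow> (R2 \<Rightarrow> real) \<Rightarrow> ereal" where
  "c1a_norm \<alpha> u = c1_norm u + holder_semi \<alpha> (px u) + holder_semi \<alpha> (py u)"

end

theory Submission
  imports Defs
begin

text \<open>
  By odd symmetry the problem lives on the square \<open>Q = [0,1/2]\<^sup>2\<close> with zero boundary values, where
  \<open>\<psi>\<^sub>0 < 0\<close> and the vorticity is 1. Since \<open>F\<^sub>\<epsilon>\<close> is decreasing, the iteration
  \<open>\<psi> \<mapsto> \<Delta>\<^sup>-\<^sup>1 F\<^sub>\<epsilon>(\<psi>)\<close> is monotone on odd functions by the maximum principle. Started from a fixed explicit
  function that is a barrier for every small \<open>\<epsilon>\<close>, it decreases to a solution with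
  \<open>\<psi>\<^sub>\<epsilon> \<le> - a sin(2\<pi>x) sin(2\<pi>y)\<close> on \<open>Q\<close>, \<open>a\<close> independent of \<open>\<epsilon>\<close>. Hence the two vorticities differ only where
  \<open>a |sin(2\<pi>x) sin(2\<pi>y)| < \<epsilon>\<close>, a set of measure \<open>O(\<epsilon> ln(1/\<epsilon>))\<close>, and \<open>\<nabla>\<Delta>\<^sup>-\<^sup>1\<close> maps a bounded function
  with \<open>L\<^sup>1\<close> norm \<open>m\<close> to a function of size \<open>O(\<surd>m)\<close>. Interpolating with a uniform \<open>C\<^sup>1\<^sup>,\<^sup>\<beta>\<close> bound gives the
  \<open>C\<^sup>1\<^sup>,\<^sup>\<alpha>\<close> limit.

  The inverse Laplacian is built without a singular kernel. For a radial probability density \<open>h\<close> and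
  \<open>n\<close> with \<open>\<nabla>n(z) = h(z) z\<close>, the average \<open>U b(p) = \<integral>\<^sub>0\<^sup>1 s \<integral> n(z) b(p + s z) dz ds\<close> over all scales satisfies
  \<open>\<Delta> U b = b - h * b\<close>, because the scale derivative of \<open>\<integral> h(z) b(p + s z) dz\<close> integrates to \<open>h * b - b\<close>.
  Convolution with \<open>h\<close> is a strict contraction on mean-zero periodic functions, so \<open>b - h * b = g\<close> is solved
  by a Neumann series and \<open>\<Delta>\<^sup>-\<^sup>1 g = U b\<close>.
\<close>

section \<open>Integration over intervals and squares\<close>

text \<open>The square root comes from the scales: the average of b at scale s is bounded by the sup
  norm of b and also by a constant times \<open>m / s^2\<close>, because the kernel is bounded, and
  min(1, m/s^2) integrates over s to order sqrt m. The gradient of \<open>U b\<close> has the same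
  form, since differentiating the kernel at scale s costs 1/s, which cancels the weight s. One
  estimate thus serves the function and its gradient. In the Neumann series only the first term g
  needs the square root; the tail starts from h * g, whose sup norm is already of order m.

  Oddness supplies both the zero boundary values for the maximum principle and the zero mean of the
  vorticity at every step. The monotone limit is known only pointwise, so \<open>ilap\<close> has to
  be continuous under bounded pointwise convergence, and smoothness is recovered afterwards from the
  equation. Since \<open>inv_lap\<close> is a definite description, uniqueness among C^1 weak
  solutions is part of the proof.\<close>

definition bdd_borel :: "real \<Rightarrow> ('a::topological_space \<Rightarrow> real) \<Rightarrow> bool" where
  "bdd_borel B f \<longleftrightarrow> f \<in> borel_measurable borel \<and> (\<forall>x. \<bar>f x\<bar> \<le> B)"

lemma bdd_borelD:
  assumes "bdd_borel B f"
  shows "f \<in> borel_measurable borel" "\<bar>f x\<bar> \<le> B" "0 \<le> B"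
  using assms abs_ge_zero[of "f x"] order_trans unfolding bdd_borel_def by blast+

lemma bdd_borelI:
  "f \<in> borel_measurable borel \<Longrightarrow> (\<And>x. \<bar>f x\<bar> \<le> B) \<Longrightarrow> bdd_borel B f"
  by (auto simp: bdd_borel_def)

lemma bdd_borel_integrable:
  assumes "finite_measure N" "sets N = sets borel" "bdd_borel B f"
  shows "integrable N f"
proof (rule finite_measure.integrable_const_bound[OF assms(1), of _ B])
  show "f \<in> borel_measurable N"
    using bdd_borelD(1)[OF assms(3)] measurable_cong_sets[OF assms(2) refl] by blast
qed (use assms(3) in \<open>simp add: bdd_borel_def\<close>)

text \<open>A density on all of \<open>borel\<close> instead of a restricted space: the underlying
  set stays \<open>UNIV\<close>, so globally measurable functions can be integrated over varying
  intervals without restricting them.\<close>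

definition ivl :: "real \<Rightarrow> real \<Rightarrow> real measure" where
  "ivl a b = density lborel (\<lambda>x. ennreal (indicator {a..b} x))"

lemma sets_ivl [simp, measurable_cong]: "sets (ivl a b) = sets borel"
  by (simp add: ivl_def)

lemma space_ivl [simp]: "space (ivl a b) = UNIV"
  by (simp add: ivl_def)

lemma emeasure_ivl: "a \<le> b \<Longrightarrow> emeasure (ivl a b) UNIV = ennreal (b - a)"
  by (simp add: ivl_def emeasure_density ennreal_indicator)

lemma measure_ivl: "a \<le> b \<Longrightarrow> measure (ivl a b) UNIV = b - a"
  by (simp add: measure_def emeasure_ivl)

interpretation ivl: finite_measure "ivl a b"
proof
  have "emeasure (ivl a b) UNIV < \<infinity>"
  proof (cases "a \<le> b")
    case False
    then have "ivl a b = density lborel (\<lambda>x. 0)"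
      by (simp add: ivl_def)
    then show ?thesis by (simp add: emeasure_density)
  qed (simp add: emeasure_ivl)
  then show "emeasure (ivl a b) (space (ivl a b)) \<noteq> \<infinity>"
    by simp
qed

lemma integral_ivl_lborel:
  fixes f :: "real \<Rightarrow> real"
  assumes "f \<in> borel_measurable borel"
  shows "(LINT x|ivl a b. f x) = (LINT x|lborel. indicator {a..b} x * f x)"
  unfolding ivl_def by (subst integral_density) (use assms in auto)

lemma integrable_ivl_iff:
  fixes f :: "real \<Rightarrow> real"
  assumes "f \<in> borel_measurable borel"
  shows "integrable (ivl a b) f \<longleftrightarrow> set_integrable lborel {a..b} f"
  unfolding ivl_def set_integrable_def by (subst integrable_density) (use assms in auto)

lemma integral_ivl:
  fixes f :: "real \<Rightarrow> real"
  assumes "f \<in> borel_measurable borel" "integrable (ivl a b) f"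
  shows "f integrable_on {a..b}" "(LINT x|ivl a b. f x) = integral {a..b} f"
proof -
  have "set_integrable lborel {a..b} f"
    using assms integrable_ivl_iff by blast
  then show "f integrable_on {a..b}" "(LINT x|ivl a b. f x) = integral {a..b} f"
    using set_borel_integral_eq_integral[of "{a..b}" f] integral_ivl_lborel[OF assms(1)]
    by (simp_all add: set_lebesgue_integral_def)
qed

lemma bdd_borel_ivl_integrable: "bdd_borel B f \<Longrightarrow> integrable (ivl a b) f"
  by (rule bdd_borel_integrable[OF ivl.finite_measure_axioms sets_ivl])

lemma integral_ivl_bdd:
  assumes "bdd_borel B f"
  shows "f integrable_on {a..b}" "(LINT x|ivl a b. f x) = integral {a..b} f"
  using integral_ivl[OF bdd_borelD(1)[OF assms] bdd_borel_ivl_integrable[OF assms]]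
  by auto

lemma integrable_ivl_nonneg:
  fixes f :: "real \<Rightarrow> real"
  assumes "f \<in> borel_measurable borel" "\<And>x. x \<in> {a..b} \<Longrightarrow> 0 \<le> f x" "f integrable_on {a..b}"
  shows "integrable (ivl a b) f"
proof -
  have "f absolutely_integrable_on {a..b}"
    using assms by (intro nonnegative_absolutely_integrable_1) auto
  then have "set_integrable lborel {a..b} f"
    unfolding set_integrable_def
    by (subst (asm) integrable_completion) (use assms(1) in auto)
  then show ?thesis
    using integrable_ivl_iff[OF assms(1)] by simp
qed

lemma periodic_int:
  fixes f :: "real \<Rightarrow> 'a"
  assumes "\<And>x. f (x + 1) = f x"
  shows "f (x + of_int k) = f x"
proof (induction k rule: int_induct[where k=0])
  case (step1 i)
  then show ?case using assms[of "x + of_int i"] by (simp add: algebra_simps)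
next
  case (step2 i)
  then show ?case using assms[of "x + of_int i - 1"] by (simp add: algebra_simps)
qed auto

lemma bdd_borel_shift:
  assumes "bdd_borel B (f :: real \<Rightarrow> real)"
  shows "bdd_borel B (\<lambda>x. f (x + a))"
  using assms unfolding bdd_borel_def by (auto intro: measurable_compose[where N=borel])

lemma integral_ivl_shift:
  assumes "bdd_borel B f"
  shows "(LINT x|ivl a b. f (x + c)) = (LINT x|ivl (a + c) (b + c). f x)"
proof -
  have m: "f \<in> borel_measurable borel" using assms bdd_borelD by blast
  have "(LINT x|ivl (a + c) (b + c). f x) = (LINT x|lborel. indicator {a + c..b + c} x * f x)"
    by (rule integral_ivl_lborel[OF m])
  also have "\<dots> = (LINT x|lborel. indicator {a + c..b + c} (c + 1 * x) * f (c + 1 * x))"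
    by (subst lborel_integral_real_affine[where c=1 and t=c]) (auto simp: add.commute)
  also have "\<dots> = (LINT x|lborel. indicator {a..b} x * f (x + c))"
    by (intro Bochner_Integration.integral_cong) (auto simp: indicator_def add.commute)
  also have "\<dots> = (LINT x|ivl a b. f (x + c))"
    by (rule integral_ivl_lborel[symmetric]) (use bdd_borel_shift[OF assms] bdd_borelD in blast)
  finally show ?thesis by simp
qed

lemma integral_ivl_combine:
  assumes "bdd_borel B f" "a \<le> b" "b \<le> c"
  shows "(LINT x|ivl a c. f x) = (LINT x|ivl a b. f x) + (LINT x|ivl b c. f x)"
  unfolding integral_ivl_bdd(2)[OF assms(1)]
  by (rule Henstock_Kurzweil_Integration.integral_combine[symmetric])
     (use assms integral_ivl_bdd(1) in auto)

text \<open>Only the fractional part of the shift matters; the piece of the window beyond 1 is moved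
  back by one period.\<close>

lemma integral_periodic_shift:
  assumes f: "bdd_borel B f" and per: "\<And>x. f (x + 1) = f x"
  shows "(LINT x|ivl 0 1. f (x + a)) = (LINT x|ivl 0 1. f x)"
proof -
  define r where "r = frac a"
  have r: "0 \<le> r" "r < 1" by (auto simp: r_def frac_lt_1)
  have fr: "f (x + a) = f (x + r)" for x
    using periodic_int[of f "x + r" "\<lfloor>a\<rfloor>"] per by (simp add: r_def frac_def algebra_simps)
  have "(LINT x|ivl 0 1. f (x + a)) = (LINT x|ivl r (1 + r). f x)"
    unfolding fr using integral_ivl_shift[OF f, of 0 1 r] by simp
  also have "\<dots> = (LINT x|ivl r 1. f x) + (LINT x|ivl 1 (1 + r). f x)"
    using r by (intro integral_ivl_combine[OF f]) auto
  also have "(LINT x|ivl 1 (1 + r). f x) = (LINT x|ivl 0 r. f (x + 1))"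
    using integral_ivl_shift[OF f, of 0 r 1] by (simp add: add.commute)
  also have "\<dots> = (LINT x|ivl 0 r. f x)"
    by (simp add: per)
  finally show ?thesis
    using integral_ivl_combine[OF f, of 0 r 1] r by simp
qed

text \<open>Substitution gives a window of half-length s with prefactor 1/s. Since s <= 1, the
  window lies in one of length 2, that is, in two periods; this is the factor 2.\<close>

lemma integral_periodic_scaled_le:
  assumes f: "bdd_borel B f" and per: "\<And>x. f (x + 1) = f x" and nn: "\<And>x. 0 \<le> f x"
    and s: "0 < s" "s \<le> 1"
  shows "(LINT z|ivl (-1) 1. f (x + s * z)) \<le> 2 / s * (LINT x|ivl 0 1. f x)"
proof -
  have m: "f \<in> borel_measurable borel" using f bdd_borelD by blast
  have fs: "bdd_borel B (\<lambda>w. f (w + x))" by (rule bdd_borel_shift[OF f])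
  have m2: "(\<lambda>w. f (w + x)) \<in> borel_measurable borel" using fs bdd_borelD by blast
  have [measurable]: "(\<lambda>z. f (x + s * z)) \<in> borel_measurable borel"
    using m by (auto intro: measurable_compose[where N=borel])
  have "(LINT w|ivl (-s) s. f (w + x)) = (LINT w|lborel. indicator {-s..s} w * f (w + x))"
    by (rule integral_ivl_lborel[OF m2])
  also have "\<dots> = s * (LINT z|lborel. indicator {-s..s} (0 + s * z) * f ((0 + s * z) + x))"
    using s by (subst lborel_integral_real_affine[where c=s and t=0]) auto
  also have "(LINT z|lborel. indicator {-s..s} (0 + s * z) * f ((0 + s * z) + x))
      = (LINT z|lborel. indicator {-1..1} z * f (x + s * z))"
  proof (intro Bochner_Integration.integral_cong refl)
    fix z
    have "-s \<le> s * z \<longleftrightarrow> -1 \<le> z" "s * z \<le> s \<longleftrightarrow> z \<le> 1"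
      using s by (auto simp: mult_le_cancel_left2 minus_le_iff) 
         (metis mult.right_neutral mult_le_cancel_left_pos mult_minus_right neg_le_iff_le minus_le_iff)+
    then show "indicator {-s..s} (0 + s * z) * f ((0 + s * z) + x) = indicator {-1..1} z * f (x + s * z)"
      by (auto simp: indicator_def add.commute)
  qed
  also have "\<dots> = (LINT z|ivl (-1) 1. f (x + s * z))"
    by (rule integral_ivl_lborel[symmetric]) measurable
  finally have 1: "(LINT z|ivl (-1) 1. f (x + s * z)) = (LINT w|ivl (-s) s. f (w + x)) / s"
    using s by simp
  have i: "(\<lambda>w. f (w + x)) integrable_on {c..d}" for c d by (rule integral_ivl_bdd[OF fs])
  have "(LINT w|ivl (-s) s. f (w + x)) \<le> (LINT w|ivl (-1) 1. f (w + x))"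
    unfolding integral_ivl_bdd(2)[OF fs]
    by (rule integral_subset_le) (use s nn i in auto)
  also have "\<dots> = (LINT w|ivl (-1) 0. f (w + x)) + (LINT w|ivl 0 1. f (w + x))"
    by (rule integral_ivl_combine[OF fs]) auto
  also have "(LINT w|ivl (-1) 0. f (w + x)) = (LINT w|ivl 0 1. f ((w + - 1) + x))"
    using integral_ivl_shift[OF fs, of 0 1 "-1"] by simp
  also have "\<dots> = (LINT w|ivl 0 1. f (w + (x - 1)))"
    by (simp add: algebra_simps)
  finally have "(LINT w|ivl (-s) s. f (w + x)) \<le> 2 * (LINT x|ivl 0 1. f x)"
    using integral_periodic_shift[OF f per] by simp
  then show ?thesis
    unfolding 1 using s by (simp add: divide_right_mono)
qed

section \<open>Squares and period cells in the plane\<close>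

definition sqm :: "real \<Rightarrow> real \<Rightarrow> R2 measure" where
  "sqm a b = ivl a b \<Otimes>\<^sub>M ivl a b"

lemma sets_sqm [simp, measurable_cong]: "sets (sqm a b) = sets borel"
proof -
  have "sets (sqm a b) = sets (borel \<Otimes>\<^sub>M borel :: R2 measure)"
    unfolding sqm_def by (intro sets_pair_measure_cong) auto
  then show ?thesis unfolding borel_prod .
qed

lemma space_sqm [simp]: "space (sqm a b) = UNIV"
  by (simp add: sqm_def space_pair_measure)

lemma pair_sigma_finite_finite:
  "finite_measure M \<Longrightarrow> finite_measure N \<Longrightarrow> pair_sigma_finite M N"
  by (simp add: finite_measure_def pair_sigma_finite_def)

interpretation ivlp: pair_sigma_finite "ivl a b" "ivl c d"
  by (intro pair_sigma_finite_finite ivl.finite_measure_axioms)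

interpretation sqm: finite_measure "sqm a b"
  unfolding sqm_def
  by (intro finite_measure_pair_measure ivl.finite_measure_axioms)

lemma measure_sqm: "a \<le> b \<Longrightarrow> measure (sqm a b) UNIV = (b - a)\<^sup>2"
proof -
  assume ab: "a \<le> b"
  have "emeasure (sqm a b) (UNIV \<times> UNIV) = ennreal (b - a) * ennreal (b - a)"
    unfolding sqm_def using ab
    by (subst ivl.emeasure_pair_measure_Times) (auto simp: emeasure_ivl)
  then show ?thesis
    using ab by (simp add: measure_def ennreal_mult[symmetric] power2_eq_square)
qed

lemma integral_sqm:
  fixes f :: "R2 \<Rightarrow> real"
  assumes "integrable (sqm a b) f"
  shows "(LINT p|sqm a b. f p) = (LINT x|ivl a b. LINT y|ivl a b. f (x, y))"
  using ivlp.integral_fst'[of a b a b f] assms by (simp add: sqm_def)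

lemma sqm_eq_density: "sqm a b = density lborel (\<lambda>p. ennreal (indicator (cbox (a, a) (b, b)) p))"
proof -
  have "sqm a b = density (lborel \<Otimes>\<^sub>M lborel)
     (\<lambda>(x, y). ennreal (indicator {a..b} x) * ennreal (indicator {a..b} y))"
    unfolding sqm_def ivl_def
    by (rule pair_measure_density)
       (auto simp: ivl_def[symmetric] lborel.sigma_finite_measure_axioms ivl.sigma_finite_measure_axioms)
  also have "(\<lambda>(x, y). ennreal (indicator {a..b} x) * ennreal (indicator {a..b} y))
      = (\<lambda>p. ennreal (indicator (cbox (a, a) (b, b)) p))"
    by (auto simp: fun_eq_iff indicator_def cbox_Pair_eq)
  finally show ?thesis by (simp add: lborel_prod)
qed

lemma integral_sqm_lborel:
  fixes f :: "R2 \<Rightarrow> real"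
  assumes "f \<in> borel_measurable borel"
  shows "(LINT p|sqm a b. f p) = (LINT p|lborel. indicator (cbox (a, a) (b, b)) p * f p)"
  unfolding sqm_eq_density by (subst integral_density) (use assms in auto)

lemma bdd_borel_sqm_integrable: "bdd_borel B f \<Longrightarrow> integrable (sqm a b) f"
  by (rule bdd_borel_integrable[OF sqm.finite_measure_axioms sets_sqm])

lemma integral_unit_sq:
  assumes "bdd_borel B f"
  shows "f integrable_on unit_sq" "integral unit_sq f = (LINT p|sqm 0 1. f p)"
proof -
  have m: "f \<in> borel_measurable borel" using assms bdd_borelD by blast
  have "integrable (sqm 0 1) f" by (rule bdd_borel_sqm_integrable[OF assms])
  then have "set_integrable lborel unit_sq f"
    unfolding sqm_eq_density set_integrable_def unit_sq_def
    by (subst (asm) integrable_density) (use m in auto)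
  then show "f integrable_on unit_sq" "integral unit_sq f = (LINT p|sqm 0 1. f p)"
    using set_borel_integral_eq_integral[of unit_sq f] integral_sqm_lborel[OF m]
    by (simp_all add: set_lebesgue_integral_def unit_sq_def)
qed

lemma bdd_borel_compose:
  assumes "bdd_borel B f" "g \<in> borel_measurable borel"
  shows "bdd_borel B (\<lambda>x. f (g x))"
  using assms unfolding bdd_borel_def by (auto intro: measurable_compose[where N=borel])

lemma bdd_borel_slice:
  fixes f :: "R2 \<Rightarrow> real"
  assumes "bdd_borel B f"
  shows "bdd_borel B (\<lambda>y. f (x, y))" "bdd_borel B (\<lambda>x. f (x, y))"
  by (rule bdd_borel_compose[OF assms];
      auto intro!: borel_measurable_continuous_onI continuous_intros)+

lemma bdd_borel_mult:
  fixes u v :: "R2 \<Rightarrow> real"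
  assumes "bdd_borel C u" "bdd_borel D v"
  shows "bdd_borel (C * D) (\<lambda>p. u p * v p)"
proof (rule bdd_borelI)
  show "(\<lambda>p. u p * v p) \<in> borel_measurable borel"
    using bdd_borelD(1)[OF assms(1)] bdd_borelD(1)[OF assms(2)] by measurable
  show "\<bar>u p * v p\<bar> \<le> C * D" for p
    unfolding abs_mult
    by (intro mult_mono bdd_borelD(2)[OF assms(1)] bdd_borelD(2)[OF assms(2)] bdd_borelD(3)[OF assms(1)]) auto
qed

lemma bdd_borel_integral_slice:
  fixes f :: "R2 \<Rightarrow> real"
  assumes "bdd_borel B f" "a \<le> b"
  shows "bdd_borel ((b - a) * B) (\<lambda>x. LINT y|ivl a b. f (x, y))"
    "bdd_borel ((b - a) * B) (\<lambda>y. LINT x|ivl a b. f (x, y))"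
proof -
  have m: "case_prod (\<lambda>x y. f (x, y)) \<in> borel_measurable (borel \<Otimes>\<^sub>M borel)"
    using bdd_borelD(1)[OF assms(1)] by (simp add: borel_prod)
  have m1[measurable]: "case_prod (\<lambda>x y. f (x, y)) \<in> borel_measurable (borel \<Otimes>\<^sub>M ivl a b)"
    using m by simp
  have m': "case_prod (\<lambda>y x. f (x, y)) \<in> borel_measurable (borel \<Otimes>\<^sub>M borel)"
    using measurable_compose[OF measurable_pair_swap' m]
    by (simp add: split_beta' )
  have m2[measurable]: "case_prod (\<lambda>y x. f (x, y)) \<in> borel_measurable (borel \<Otimes>\<^sub>M ivl a b)"
    using m' by simp
  have bound: "\<bar>LINT y|ivl a b. g y\<bar> \<le> (b - a) * B" if "bdd_borel B g" for g
  proof -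
    have "\<bar>LINT y|ivl a b. g y\<bar> \<le> (LINT y|ivl a b. \<bar>g y\<bar>)"
      using integral_norm_bound[of "ivl a b" g] by simp
    also have "\<dots> \<le> (LINT y|ivl a b. B)"
      by (intro integral_mono integrable_abs
            bdd_borel_ivl_integrable[OF that]) (use that in \<open>auto simp: bdd_borelD\<close>)
    finally show ?thesis using assms(2) by (simp add: measure_ivl)
  qed
  show "bdd_borel ((b - a) * B) (\<lambda>x. LINT y|ivl a b. f (x, y))"
    "bdd_borel ((b - a) * B) (\<lambda>y. LINT x|ivl a b. f (x, y))"
    by (auto intro!: bdd_borelI bound bdd_borel_slice[OF assms(1)]
        ivl.borel_measurable_lebesgue_integral m1 m2 simp: bdd_borelD(2)[OF assms(1)])
qed

lemma integral_cell_shift: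
  assumes f: "bdd_borel B f" and per: "periodic2 f"
  shows "(LINT p|sqm 0 1. f (p + c)) = (LINT p|sqm 0 1. f p)"
proof -
  obtain c1 c2 where c: "c = (c1, c2)" by fastforce
  have f': "bdd_borel B (\<lambda>p. f (p + c))" by (rule bdd_borel_compose[OF f]) auto
  have p1: "f (x + 1, y) = f (x, y)" and p2: "f (x, y + 1) = f (x, y)" for x y
    using per by (auto simp: periodic2_def)
  have "(LINT p|sqm 0 1. f (p + c)) = (LINT x|ivl 0 1. LINT y|ivl 0 1. f (x + c1, y + c2))"
    using integral_sqm[OF bdd_borel_sqm_integrable[OF f']] by (simp add: c)
  also have "\<dots> = (LINT x|ivl 0 1. LINT y|ivl 0 1. f (x + c1, y))"
    using p2 by (intro Bochner_Integration.integral_cong refl integral_periodic_shift[OF bdd_borel_slice(1)[OF f]])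
  also have "\<dots> = (LINT x|ivl 0 1. LINT y|ivl 0 1. f (x, y))"
    by (rule integral_periodic_shift[OF bdd_borel_integral_slice(1)[OF f]]) (auto simp: p1)
  also have "\<dots> = (LINT p|sqm 0 1. f p)"
    using integral_sqm[OF bdd_borel_sqm_integrable[OF f]] by simp
  finally show ?thesis .
qed

text \<open>One factor 2/s per coordinate, by Fubini. This is the bound at scale s that sees only
  the \<open>L^1\<close> norm over a cell.\<close>

lemma integral_cell_scaled_le:
  assumes f: "bdd_borel B f" and per: "periodic2 f" and nn: "\<And>x. 0 \<le> f x"
    and s: "0 < s" "s \<le> 1"
  shows "(LINT z|sqm (-1) 1. f (p + s *\<^sub>R z)) \<le> 4 / s\<^sup>2 * (LINT p|sqm 0 1. f p)"
proof -
  obtain c1 c2 where c: "p = (c1, c2)" by fastforce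
  have f': "bdd_borel B (\<lambda>z. f (p + s *\<^sub>R z))" by (rule bdd_borel_compose[OF f]) auto
  have p1: "f (x + 1, y) = f (x, y)" and p2: "f (x, y + 1) = f (x, y)" for x y
    using per by (auto simp: periodic2_def)
  note sl = bdd_borel_integral_slice(1)[OF f, of 0 1, simplified]
  have nn2: "0 \<le> (LINT y|ivl 0 1. f (x, y))" for x
    by (rule Bochner_Integration.integral_nonneg) (simp add: nn)
  have fp: "bdd_borel B (\<lambda>z. f (c1 + s * fst z, c2 + s * snd z))"
    by (rule bdd_borel_compose[OF f]) (auto intro!: borel_measurable_continuous_onI continuous_intros)
  have "(LINT z|sqm (-1) 1. f (p + s *\<^sub>R z)) = (LINT x|ivl (-1) 1. LINT y|ivl (-1) 1. f (c1 + s * x, c2 + s * y))"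
    using integral_sqm[OF bdd_borel_sqm_integrable[OF f']] by (simp add: c)
  also have "\<dots> \<le> (LINT x|ivl (-1) 1. 2 / s * (LINT y|ivl 0 1. f (c1 + s * x, y)))"
  proof (rule integral_mono)
    show "integrable (ivl (-1) 1) (\<lambda>x. LINT y|ivl (-1) 1. f (c1 + s * x, c2 + s * y))"
      using bdd_borel_integral_slice(1)[OF fp, of "-1" 1]
      by (auto intro: bdd_borel_ivl_integrable)
    have "bdd_borel B (\<lambda>x. LINT y|ivl 0 1. f (c1 + s * x, y))"
      by (rule bdd_borel_compose[OF sl]) auto
    then show "integrable (ivl (-1) 1) (\<lambda>x. 2 / s * (LINT y|ivl 0 1. f (c1 + s * x, y)))"
      by (intro integrable_mult_right bdd_borel_ivl_integrable)
    show "(LINT y|ivl (-1) 1. f (c1 + s * x, c2 + s * y)) \<le> 2 / s * (LINT y|ivl 0 1. f (c1 + s * x, y))" for x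
      using p2 nn s by (intro integral_periodic_scaled_le[OF bdd_borel_slice(1)[OF f]]) auto
  qed
  also have "\<dots> = 2 / s * (LINT x|ivl (-1) 1. (LINT y|ivl 0 1. f (c1 + s * x, y)))"
    by simp
  also have "\<dots> \<le> 2 / s * (2 / s * (LINT x|ivl 0 1. (LINT y|ivl 0 1. f (x, y))))"
    using s nn2 by (intro mult_left_mono integral_periodic_scaled_le[OF sl]) (auto simp: p1)
  also have "\<dots> = 4 / s\<^sup>2 * (LINT p|sqm 0 1. f p)"
    using integral_sqm[OF bdd_borel_sqm_integrable[OF f]] by (simp add: power2_eq_square)
  finally show ?thesis .
qed

section \<open>Averaging operators\<close>

text \<open>Common form of the operators: for convolution with \<open>hker\<close>, N is the square
  and \<open>\<xi>\<close> the identity; for the potential and its gradient, N is scales times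
  square and \<open>\<xi> (s, z) = s z\<close>. Sup bounds, periodicity, pointwise limits and
  duality are then shown once.\<close>

locale averaging = finite_measure N for N :: "'a measure" +
  fixes w :: "'a \<Rightarrow> real" and \<xi> :: "'a \<Rightarrow> R2" and W :: real
  assumes w [measurable]: "w \<in> borel_measurable N"
    and \<xi> [measurable]: "\<xi> \<in> borel_measurable N"
    and W: "\<And>t. \<bar>w t\<bar> \<le> W"
begin

definition av :: "(R2 \<Rightarrow> real) \<Rightarrow> R2 \<Rightarrow> real" where
  "av b p = (LINT t|N. w t * b (p + \<xi> t))"

definition wmass :: real where "wmass = (LINT t|N. \<bar>w t\<bar>)"

lemma W_nonneg: "0 \<le> W"
  using W[of undefined] by linarith

lemma integrable_w: "integrable N w"
  by (rule integrable_const_bound[of _ W]) (auto simp: W)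

lemma integrable_av:
  assumes "bdd_borel B b"
  shows "integrable N (\<lambda>t. w t * b (p + \<xi> t))"
proof (rule integrable_const_bound[of _ "W * B"])
  have [measurable]: "b \<in> borel_measurable borel" using assms bdd_borelD by blast
  show "(\<lambda>t. w t * b (p + \<xi> t)) \<in> borel_measurable N" by measurable
  show "AE t in N. norm (w t * b (p + \<xi> t)) \<le> W * B"
    by (auto simp: abs_mult intro!: AE_I2 mult_mono W bdd_borelD(2)[OF assms] W_nonneg)
qed

lemma abs_av_le:
  assumes "bdd_borel B b"
  shows "\<bar>av b p\<bar> \<le> wmass * B"
proof -
  have "\<bar>av b p\<bar> \<le> (LINT t|N. \<bar>w t * b (p + \<xi> t)\<bar>)"
    unfolding av_def using integral_norm_bound[of N "\<lambda>t. w t * b (p + \<xi> t)"] by simp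
  also have "\<dots> \<le> (LINT t|N. \<bar>w t\<bar> * B)"
    using integrable_w
    by (intro integral_mono integrable_abs integrable_av[OF assms] integrable_mult_left)
       (auto simp: abs_mult bdd_borelD(2)[OF assms] intro!: mult_left_mono)
  finally show ?thesis by (simp add: wmass_def)
qed

lemma bdd_borel_av:
  assumes "bdd_borel B b"
  shows "bdd_borel (wmass * B) (av b)"
proof (rule bdd_borelI)
  have [measurable]: "b \<in> borel_measurable borel" using assms bdd_borelD by blast
  have "(\<lambda>p. LINT t|N. w t * b (p + \<xi> t)) \<in> borel_measurable borel"
    by (rule borel_measurable_lebesgue_integral) measurable
  then show "av b \<in> borel_measurable borel" by (simp add: av_def[abs_def])
qed (rule abs_av_le[OF assms])

lemma av_add:
  assumes "bdd_borel B b" "bdd_borel B' b'"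
  shows "av (\<lambda>p. b p + b' p) p = av b p + av b' p"
  using integrable_av[OF assms(1)] integrable_av[OF assms(2)]
  by (simp add: av_def distrib_left)

lemma av_diff:
  assumes "bdd_borel B b" "bdd_borel B' b'"
  shows "av (\<lambda>p. b p - b' p) p = av b p - av b' p"
  using integrable_av[OF assms(1)] integrable_av[OF assms(2)]
  by (simp add: av_def right_diff_distrib)

lemma av_cmult: "av (\<lambda>p. c * b p) p = c * av b p"
  by (simp add: av_def mult.left_commute)

lemma av_shift: "av (\<lambda>p. b (p + c)) p = av b (p + c)"
  by (simp add: av_def add_ac)

lemma periodic2_av: "periodic2 b \<Longrightarrow> periodic2 (av b)"
proof -
  assume b: "periodic2 b"
  have 1: "b ((x + 1, y) + q) = b ((x, y) + q)" for x y q
    using b[unfolded periodic2_def, rule_format, of "x + fst q" "y + snd q"]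
    by (cases q) (simp add: add_ac)
  have 2: "b ((x, y + 1) + q) = b ((x, y) + q)" for x y q
    using b[unfolded periodic2_def, rule_format, of "x + fst q" "y + snd q"]
    by (cases q) (simp add: add_ac)
  show ?thesis
    unfolding periodic2_def av_def by (simp only: 1 2) simp
qed

lemma av_tendsto:
  assumes "\<And>n. bdd_borel B (f n)" "bdd_borel B b" "\<And>q. (\<lambda>n. f n q) \<longlonglongrightarrow> b q"
  shows "(\<lambda>n. av (f n) p) \<longlonglongrightarrow> av b p"
  unfolding av_def
proof (rule integral_dominated_convergence[where w = "\<lambda>_. W * B"])
  have [measurable]: "b \<in> borel_measurable borel" "\<And>n. f n \<in> borel_measurable borel"
    using assms bdd_borelD by blast+
  show "(\<lambda>t. w t * b (p + \<xi> t)) \<in> borel_measurable N" by measurable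
  show "(\<lambda>t. w t * f n (p + \<xi> t)) \<in> borel_measurable N" for n by measurable
  show "AE t in N. norm (w t * f n (p + \<xi> t)) \<le> W * B" for n
    by (auto simp: abs_mult intro!: AE_I2 mult_mono W bdd_borelD(2)[OF assms(1)] W_nonneg)
  show "AE t in N. (\<lambda>n. w t * f n (p + \<xi> t)) \<longlonglongrightarrow> w t * b (p + \<xi> t)"
    by (auto intro!: AE_I2 tendsto_intros assms(3))
qed simp

text \<open>Fubini and translation invariance over a cell: the adjoint averages over the opposite
  displacements. This lets the calculus take place on the test function, although b is only
  measurable.\<close>

lemma av_dual:
  assumes b: "bdd_borel B b" "periodic2 b" and f: "bdd_borel C f" "periodic2 f"
  shows "(LINT p|sqm 0 1. av b p * f p) = (LINT p|sqm 0 1. b p * (LINT t|N. w t * f (p - \<xi> t)))"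
proof -
  interpret P: pair_sigma_finite "sqm 0 1" N
    by (intro pair_sigma_finite_finite sqm.finite_measure_axioms finite_measure_axioms)
  interpret PN: finite_measure "sqm 0 1 \<Otimes>\<^sub>M N"
    by (intro finite_measure_pair_measure sqm.finite_measure_axioms finite_measure_axioms)
  have [measurable]: "b \<in> borel_measurable borel" "f \<in> borel_measurable borel"
    using b f bdd_borelD by blast+
  have bd: "\<bar>b p\<bar> \<le> B" "\<bar>f p\<bar> \<le> C" "0 \<le> B" "0 \<le> C" for p
    using b f bdd_borelD by blast+
  have bound: "\<bar>w t * b p * f q\<bar> \<le> W * B * C" for t p q
    unfolding abs_mult using bd W W_nonneg by (intro mult_mono) auto
  have i1: "integrable (sqm 0 1 \<Otimes>\<^sub>M N) (\<lambda>(p, t). w t * b (p + \<xi> t) * f p)"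
    by (rule PN.integrable_const_bound[of _ "W * B * C"]) (auto simp: bound split_beta')
  have i2: "integrable (sqm 0 1 \<Otimes>\<^sub>M N) (\<lambda>(p, t). w t * b p * f (p - \<xi> t))"
    by (rule PN.integrable_const_bound[of _ "W * B * C"]) (auto simp: bound split_beta')
  have sh: "(LINT p|sqm 0 1. w t * b (p + \<xi> t) * f p) = (LINT p|sqm 0 1. w t * b p * f (p - \<xi> t))" for t
  proof -
    let ?g = "\<lambda>p. w t * b p * f (p - \<xi> t)"
    have "bdd_borel (W * B * C) ?g"
      by (rule bdd_borelI) (auto simp: bound)
    moreover have "periodic2 ?g"
    proof -
      obtain c1 c2 where c: "\<xi> t = (c1, c2)" by fastforce
      have "f (x + 1 - c1, y) = f (x - c1, y)" "f (x, y + 1 - c2) = f (x, y - c2)" for x y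
        using f(2)[unfolded periodic2_def, rule_format, of "x - c1" y]
          f(2)[unfolded periodic2_def, rule_format, of x "y - c2"]
        by (simp_all add: diff_add_eq)
      then show ?thesis
        using b(2) unfolding periodic2_def c by simp
    qed
    ultimately show ?thesis
      using integral_cell_shift[of _ ?g "\<xi> t"] by simp
  qed
  have "(LINT p|sqm 0 1. av b p * f p) = (LINT p|sqm 0 1. LINT t|N. w t * b (p + \<xi> t) * f p)"
    unfolding av_def by simp
  also have "\<dots> = (LINT t|N. LINT p|sqm 0 1. w t * b (p + \<xi> t) * f p)"
    using P.Fubini_integral[OF i1] by simp
  also have "\<dots> = (LINT t|N. LINT p|sqm 0 1. w t * b p * f (p - \<xi> t))"
    by (simp only: sh)
  also have "\<dots> = (LINT p|sqm 0 1. LINT t|N. w t * b p * f (p - \<xi> t))"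
    using P.Fubini_integral[OF i2] by simp
  also have "\<dots> = (LINT p|sqm 0 1. b p * (LINT t|N. w t * f (p - \<xi> t)))"
    by (subst integral_mult_right_zero[symmetric]) (simp add: mult_ac)
  finally show ?thesis .
qed

lemma integral_av:
  assumes b: "bdd_borel B b" "periodic2 b"
  shows "(LINT p|sqm 0 1. av b p) = (LINT p|sqm 0 1. b p) * (LINT t|N. w t)"
proof -
  \<comment> \<open>Duality against the constant function 1.\<close>
  have "bdd_borel 1 (\<lambda>p::R2. 1)" by (rule bdd_borelI) auto
  from av_dual[OF b this] show ?thesis by (simp add: periodic2_def)
qed

end

section \<open>Estimates for integrals over the scale\<close>

lemma AE_ivl_01: "AE s in ivl 0 1. 0 < s \<and> s \<le> 1"
proof -
  have "AE s in lborel. s \<noteq> (0::real)" by (rule AE_lborel_singleton)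
  then show ?thesis
    unfolding ivl_def by (subst AE_density) (auto elim!: eventually_mono simp: indicator_def split: if_splits)
qed

text \<open>The estimate is available for s > 0 only; the endpoint is a null set, and
  \<open>0 <= G 0\<close> makes the majorant nonnegative on the whole interval.\<close>

lemma abs_integral_ivl_le:
  fixes F G :: "real \<Rightarrow> real"
  assumes F: "F \<in> borel_measurable borel" and G: "G \<in> borel_measurable borel"
    and le: "\<And>s. 0 < s \<Longrightarrow> s \<le> 1 \<Longrightarrow> \<bar>F s\<bar> \<le> G s" and I: "(G has_integral I) {0..1}"
    and G0: "0 \<le> G 0"
  shows "\<bar>LINT s|ivl 0 1. F s\<bar> \<le> I"
proof -
  have nn: "0 \<le> G s" if "s \<in> {0..1}" for s
    using that le[of s] G0 abs_ge_zero[of "F s"] by (cases "s = 0") auto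
  have iG: "integrable (ivl 0 1) G"
    by (rule integrable_ivl_nonneg[OF G]) (use nn I in auto)
  have ae: "AE s in ivl 0 1. \<bar>F s\<bar> \<le> G s"
    using AE_ivl_01 le by (auto elim: eventually_mono)
  have iF: "integrable (ivl 0 1) F"
    by (rule Bochner_Integration.integrable_bound[OF iG]) (use F ae in \<open>auto elim!: eventually_mono\<close>)
  have "\<bar>LINT s|ivl 0 1. F s\<bar> \<le> (LINT s|ivl 0 1. \<bar>F s\<bar>)"
    using integral_norm_bound[of "ivl 0 1" F] by simp
  also have "\<dots> \<le> (LINT s|ivl 0 1. G s)"
    by (rule integral_mono_AE) (use iF iG ae in auto)
  also have "\<dots> = I"
    using integral_ivl(2)[OF G iG] I by (simp add: integral_unique)
  finally show ?thesis .
qed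

lemma integral_ivl_powr_bound:
  assumes F: "F \<in> borel_measurable borel" and \<beta>: "0 \<le> \<beta>" "\<beta> < 1" and C: "0 \<le> C"
    and le: "\<And>s. 0 < s \<Longrightarrow> s \<le> 1 \<Longrightarrow> \<bar>F s\<bar> \<le> C * s powr (- \<beta>)"
  shows "\<bar>LINT s|ivl 0 1. F s\<bar> \<le> C / (1 - \<beta>)"
proof (rule abs_integral_ivl_le[OF F _ le])
  have "((\<lambda>s. s powr (-\<beta>)) has_integral (1 powr (-\<beta> + 1) / (-\<beta> + 1))) {0..1}"
    by (rule has_integral_powr_from_0) (use \<beta> in auto)
  from has_integral_mult_right[OF this, of C]
  show "((\<lambda>s. C * s powr (-\<beta>)) has_integral C / (1 - \<beta>)) {0..1}" by simp
qed (use C in auto)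

text \<open>The integrand is at most \<open>C min(1, m / s^2)\<close>, which is dominated by
  \<open>2 C m / (s^2 + m)\<close>. The integral of the latter is \<open>2 C sqrt m\<close> times an
  arctangent, and arctan is below 2.\<close>

lemma integral_ivl_sqrt_bound:
  assumes F: "F \<in> borel_measurable borel" and m: "0 < m" and C: "0 \<le> C"
    and le1: "\<And>s. 0 < s \<Longrightarrow> s \<le> 1 \<Longrightarrow> \<bar>F s\<bar> \<le> C"
    and le2: "\<And>s. 0 < s \<Longrightarrow> s \<le> 1 \<Longrightarrow> \<bar>F s\<bar> * s\<^sup>2 \<le> C * m"
  shows "\<bar>LINT s|ivl 0 1. F s\<bar> \<le> 4 * C * sqrt m"
proof -
  define G where "G s = C * (2 * m / (s\<^sup>2 + m))" for s :: real
  have pos: "s\<^sup>2 + m > 0" for s :: real using m by (simp add: add_nonneg_pos)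
  have pos': "s\<^sup>2 + m \<noteq> 0" for s :: real using pos[of s] by simp
  have cG: "continuous_on UNIV G"
    unfolding G_def by (intro continuous_intros) (simp add: pos')
  have "((\<lambda>s. C * 2 * sqrt m * arctan (s / sqrt m)) has_real_derivative G s) (at s within {0..1})" for s
  proof -
    have "1 + (s / sqrt m)\<^sup>2 = (s\<^sup>2 + m) / m" using m by (simp add: power_divide field_simps)
    then have "C * 2 * sqrt m * (inverse (1 + (s / sqrt m)\<^sup>2) * (1 / sqrt m)) = G s"
      using m by (simp add: G_def)
    moreover have "((\<lambda>s. s / sqrt m) has_real_derivative 1 / sqrt m) (at s within {0..1})"
      by (rule DERIV_cdivide[OF DERIV_ident])
    from DERIV_cmult[OF DERIV_chain2[OF DERIV_arctan this], of "C * 2 * sqrt m"]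
    have "((\<lambda>s. C * 2 * sqrt m * arctan (s / sqrt m)) has_real_derivative
        C * 2 * sqrt m * (inverse (1 + (s / sqrt m)\<^sup>2) * (1 / sqrt m))) (at s within {0..1})" .
    ultimately show ?thesis by simp
  qed
  then have "((\<lambda>s. C * 2 * sqrt m * arctan (s / sqrt m)) has_vector_derivative G s) (at s within {0..1})" for s
    unfolding has_real_derivative_iff_has_vector_derivative .
  then have "(G has_integral (C * 2 * sqrt m * arctan (1 / sqrt m) - C * 2 * sqrt m * arctan (0 / sqrt m))) {0..1}"
    by (rule fundamental_theorem_of_calculus[rotated]) simp
  then have I: "(G has_integral (C * 2 * sqrt m * arctan (1 / sqrt m))) {0..1}" by simp
  have "\<bar>F s\<bar> \<le> G s" if s: "0 < s" "s \<le> 1" for s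
  proof (cases "s\<^sup>2 \<le> m")
    case True
    then have "1 \<le> 2 * m / (s\<^sup>2 + m)" using pos[of s] by (simp add: field_simps)
    then have "C * 1 \<le> G s" unfolding G_def using C by (intro mult_left_mono) auto
    then show ?thesis using le1[OF s] by simp
  next
    case False
    have "\<bar>F s\<bar> \<le> C * m / s\<^sup>2" using le2[OF s] s by (simp add: field_simps)
    also have "\<dots> \<le> G s"
    proof -
      have "m / s\<^sup>2 \<le> 2 * m / (s\<^sup>2 + m)"
        using False m s pos[of s] by (simp add: field_simps)
      then show ?thesis unfolding G_def using C mult_left_mono by fastforce
    qed
    finally show ?thesis .
  qed
  then have "\<bar>LINT s|ivl 0 1. F s\<bar> \<le> C * 2 * sqrt m * arctan (1 / sqrt m)"
    by (intro abs_integral_ivl_le[OF F _ _ I] borel_measurable_continuous_onI cG)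
       (use C m in \<open>auto simp: G_def\<close>)
  also have "\<dots> \<le> C * 2 * sqrt m * 2"
    using C m arctan_ubound[of "1 / sqrt m"] pi_less_4 by (intro mult_left_mono) auto
  finally show ?thesis by simp
qed

section \<open>Kernels and averages over scales\<close>

text \<open>
  \<open>hker\<close>, \<open>nker\<close> are \<open>h\<close>, \<open>n\<close> above, and \<open>kern e\<close> is minus the derivative of \<open>nker\<close> in direction \<open>e\<close>: moving
  \<open>p\<close> by \<open>t e\<close> in \<open>b (p + s z)\<close> amounts to replacing the kernel \<open>n(z)\<close> by \<open>n(z - (t / s) e)\<close>. The unit disc contains a period
  cell on which \<open>hker\<close> is bounded below; this makes the convolution a contraction.
\<close>

definition rho :: "R2 \<Rightarrow> real" where
  "rho z = max 0 (1 - (norm z)\<^sup>2)"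

definition mass :: real where
  "mass = (LINT z|sqm (-1) 1. rho z)"

definition hker :: "R2 \<Rightarrow> real" where
  "hker z = rho z / mass"

text \<open>The parabolic profile has an explicit radial potential: the gradient of
  \<open>-(1 - |z|^2)^2 / 4\<close> is \<open>(1 - |z|^2) z\<close>. Squaring the positive part
  makes it \<open>C^{1,1}\<close> across the unit circle, which is the regularity used
  below.\<close>

definition nker :: "R2 \<Rightarrow> real" where
  "nker z = - (rho z)\<^sup>2 / (4 * mass)"

definition kern :: "R2 \<Rightarrow> R2 \<Rightarrow> real" where
  "kern e z = - rho z * (z \<bullet> e) / mass"

lemma rho_bounds: "0 \<le> rho z" "rho z \<le> 1"
  by (simp_all add: rho_def)

lemma rho_eq_0: "1 \<le> norm z \<Longrightarrow> rho z = 0"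
proof -
  assume "1 \<le> norm z"
  then have "1 \<le> (norm z)\<^sup>2" by (simp add: one_le_power)
  then show ?thesis by (simp add: rho_def)
qed

lemma continuous_rho: "continuous_on UNIV rho"
  unfolding rho_def by (intro continuous_intros)

lemma borel_rho [measurable]: "rho \<in> borel_measurable borel"
  by (rule borel_measurable_continuous_onI[OF continuous_rho])

lemma bdd_borel_rho: "bdd_borel 1 rho"
  by (rule bdd_borelI[OF borel_rho]) (simp add: rho_bounds)

definition hcell :: "R2 set" where
  "hcell = cbox (-1/2, -1/2) (1/2, 1/2)"

text \<open>The centred unit cell lies within distance \<open>sqrt (1/2)\<close> of 0.\<close>

lemma rho_ge_hcell: "indicator hcell z / 2 \<le> rho z"
proof (cases "z \<in> hcell")
  case True
  obtain x y where z: "z = (x, y)" by fastforce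
  have "\<bar>x\<bar> \<le> 1/2" "\<bar>y\<bar> \<le> 1/2"
    using True unfolding hcell_def z by auto
  from this[THEN power_mono, of 2]
  have "x\<^sup>2 + y\<^sup>2 \<le> 1/2" by (simp add: power2_eq_square)
  moreover have "(norm z)\<^sup>2 = x\<^sup>2 + y\<^sup>2" by (simp add: z norm_Pair)
  ultimately have "1/2 \<le> rho z" unfolding rho_def by linarith
  then show ?thesis using True by simp
next
  case False
  then show ?thesis using rho_bounds(1)[of z] by simp
qed

lemma hcell_measurable [measurable]: "hcell \<in> sets borel"
  by (simp add: hcell_def)

lemma integral_hcell:
  fixes f :: "R2 \<Rightarrow> real"
  assumes [measurable]: "f \<in> borel_measurable borel"
  shows "(LINT z|sqm (-1) 1. indicator hcell z * f z) = (LINT z|sqm (-1/2) (1/2). f z)"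
proof -
  have "(LINT z|sqm (-1) 1. indicator hcell z * f z)
      = (LINT z|lborel. indicator (cbox (-1, -1) (1, 1)) z * (indicator hcell z * f z))"
    by (rule integral_sqm_lborel) measurable
  also have "\<dots> = (LINT z|lborel. indicator (cbox (-1/2, -1/2) (1/2, 1/2)) z * f z)"
    by (intro Bochner_Integration.integral_cong refl)
       (auto simp: hcell_def indicator_def cbox_Pair_eq)
  also have "\<dots> = (LINT z|sqm (-1/2) (1/2). f z)"
    by (rule integral_sqm_lborel[symmetric]) measurable
  finally show ?thesis .
qed

text \<open>The exact mass is \<open>pi / 2\<close>. The lower bound 1/2 controls the size of all
  kernels; the upper bound 4 fixes the contraction factor 7/8.\<close>

lemma mass_ge: "1 / 2 \<le> mass"
proof -
  have "(LINT z|sqm (-1) 1. indicator hcell z * (1/2::real)) = (LINT z|sqm (-1/2) (1/2). (1/2::real))"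
    by (rule integral_hcell) simp
  also have "\<dots> = 1 / 2" by (simp add: measure_sqm)
  finally have "1 / 2 = (LINT z|sqm (-1) 1. indicator hcell z * (1/2::real))" by simp
  also have "\<dots> \<le> mass"
    unfolding mass_def using rho_ge_hcell
    by (intro integral_mono bdd_borel_sqm_integrable[of 1] bdd_borel_rho bdd_borelI)
       (auto simp: indicator_def)
  finally show ?thesis .
qed

lemma mass_pos: "0 < mass" using mass_ge by linarith

lemma mass_le: "mass \<le> 4"
proof -
  have "mass \<le> (LINT z|sqm (-1) 1. 1)"
    unfolding mass_def using rho_bounds
    by (intro integral_mono bdd_borel_sqm_integrable[of 1] bdd_borel_rho bdd_borelI) auto
  then show ?thesis by (simp add: measure_sqm)
qed

lemma borel_kernels [measurable]:
  "hker \<in> borel_measurable borel" "nker \<in> borel_measurable borel" "kern e \<in> borel_measurable borel"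
  unfolding hker_def[abs_def] nker_def[abs_def] kern_def[abs_def] by measurable

lemma hker_bounds: "0 \<le> hker z" "hker z \<le> 2"
  using rho_bounds[of z] mass_ge by (auto simp: hker_def field_simps)

lemma abs_nker_le: "\<bar>nker z\<bar> \<le> 1"
proof -
  have "(rho z)\<^sup>2 \<le> 1" using rho_bounds[of z] by (simp add: power_le_one)
  then show ?thesis using mass_ge by (simp add: nker_def abs_mult field_simps)
qed

lemma rho_norm_le: "rho z * norm z \<le> 1"
proof (cases "norm z \<le> 1")
  case True then show ?thesis using rho_bounds[of z] by (simp add: mult_le_one)
next
  case False then show ?thesis by (simp add: rho_eq_0)
qed

lemma abs_kern_le:
  assumes "norm e = 1"
  shows "\<bar>kern e z\<bar> \<le> 2"
proof -
  have "\<bar>z \<bullet> e\<bar> \<le> norm z" using Cauchy_Schwarz_ineq2[of z e] assms by simp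
  then have "rho z * \<bar>z \<bullet> e\<bar> \<le> rho z * norm z" using rho_bounds by (intro mult_left_mono)
  then have "rho z * \<bar>z \<bullet> e\<bar> \<le> 1" using rho_norm_le[of z] by linarith
  then show ?thesis
    using mass_ge rho_bounds[of z] by (simp add: kern_def abs_mult field_simps)
qed

lemma kernels_eq_0: "1 \<le> norm z \<Longrightarrow> nker z = 0" "1 \<le> norm z \<Longrightarrow> kern e z = 0"
  by (simp_all add: nker_def kern_def rho_eq_0)

lemma abs_rho_diff_le: "\<bar>rho z - rho y\<bar> \<le> norm (z - y) * (norm z + norm y)"
proof -
  have "\<bar>rho z - rho y\<bar> \<le> \<bar>(norm z)\<^sup>2 - (norm y)\<^sup>2\<bar>"
    unfolding rho_def by linarith
  also have "\<dots> = \<bar>norm z - norm y\<bar> * (norm z + norm y)"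
    by (simp add: power2_eq_square square_diff_square_factored abs_mult)
  also have "\<dots> \<le> norm (z - y) * (norm z + norm y)"
    by (intro mult_right_mono norm_triangle_ineq3) auto
  finally show ?thesis .
qed

text \<open>Split the difference into a change of \<open>rho\<close> and a change of
  \<open>z \<bullet> e\<close>. From \<open>|z| <= 2\<close> and \<open>|z - d| <= 3\<close> the
  first part is at most \<open>5 |d| * 3\<close> and the second at most \<open>|d|\<close>; finally
  \<open>1 / mass <= 2\<close>.\<close>

lemma kern_Lipschitz:
  assumes e: "norm e = 1" and d: "norm d \<le> 1" and z: "norm z \<le> 2"
  shows "\<bar>kern e (z - d) - kern e z\<bar> \<le> 32 * norm d"
proof -
  let ?y = "z - d"
  have y: "norm ?y \<le> 3" using norm_triangle_ineq4[of z d] d z by linarith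
  have ye: "\<bar>?y \<bullet> e\<bar> \<le> 3" using Cauchy_Schwarz_ineq2[of ?y e] e y by simp
  have de: "\<bar>d \<bullet> e\<bar> \<le> norm d" using Cauchy_Schwarz_ineq2[of d e] e by simp
  have r: "\<bar>rho ?y - rho z\<bar> \<le> norm d * 5"
    using abs_rho_diff_le[of ?y z] y z mult_left_mono[of "norm ?y + norm z" 5 "norm d"] by simp
  have "kern e ?y - kern e z = - ((rho ?y - rho z) * (?y \<bullet> e) - rho z * (d \<bullet> e)) / mass"
    using mass_pos by (simp add: kern_def inner_diff_left field_simps)
  then have "\<bar>kern e ?y - kern e z\<bar> = \<bar>(rho ?y - rho z) * (?y \<bullet> e) - rho z * (d \<bullet> e)\<bar> / mass"
    using mass_pos by simp
  also have "\<dots> \<le> (16 * norm d) / mass"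
  proof (rule divide_right_mono)
    have "\<bar>(rho ?y - rho z) * (?y \<bullet> e) - rho z * (d \<bullet> e)\<bar>
        \<le> \<bar>rho ?y - rho z\<bar> * \<bar>?y \<bullet> e\<bar> + rho z * \<bar>d \<bullet> e\<bar>"
      using rho_bounds[of z] abs_triangle_ineq4[of "(rho ?y - rho z) * (?y \<bullet> e)" "rho z * (d \<bullet> e)"]
      by (simp add: abs_mult)
    also have "\<dots> \<le> (norm d * 5) * 3 + 1 * norm d"
      using r ye de rho_bounds[of z] by (intro add_mono mult_mono) auto
    finally show "\<bar>(rho ?y - rho z) * (?y \<bullet> e) - rho z * (d \<bullet> e)\<bar> \<le> 16 * norm d" by simp
  qed (use mass_pos in simp)
  also have "\<dots> \<le> (16 * norm d) * 2"
  proof -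
    have "1 / mass \<le> 2" using mass_ge by (simp add: field_simps)
    from mult_left_mono[OF this, of "16 * norm d"] show ?thesis by simp
  qed
  finally show ?thesis by simp
qed

text \<open>The squared positive part is \<open>C^{1,1}\<close>: its derivative
  \<open>2 max 0 a\<close> has Lipschitz constant 2.\<close>

lemma square_pos_part_Taylor:
  fixes a b :: real
  shows "\<bar>(max 0 b)\<^sup>2 - (max 0 a)\<^sup>2 - 2 * max 0 a * (b - a)\<bar> \<le> (b - a)\<^sup>2"
proof -
  consider "0 \<le> a" "0 \<le> b" | "a \<le> 0" "0 \<le> b" | "0 \<le> a" "b \<le> 0" | "a \<le> 0" "b \<le> 0" by linarith
  then show ?thesis
  proof cases
    case 1 
    then have "(max 0 b)\<^sup>2 - (max 0 a)\<^sup>2 - 2 * max 0 a * (b - a) = (b - a)\<^sup>2" 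
      by (simp add: power2_eq_square algebra_simps)
    then show ?thesis by simp
  next
    case 2
    then have "b\<^sup>2 \<le> (b - a)\<^sup>2" by (intro power_mono) auto
    then show ?thesis using 2 by simp
  next
    case 3
    have "(max 0 b)\<^sup>2 - (max 0 a)\<^sup>2 - 2 * max 0 a * (b - a) = a * (a - 2 * b)"
      using 3 by (simp add: power2_eq_square algebra_simps)
    moreover have "0 \<le> a * (a - 2 * b)" using 3 by simp
    moreover have "a * (a - 2 * b) \<le> (b - a)\<^sup>2"
      by (simp add: power2_eq_square algebra_simps)
    ultimately show ?thesis by simp
  qed auto
qed

text \<open>Apply the previous estimate to \<open>1 - |z|^2\<close>, whose increment is
  \<open>b - a = 2 t (z \<bullet> e) - t^2\<close>. The part linear in t yields
  \<open>t * kern e z\<close>; the errors are at most \<open>25 t^2 + 2 t^2\<close>, divided by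
  \<open>4 mass >= 2\<close>.\<close>

lemma nker_Taylor:
  assumes e: "norm e = 1" and t: "\<bar>t\<bar> \<le> 1" and z: "norm z \<le> 2"
  shows "\<bar>nker (z - t *\<^sub>R e) - nker z - t * kern e z\<bar> \<le> 14 * t\<^sup>2"
proof -
  define a where "a = 1 - (norm z)\<^sup>2"
  define b where "b = 1 - (norm (z - t *\<^sub>R e))\<^sup>2"
  have ze: "\<bar>z \<bullet> e\<bar> \<le> 2" using Cauchy_Schwarz_ineq2[of z e] e z by simp
  have ee: "e \<bullet> e = 1" using e by (simp add: norm_eq_sqrt_inner)
  have ba: "b - a = t * (2 * (z \<bullet> e) - t)"
    unfolding a_def b_def power2_norm_eq_inner
    by (simp add: inner_diff_left inner_diff_right inner_commute ee algebra_simps)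
  have "\<bar>2 * (z \<bullet> e) - t\<bar> \<le> 5" using ze t by linarith
  then have "(2 * (z \<bullet> e) - t)\<^sup>2 \<le> 5\<^sup>2" by (metis abs_ge_zero power2_abs power_mono)
  then have sq: "(b - a)\<^sup>2 \<le> 25 * t\<^sup>2"
    unfolding ba power_mult_distrib
    using mult_left_mono[of "(2 * (z \<bullet> e) - t)\<^sup>2" 25 "t\<^sup>2"] by (simp add: mult.commute)
  have r: "rho z = max 0 a" "rho (z - t *\<^sub>R e) = max 0 b" by (simp_all add: rho_def a_def b_def)
  have rz: "0 \<le> rho z" "rho z \<le> 1" by (rule rho_bounds)+
  have "nker (z - t *\<^sub>R e) - nker z - t * kern e z
      = - (((max 0 b)\<^sup>2 - (max 0 a)\<^sup>2 - 2 * max 0 a * (b - a)) - 2 * rho z * t\<^sup>2) / (4 * mass)"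
    using mass_pos unfolding nker_def kern_def ba r[symmetric]
    by (simp add: field_simps power2_eq_square)
  then have "\<bar>nker (z - t *\<^sub>R e) - nker z - t * kern e z\<bar>
      = \<bar>((max 0 b)\<^sup>2 - (max 0 a)\<^sup>2 - 2 * max 0 a * (b - a)) - 2 * rho z * t\<^sup>2\<bar> / (4 * mass)"
    using mass_pos by (simp add: abs_mult abs_minus_commute)
  also have "\<dots> \<le> (27 * t\<^sup>2) / (4 * mass)"
  proof (rule divide_right_mono)
    have 1: "\<bar>2 * rho z * t\<^sup>2\<bar> \<le> 2 * t\<^sup>2"
      using rz mult_right_mono[of "rho z" 1 "t\<^sup>2"] by (simp add: abs_mult)
    have "\<bar>x - y\<bar> \<le> 27 * t\<^sup>2" if "\<bar>x\<bar> \<le> (b - a)\<^sup>2" "\<bar>y\<bar> \<le> 2 * t\<^sup>2" for x y :: real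
      using that sq by linarith
    from this[OF square_pos_part_Taylor 1]
    show "\<bar>((max 0 b)\<^sup>2 - (max 0 a)\<^sup>2 - 2 * max 0 a * (b - a)) - 2 * rho z * t\<^sup>2\<bar> \<le> 27 * t\<^sup>2" .
  qed (use mass_pos in simp)
  also have "\<dots> \<le> 27 * t\<^sup>2 / 2"
    using mass_ge by (intro divide_left_mono) auto
  also have "\<dots> \<le> 14 * t\<^sup>2" by simp
  finally show ?thesis .
qed

section \<open>Translation moduli of the kernels in L^1\<close>

lemma integral_lborel_translate:
  fixes f :: "R2 \<Rightarrow> real"
  assumes "f \<in> borel_measurable borel"
  shows "(LINT z|lborel. f (z + c)) = (LINT z|lborel. f z)"
proof -
  have "(LINT z|lborel. f z) = (LINT z|distr lborel borel ((+) c). f z)"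
    by (simp add: lborel_distr_plus)
  also have "\<dots> = (LINT z|lborel. f (c + z))"
    by (rule integral_distr) (use assms in auto)
  finally show ?thesis by (simp add: add.commute)
qed

text \<open>The area \<open>4 pi\<close>. Radius 2 leaves room for kernels supported in the unit
  disc and translated by vectors of norm at most 1.\<close>

definition ball2 :: real where
  "ball2 = measure lborel (cball (0::R2) 2)"

lemma ball2_nonneg: "0 \<le> ball2"
  by (simp add: ball2_def)

lemma integral_ball2_bound:
  fixes f :: "R2 \<Rightarrow> real"
  assumes [measurable]: "f \<in> borel_measurable borel"
    and le: "\<And>z. norm z \<le> 2 \<Longrightarrow> \<bar>f z\<bar> \<le> C" and z: "\<And>z. 2 < norm z \<Longrightarrow> f z = 0"
  shows "integrable lborel f" "(LINT z|lborel. \<bar>f z\<bar>) \<le> C * ball2"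
proof -
  have fin: "emeasure lborel (cball (0::R2) 2) < \<infinity>" by (rule emeasure_lborel_cball_finite)
  have i: "integrable lborel (\<lambda>z. C * indicator (cball (0::R2) 2) z)"
    using fin by (intro integrable_mult_right integrable_real_indicator) auto
  have b: "\<bar>f z\<bar> \<le> C * indicator (cball 0 2) z" for z
    using le[of z] z[of z] by (auto simp: indicator_def not_le)
  show 1: "integrable lborel f"
    by (rule Bochner_Integration.integrable_bound[OF i])
       (auto intro!: AE_I2 order_trans[OF b])
  have "(LINT z|lborel. \<bar>f z\<bar>) \<le> (LINT z|lborel. C * indicator (cball (0::R2) 2) z)"
    by (intro integral_mono integrable_abs 1 i b)
  also have "\<dots> = C * ball2" by (simp add: ball2_def)
  finally show "(LINT z|lborel. \<bar>f z\<bar>) \<le> C * ball2" .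
qed

text \<open>For \<open>|d| <= 1\<close> the Lipschitz bound is integrated over a disc of radius 2;
  for larger d the two translates are bounded separately. \<open>|d| powr \<beta>\<close> majorises
  |d| in the first case and 1 in the second.\<close>

lemma kernel_L1_modulus:
  fixes k :: "R2 \<Rightarrow> real"
  assumes k [measurable]: "k \<in> borel_measurable borel" and W: "\<And>z. \<bar>k z\<bar> \<le> W"
    and k0: "\<And>z. 1 \<le> norm z \<Longrightarrow> k z = 0"
    and lip: "\<And>z d. norm d \<le> 1 \<Longrightarrow> norm z \<le> 2 \<Longrightarrow> \<bar>k (z - d) - k z\<bar> \<le> L * norm d"
    and L: "0 \<le> L" and \<beta>: "0 \<le> \<beta>" "\<beta> \<le> 1"
  shows "(LINT z|lborel. \<bar>k (z - d) - k z\<bar>) \<le> (L + 2 * W) * ball2 * norm d powr \<beta>"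
proof (cases "norm d \<le> 1")
  case True
  have "(LINT z|lborel. \<bar>k (z - d) - k z\<bar>) \<le> (L * norm d) * ball2"
  proof (rule integral_ball2_bound(2))
    fix z :: R2 assume "2 < norm z"
    then have "1 \<le> norm (z - d)" "1 \<le> norm z" using True norm_triangle_ineq2[of z d] by linarith+
    then show "k (z - d) - k z = 0" using k0 by simp
  qed (use lip True in auto)
  also have "\<dots> \<le> (L + 2 * W) * ball2 * norm d powr \<beta>"
  proof -
    have "norm d \<le> norm d powr \<beta>"
    proof (cases "d = 0")
      case False
      then show ?thesis using True \<beta> powr_mono'[of \<beta> 1 "norm d"] by simp
    qed simp
    moreover have "L \<le> L + 2 * W" using W[of 0] by simp
    ultimately have "L * norm d \<le> (L + 2 * W) * norm d powr \<beta>"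
      using L by (intro mult_mono) auto
    from mult_right_mono[OF this ball2_nonneg] show ?thesis by (simp add: mult_ac)
  qed
  finally show ?thesis .
next
  case False
  have k2: "k z = 0" if "2 < norm z" for z using that k0[of z] by simp
  have W_nonneg: "0 \<le> W" using W[of 0] by linarith
  have ik: "integrable lborel k" "(LINT z|lborel. \<bar>k z\<bar>) \<le> W * ball2"
    using integral_ball2_bound[OF k, of W] W k2 by auto
  have t: "(LINT z|lborel. \<bar>k (z - d)\<bar>) = (LINT z|lborel. \<bar>k z\<bar>)"
    using integral_lborel_translate[of "\<lambda>z. \<bar>k z\<bar>" "- d"] by simp
  have ikd: "integrable lborel (\<lambda>z. k (z - d))"
  proof -
    have "integrable (distr lborel borel ((+) (- d))) k"
      using ik(1) by (simp add: lborel_distr_plus)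
    then show ?thesis
      by (subst (asm) integrable_distr_eq) auto
  qed
  have "(LINT z|lborel. \<bar>k (z - d) - k z\<bar>) \<le> (LINT z|lborel. \<bar>k (z - d)\<bar> + \<bar>k z\<bar>)"
    by (intro integral_mono integrable_abs Bochner_Integration.integrable_diff
        Bochner_Integration.integrable_add ik ikd) auto
  also have "\<dots> = (LINT z|lborel. \<bar>k (z - d)\<bar>) + (LINT z|lborel. \<bar>k z\<bar>)"
    by (intro Bochner_Integration.integral_add integrable_abs ik ikd)
  also have "\<dots> \<le> 2 * W * ball2 * 1" using t ik by simp
  also have "\<dots> \<le> (L + 2 * W) * ball2 * norm d powr \<beta>"
  proof (intro mult_mono)
    show "1 \<le> norm d powr \<beta>" using False \<beta> by (simp add: ge_one_powr_ge_zero)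
  qed (use L W_nonneg ball2_nonneg in auto)
  finally show ?thesis .
qed

text \<open>The remainder is quadratic in t for \<open>|t| <= 1\<close> and linear beyond. The
  exponent 3/2 lies strictly between: above 1 to give a derivative, below 2 so that the remainder at
  \<open>t / s\<close>, weighted by s, stays integrable at s = 0.\<close>

lemma nker_L1_Taylor:
  assumes e: "norm e = 1"
  shows "(LINT z|lborel. \<bar>nker (z - t *\<^sub>R e) - nker z - t * kern e z\<bar>) \<le> 14 * ball2 * \<bar>t\<bar> powr (3/2)"
proof (cases "\<bar>t\<bar> \<le> 1")
  case True
  have nt: "norm (t *\<^sub>R e) \<le> 1" using True e by simp
  have "(LINT z|lborel. \<bar>nker (z - t *\<^sub>R e) - nker z - t * kern e z\<bar>) \<le> (14 * t\<^sup>2) * ball2"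
  proof (rule integral_ball2_bound(2))
    fix z :: R2 assume "2 < norm z"
    then have "1 \<le> norm (z - t *\<^sub>R e)" "1 \<le> norm z"
      using nt norm_triangle_ineq2[of z "t *\<^sub>R e"] by linarith+
    then show "nker (z - t *\<^sub>R e) - nker z - t * kern e z = 0" by (simp add: kernels_eq_0)
  qed (use nker_Taylor[OF e True] in auto)
  also have "\<dots> \<le> 14 * ball2 * \<bar>t\<bar> powr (3/2)"
  proof -
    have "t\<^sup>2 \<le> \<bar>t\<bar> powr (3/2)"
    proof (cases "t = 0")
      case False
      then have "t\<^sup>2 = \<bar>t\<bar> powr 2" by (simp add: powr_numeral)
      also have "\<dots> \<le> \<bar>t\<bar> powr (3/2)" using True False by (intro powr_mono') auto
      finally show ?thesis .
    qed simp
    then show ?thesis using ball2_nonneg by (simp add: mult_mono mult.commute)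
  qed
  finally show ?thesis .
next
  case False
  have n0: "nker z = 0" "kern e z = 0" if "2 < norm z" for z using that by (simp_all add: kernels_eq_0)
  have n: "integrable lborel nker" "(LINT z|lborel. \<bar>nker z\<bar>) \<le> 1 * ball2"
    by (rule integral_ball2_bound; use abs_nker_le n0 in auto)+
  have k: "integrable lborel (kern e)" "(LINT z|lborel. \<bar>kern e z\<bar>) \<le> 2 * ball2"
    by (rule integral_ball2_bound; use abs_kern_le[OF e] n0 in auto)+
  have tr: "(LINT z|lborel. \<bar>nker (z - t *\<^sub>R e)\<bar>) = (LINT z|lborel. \<bar>nker z\<bar>)"
    using integral_lborel_translate[of "\<lambda>z. \<bar>nker z\<bar>" "- t *\<^sub>R e"] by simp
  have nd: "integrable lborel (\<lambda>z. nker (z - t *\<^sub>R e))"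
  proof -
    have "integrable (distr lborel borel ((+) (- t *\<^sub>R e))) nker"
      using n(1) by (simp add: lborel_distr_plus)
    then show ?thesis
      by (subst (asm) integrable_distr_eq) auto
  qed
  have "(LINT z|lborel. \<bar>nker (z - t *\<^sub>R e) - nker z - t * kern e z\<bar>)
      \<le> (LINT z|lborel. \<bar>nker (z - t *\<^sub>R e)\<bar> + \<bar>nker z\<bar> + \<bar>t\<bar> * \<bar>kern e z\<bar>)"
  proof (rule integral_mono)
    show "\<bar>nker (z - t *\<^sub>R e) - nker z - t * kern e z\<bar>
        \<le> \<bar>nker (z - t *\<^sub>R e)\<bar> + \<bar>nker z\<bar> + \<bar>t\<bar> * \<bar>kern e z\<bar>" for z
      unfolding abs_mult[symmetric] by linarith
  qed (intro integrable_abs Bochner_Integration.integrable_diff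
        Bochner_Integration.integrable_add integrable_mult_right n k nd)+
  also have "\<dots> = (LINT z|lborel. \<bar>nker (z - t *\<^sub>R e)\<bar>) + (LINT z|lborel. \<bar>nker z\<bar>)
      + \<bar>t\<bar> * (LINT z|lborel. \<bar>kern e z\<bar>)"
    using n k nd by simp
  also have "\<dots> \<le> 1 * ball2 + 1 * ball2 + \<bar>t\<bar> * (2 * ball2)"
    unfolding tr using n k by (intro add_mono mult_left_mono) auto
  also have "\<dots> \<le> 14 * ball2 * \<bar>t\<bar>"
    using False ball2_nonneg mult_right_mono[of 1 "\<bar>t\<bar>" ball2] by (simp add: algebra_simps)
  also have "\<dots> \<le> 14 * ball2 * \<bar>t\<bar> powr (3/2)"
    using False ball2_nonneg powr_mono[of 1 "3/2" "\<bar>t\<bar>"] by (intro mult_left_mono) auto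
  finally show ?thesis .
qed

section \<open>Averages over all scales\<close>

definition svm :: "(real \<times> R2) measure" where
  "svm = ivl 0 1 \<Otimes>\<^sub>M sqm (-1) 1"

lemma sets_svm [simp, measurable_cong]: "sets svm = sets borel"
proof -
  have "sets svm = sets (borel \<Otimes>\<^sub>M borel :: (real \<times> R2) measure)"
    unfolding svm_def by (intro sets_pair_measure_cong) auto
  then show ?thesis unfolding borel_prod .
qed

interpretation svm: finite_measure svm
  unfolding svm_def
  by (intro finite_measure_pair_measure ivl.finite_measure_axioms sqm.finite_measure_axioms)

lemma svm_measure: "measure svm (space svm) = 4"
proof -
  have "emeasure svm (UNIV \<times> UNIV) = emeasure (ivl 0 1) UNIV * emeasure (sqm (-1) 1) UNIV"
    unfolding svm_def by (subst sqm.emeasure_pair_measure_Times) auto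
  also have "emeasure (sqm (-1) 1) UNIV = ennreal 4"
    using measure_sqm[of "-1" 1] sqm.emeasure_eq_measure[of "-1" 1 UNIV] by simp
  also have "emeasure (ivl 0 1) UNIV = 1" by (simp add: emeasure_ivl)
  finally have "emeasure svm UNIV = 4" by simp
  moreover have "space svm = UNIV" by (simp add: svm_def space_pair_measure)
  ultimately show ?thesis by (simp add: measure_def)
qed

text \<open>The average at a single scale, taken over the whole plane instead of the square, so that
  translating p can be traded for translating k.\<close>

definition cv :: "(R2 \<Rightarrow> real) \<Rightarrow> real \<Rightarrow> (R2 \<Rightarrow> real) \<Rightarrow> R2 \<Rightarrow> real" where
  "cv k s b p = (LINT z|lborel. k z * b (p + s *\<^sub>R z))"

text \<open>The weight \<open>\<omega>\<close> is s for the potential and 1 for its gradient.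
  Support of k in the unit disc allows passing between the plane and the square.\<close>

locale scaled =
  fixes \<omega> :: "real \<Rightarrow> real" and k :: "R2 \<Rightarrow> real" and W :: real
  assumes \<omega> [measurable]: "\<omega> \<in> borel_measurable borel" and \<omega>1: "\<And>s. \<bar>\<omega> s\<bar> \<le> 1"
    and k [measurable]: "k \<in> borel_measurable borel" and kW: "\<And>z. \<bar>k z\<bar> \<le> W"
    and k0: "\<And>z. 1 \<le> norm z \<Longrightarrow> k z = 0"
begin

sublocale averaging svm "\<lambda>t. \<omega> (fst t) * k (snd t)" "\<lambda>t. fst t *\<^sub>R snd t" W
proof
  have [measurable]: "fst \<in> borel_measurable (borel :: (real \<times> R2) measure)"
    "snd \<in> borel_measurable (borel :: (real \<times> R2) measure)"
    by (intro borel_measurable_continuous_onI continuous_intros)+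
  show "(\<lambda>t. \<omega> (fst t) * k (snd t)) \<in> borel_measurable svm" by measurable
  show "(\<lambda>t. fst t *\<^sub>R snd t) \<in> borel_measurable svm" by measurable
  show "\<bar>\<omega> (fst t) * k (snd t)\<bar> \<le> W" for t
    unfolding abs_mult using mult_mono[OF \<omega>1[of "fst t"] kW[of "snd t"]] by simp
qed

lemma wmass_le: "wmass \<le> 4 * W"
proof -
  have "wmass \<le> (LINT t|svm. W)"
    unfolding wmass_def by (intro integral_mono integrable_abs integrable_w) (auto simp: W)
  then show ?thesis by (simp add: svm_measure)
qed

lemma integrable_k: "integrable lborel k"
  by (rule integral_ball2_bound(1)[OF k, of W]) (use kW k0 in auto)

lemma integrable_cv:
  assumes "bdd_borel B b"
  shows "integrable lborel (\<lambda>z. k z * b (p + s *\<^sub>R z))"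
proof -
  have [measurable]: "b \<in> borel_measurable borel" using assms bdd_borelD by blast
  show ?thesis
    by (rule integral_ball2_bound(1)[of _ "W * B"])
       (auto simp: abs_mult k0 intro!: mult_mono kW bdd_borelD(2)[OF assms] W_nonneg)
qed

lemma cv_sqm:
  assumes "bdd_borel B b"
  shows "cv k s b p = (LINT z|sqm (-1) 1. k z * b (p + s *\<^sub>R z))"
proof -
  have [measurable]: "b \<in> borel_measurable borel" using assms bdd_borelD by blast
  have kk: "indicator (cbox (-1, -1) (1, 1)) z * k z = k z" for z
  proof (cases "z \<in> cbox (-1, -1) (1, 1)")
    case False
    obtain x y where z: "z = (x, y)" by fastforce
    have "1 < \<bar>x\<bar> \<or> 1 < \<bar>y\<bar>" using False by (auto simp: z)
    moreover have "\<bar>x\<bar> \<le> norm z" "\<bar>y\<bar> \<le> norm z"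
      unfolding z norm_Pair by (auto intro!: real_le_rsqrt)
    ultimately have "1 \<le> norm z" by linarith
    then show ?thesis by (simp add: k0)
  qed simp
  show ?thesis
    unfolding cv_def by (subst integral_sqm_lborel) (simp_all add: mult.assoc[symmetric] kk)
qed

lemma av_iter:
  assumes "bdd_borel B b"
  shows "av b p = (LINT s|ivl 0 1. \<omega> s * cv k s b p)"
    and "(\<lambda>s. \<omega> s * cv k s b p) \<in> borel_measurable borel"
    and "integrable (ivl 0 1) (\<lambda>s. \<omega> s * cv k s b p)"
proof -
  interpret P: pair_sigma_finite "ivl 0 1" "sqm (-1) 1"
    by (intro pair_sigma_finite_finite ivl.finite_measure_axioms sqm.finite_measure_axioms)
  have [measurable]: "b \<in> borel_measurable borel" using assms bdd_borelD by blast
  have i: "integrable (ivl 0 1 \<Otimes>\<^sub>M sqm (-1) 1) (\<lambda>t. \<omega> (fst t) * k (snd t) * b (p + fst t *\<^sub>R snd t))"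
    using integrable_av[OF assms, of p] by (simp add: svm_def)
  have eq: "(LINT z|sqm (-1) 1. \<omega> s * k z * b (p + s *\<^sub>R z)) = \<omega> s * cv k s b p" for s
    unfolding cv_sqm[OF assms] by (simp add: mult.assoc)
  show "av b p = (LINT s|ivl 0 1. \<omega> s * cv k s b p)"
    unfolding av_def unfolding svm_def using P.integral_fst'[OF i] by (simp add: eq)
  show "integrable (ivl 0 1) (\<lambda>s. \<omega> s * cv k s b p)"
    using P.integrable_fst'[OF i] by (simp add: eq)
  then show "(\<lambda>s. \<omega> s * cv k s b p) \<in> borel_measurable borel"
    using borel_measurable_integrable by fastforce
qed

lemma abs_cv_le:
  assumes "bdd_borel B b"
  shows "\<bar>cv k s b p\<bar> \<le> W * (LINT z|sqm (-1) 1. \<bar>b (p + s *\<^sub>R z)\<bar>)"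
proof -
  have [measurable]: "b \<in> borel_measurable borel" using assms bdd_borelD by blast
  have bb: "bdd_borel B (\<lambda>z. \<bar>b (p + s *\<^sub>R z)\<bar>)"
    by (rule bdd_borelI) (auto simp: bdd_borelD(2)[OF assms])
  have kb: "bdd_borel (W * B) (\<lambda>z. k z * b (p + s *\<^sub>R z))"
    by (rule bdd_borelI) (auto simp: abs_mult intro!: mult_mono kW bdd_borelD(2)[OF assms] W_nonneg)
  have "\<bar>cv k s b p\<bar> \<le> (LINT z|sqm (-1) 1. \<bar>k z * b (p + s *\<^sub>R z)\<bar>)"
    unfolding cv_sqm[OF assms] using integral_norm_bound[of "sqm (-1) 1" "\<lambda>z. k z * b (p + s *\<^sub>R z)"] by simp
  also have "\<dots> \<le> (LINT z|sqm (-1) 1. W * \<bar>b (p + s *\<^sub>R z)\<bar>)"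
    by (intro integral_mono integrable_abs integrable_mult_right bdd_borel_sqm_integrable[OF kb]
          bdd_borel_sqm_integrable[OF bb]) (auto simp: abs_mult intro!: mult_right_mono kW)
  finally show ?thesis by simp
qed

text \<open>Each scale gives two bounds, \<open>4 W B\<close> from the sup norm and
  \<open>4 W m / s^2\<close> from the \<open>L^1\<close> norm over a cell. Assuming
  \<open>1 <= B\<close> gives both the common constant \<open>4 W B\<close> that the integration
  over scales expects.\<close>

lemma av_sqrt_bound:
  assumes b: "bdd_borel B b" "periodic2 b" and B: "1 \<le> B" and m: "0 < m"
    and le: "(LINT p|sqm 0 1. \<bar>b p\<bar>) \<le> m"
  shows "\<bar>av b p\<bar> \<le> 16 * W * B * sqrt m"
proof -
  have [measurable]: "b \<in> borel_measurable borel" using b bdd_borelD by blast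
  have bb: "bdd_borel B (\<lambda>p. \<bar>b p\<bar>)"
    by (rule bdd_borelI) (auto simp: bdd_borelD(2)[OF b(1)])
  have pb: "periodic2 (\<lambda>p. \<bar>b p\<bar>)" using b(2) by (simp add: periodic2_def)
  have c: "\<bar>\<omega> s * cv k s b p\<bar> \<le> \<bar>cv k s b p\<bar>" for s
    unfolding abs_mult using mult_right_mono[OF \<omega>1[of s], of "\<bar>cv k s b p\<bar>"] by simp
  have 1: "\<bar>\<omega> s * cv k s b p\<bar> \<le> 4 * W * B" for s
  proof -
    have bs: "bdd_borel B (\<lambda>z. \<bar>b (p + s *\<^sub>R z)\<bar>)"
      by (rule bdd_borel_compose[OF bb]) measurable
    have "(LINT z|sqm (-1) 1. \<bar>b (p + s *\<^sub>R z)\<bar>) \<le> (LINT z|sqm (-1) 1. B)"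
      by (intro integral_mono bdd_borel_sqm_integrable[OF bs]) (auto simp: bdd_borelD(2)[OF b(1)])
    then have "(LINT z|sqm (-1) 1. \<bar>b (p + s *\<^sub>R z)\<bar>) \<le> 4 * B" by (simp add: measure_sqm)
    from mult_left_mono[OF this W_nonneg] show ?thesis
      using c[of s] abs_cv_le[OF b(1), of s p] by simp
  qed
  have 2: "\<bar>\<omega> s * cv k s b p\<bar> * s\<^sup>2 \<le> 4 * W * B * m" if s: "0 < s" "s \<le> 1" for s
  proof -
    have "(LINT z|sqm (-1) 1. \<bar>b (p + s *\<^sub>R z)\<bar>) \<le> 4 / s\<^sup>2 * (LINT p|sqm 0 1. \<bar>b p\<bar>)"
      by (rule integral_cell_scaled_le[OF bb pb _ s]) simp
    also have "\<dots> \<le> 4 / s\<^sup>2 * m" by (intro mult_left_mono le) auto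
    finally have "W * (LINT z|sqm (-1) 1. \<bar>b (p + s *\<^sub>R z)\<bar>) \<le> W * (4 / s\<^sup>2 * m)"
      by (rule mult_left_mono[OF _ W_nonneg])
    then have "\<bar>\<omega> s * cv k s b p\<bar> \<le> W * (4 / s\<^sup>2 * m)"
      using c[of s] abs_cv_le[OF b(1), of s p] by linarith
    then have "\<bar>\<omega> s * cv k s b p\<bar> * s\<^sup>2 \<le> W * (4 / s\<^sup>2 * m) * s\<^sup>2"
      by (rule mult_right_mono) simp
    also have "\<dots> = 4 * W * m * 1" using s by simp
    also have "\<dots> \<le> 4 * W * m * B" using B W_nonneg m by (intro mult_left_mono) auto
    finally show ?thesis by (simp add: mult_ac)
  qed
  have "\<bar>LINT s|ivl 0 1. \<omega> s * cv k s b p\<bar> \<le> 4 * (4 * W * B) * sqrt m"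
    by (rule integral_ivl_sqrt_bound[OF av_iter(2)[OF b(1)] m _ 1 2]) (use W_nonneg B in auto)
  then show ?thesis using av_iter(1)[OF b(1)] by simp
qed

lemma cv_translate:
  assumes "bdd_borel B b" "0 < s"
  shows "cv k s b (p + d) = (LINT z|lborel. k (z - d /\<^sub>R s) * b (p + s *\<^sub>R z))"
proof -
  have [measurable]: "b \<in> borel_measurable borel" using assms bdd_borelD by blast
  have "(LINT z|lborel. k (z - d /\<^sub>R s) * b (p + s *\<^sub>R z))
      = (LINT z|lborel. k (z + d /\<^sub>R s - d /\<^sub>R s) * b (p + s *\<^sub>R (z + d /\<^sub>R s)))"
    by (rule integral_lborel_translate[symmetric]) measurable
  also have "\<dots> = cv k s b (p + d)"
    unfolding cv_def using assms(2) by (simp add: scaleR_add_right add_ac)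
  finally show ?thesis by simp
qed

lemma integrable_cv_translate:
  assumes "bdd_borel B b" "0 < s"
  shows "integrable lborel (\<lambda>z. k (z - d) * b (p + s *\<^sub>R z))"
proof -
  have [measurable]: "b \<in> borel_measurable borel" using assms bdd_borelD by blast
  have "integrable (distr lborel borel ((+) (- d))) (\<lambda>z. k z * b ((p + s *\<^sub>R d) + s *\<^sub>R z))"
    using integrable_cv[OF assms(1)] by (simp add: lborel_distr_plus)
  then show ?thesis
    by (subst (asm) integrable_distr_eq) (auto simp: algebra_simps)
qed

text \<open>A displacement d of p translates the kernel at scale s by d / s, at cost
  \<open>(|d| / s) powr \<beta>\<close>; the singularity \<open>s powr - \<beta>\<close> is
  integrable for \<open>\<beta> < 1\<close>. Only the sup norm of b enters.\<close>

lemma av_Holder: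
  assumes b: "bdd_borel B b" and \<beta>: "0 \<le> \<beta>" "\<beta> < 1"
    and L: "\<And>d. (LINT z|lborel. \<bar>k (z - d) - k z\<bar>) \<le> L * norm d powr \<beta>" "0 \<le> L"
  shows "\<bar>av b (p + d) - av b p\<bar> \<le> B * L / (1 - \<beta>) * norm d powr \<beta>"
proof -
  have B0: "0 \<le> B" using b bdd_borelD by blast
  have [measurable]: "b \<in> borel_measurable borel" using b bdd_borelD by blast
  define F where "F s = \<omega> s * cv k s b (p + d) - \<omega> s * cv k s b p" for s
  have F: "F \<in> borel_measurable borel"
    unfolding F_def[abs_def] by (intro borel_measurable_diff av_iter(2)[OF b])
  have "\<bar>F s\<bar> \<le> B * L * norm d powr \<beta> * s powr - \<beta>" if s: "0 < s" "s \<le> 1" for s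
  proof -
    let ?d = "d /\<^sub>R s"
    have "cv k s b (p + d) - cv k s b p = (LINT z|lborel. (k (z - ?d) - k z) * b (p + s *\<^sub>R z))"
      unfolding cv_translate[OF b s(1)] cv_def[of k s b p]
      using integrable_cv_translate[OF b s(1)] integrable_cv[OF b]
      by (simp add: left_diff_distrib)
    moreover have "\<bar>LINT z|lborel. (k (z - ?d) - k z) * b (p + s *\<^sub>R z)\<bar> \<le> (LINT z|lborel. \<bar>k (z - ?d) - k z\<bar> * B)"
    proof -
      have i1: "integrable lborel (\<lambda>z. (k (z - ?d) - k z) * b (p + s *\<^sub>R z))"
        using integrable_cv_translate[OF b s(1)] integrable_cv[OF b] by (simp add: left_diff_distrib)
      have one: "bdd_borel 1 (\<lambda>_::R2. 1)" by (rule bdd_borelI) auto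
      have i2: "integrable lborel (\<lambda>z. k (z - ?d) - k z)"
        using integrable_cv_translate[OF one s(1)] integrable_k by simp
      have "\<bar>LINT z|lborel. (k (z - ?d) - k z) * b (p + s *\<^sub>R z)\<bar>
          \<le> (LINT z|lborel. \<bar>(k (z - ?d) - k z) * b (p + s *\<^sub>R z)\<bar>)"
        using integral_norm_bound[of lborel "\<lambda>z. (k (z - ?d) - k z) * b (p + s *\<^sub>R z)"] by simp
      also have "\<dots> \<le> (LINT z|lborel. \<bar>k (z - ?d) - k z\<bar> * B)"
        by (intro integral_mono integrable_abs integrable_mult_left i1 i2)
           (auto simp: abs_mult intro!: mult_left_mono bdd_borelD(2)[OF b])
      finally show ?thesis .
    qed
    moreover have "(LINT z|lborel. \<bar>k (z - ?d) - k z\<bar> * B) \<le> L * norm ?d powr \<beta> * B"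
      using L(1)[of ?d] B0 by (simp add: mult_right_mono)
    moreover have "norm ?d powr \<beta> = norm d powr \<beta> * s powr - \<beta>"
      using s by (simp add: powr_mult powr_minus inverse_powr mult.commute)
    ultimately have "\<bar>cv k s b (p + d) - cv k s b p\<bar> \<le> B * L * norm d powr \<beta> * s powr - \<beta>"
      by (simp add: mult_ac)
    moreover have "\<bar>F s\<bar> \<le> \<bar>cv k s b (p + d) - cv k s b p\<bar>"
      unfolding F_def right_diff_distrib[symmetric] abs_mult
      using mult_right_mono[OF \<omega>1[of s], of "\<bar>cv k s b (p + d) - cv k s b p\<bar>"] by simp
    ultimately show ?thesis by linarith
  qed
  then have "\<bar>LINT s|ivl 0 1. F s\<bar> \<le> B * L * norm d powr \<beta> / (1 - \<beta>)"
    using \<beta> B0 L by (intro integral_ivl_powr_bound[OF F \<beta>]) auto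
  moreover have "(LINT s|ivl 0 1. F s) = av b (p + d) - av b p"
    unfolding F_def av_iter(1)[OF b] by (intro Bochner_Integration.integral_diff av_iter(3)[OF b])
  ultimately show ?thesis by (simp add: mult_ac)
qed

end

text \<open>The scale weight \<open>s\<close> of \<open>U\<close>, cut off outside \<open>[0,1]\<close> because the locale asks for a globally bounded weight.\<close>

definition clamp01 :: "real \<Rightarrow> real" where
  "clamp01 s = (if 0 \<le> s \<and> s \<le> 1 then s else 0)"

interpretation U: scaled clamp01 nker 1
proof
  show "clamp01 \<in> borel_measurable borel" unfolding clamp01_def[abs_def] by measurable
qed (auto simp: clamp01_def abs_nker_le kernels_eq_0)

interpretation H: averaging "sqm (-1) 1" hker "\<lambda>z. z" 2
proof
  show "\<bar>hker z\<bar> \<le> 2" for z using hker_bounds[of z] by simp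
qed measurable

text \<open>The derivative of the potential in direction e: differentiating the kernel at scale s
  produces \<open>1 / s\<close>, which removes the weight of \<open>U\<close> and leaves weight 1.
  The factor 1 is written out to match \<open>scaled\<close>.\<close>

definition V :: "R2 \<Rightarrow> (R2 \<Rightarrow> real) \<Rightarrow> R2 \<Rightarrow> real" where
  "V e = averaging.av svm (\<lambda>t. 1 * kern e (snd t)) (\<lambda>t. fst t *\<^sub>R snd t)"

lemma scaled_kern: "norm e = 1 \<Longrightarrow> scaled (\<lambda>_. 1) (kern e) 2"
  by standard (auto simp: abs_kern_le kernels_eq_0)

lemma averaging_V:
  assumes "norm e = 1"
  shows "averaging svm (\<lambda>t. 1 * kern e (snd t)) (\<lambda>t. fst t *\<^sub>R snd t) 2"
proof -
  interpret scaled "\<lambda>_. 1" "kern e" 2 by (rule scaled_kern[OF assms])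
  show ?thesis by (rule averaging_axioms)
qed

lemma V_Holder:
  assumes e: "norm e = 1" and b: "bdd_borel B b" and \<beta>: "0 \<le> \<beta>" "\<beta> < 1"
  shows "\<bar>V e b p - V e b q\<bar> \<le> B * (36 * ball2) / (1 - \<beta>) * dist p q powr \<beta>"
proof -
  interpret scaled "\<lambda>_. 1" "kern e" 2 by (rule scaled_kern[OF e])
  have "(LINT z|lborel. \<bar>kern e (z - d) - kern e z\<bar>) \<le> 36 * ball2 * norm d powr \<beta>" for d
    using kernel_L1_modulus[of "kern e" 2 32 \<beta> d] kern_Lipschitz[OF e] abs_kern_le[OF e] \<beta>
    by (simp add: kernels_eq_0)
  from av_Holder[OF b \<beta> this, of q "p - q"] show ?thesis
    using ball2_nonneg by (simp add: V_def dist_norm)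
qed

text \<open>At scale s the kernel moves by \<open>t / s\<close>, so the Taylor remainder contributes
  \<open>s * |t / s| powr (3/2)\<close>. This is \<open>|t| powr (3/2)\<close> times
  \<open>s powr - (1/2)\<close>, whose integral over the scales is 2.\<close>

lemma U_derivative_bound:
  assumes e: "norm e = 1" and b: "bdd_borel B b"
  shows "\<bar>U.av b (p + t *\<^sub>R e) - U.av b p - t * V e b p\<bar> \<le> 28 * B * ball2 * \<bar>t\<bar> powr (3/2)"
proof -
  interpret K: scaled "\<lambda>_. 1" "kern e" 2 by (rule scaled_kern[OF e])
  have B0: "0 \<le> B" using b bdd_borelD by blast
  have [measurable]: "b \<in> borel_measurable borel" using b bdd_borelD by blast
  define F where "F s = clamp01 s * cv nker s b (p + t *\<^sub>R e) - clamp01 s * cv nker s b p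
    - t * (1 * cv (kern e) s b p)" for s
  have F: "F \<in> borel_measurable borel"
    unfolding F_def[abs_def]
    by (intro borel_measurable_diff borel_measurable_times borel_measurable_const U.av_iter(2)[OF b] K.av_iter(2)[OF b])
  have Fle: "\<bar>F s\<bar> \<le> (14 * B * ball2 * \<bar>t\<bar> powr (3/2)) * s powr - (1/2)" if s: "0 < s" "s \<le> 1" for s
  proof -
    let ?t = "t / s"
    have d: "(t *\<^sub>R e) /\<^sub>R s = ?t *\<^sub>R e" using s by (simp add: divide_inverse mult.commute)
    let ?D = "\<lambda>z. nker (z - ?t *\<^sub>R e) - nker z - ?t * kern e z"
    have one: "bdd_borel 1 (\<lambda>_::R2. 1)" by (rule bdd_borelI) auto
    have i: "integrable lborel (\<lambda>z. ?D z * c (p + s *\<^sub>R z))" if "bdd_borel C c" for C c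
      using U.integrable_cv_translate[OF that s(1)] U.integrable_cv[OF that] K.integrable_cv[OF that]
      by (simp add: left_diff_distrib mult.assoc)
    have "F s = s * (cv nker s b (p + t *\<^sub>R e) - cv nker s b p - ?t * cv (kern e) s b p)"
      using s by (simp add: F_def clamp01_def field_simps)
    also have "cv nker s b (p + t *\<^sub>R e) - cv nker s b p - ?t * cv (kern e) s b p
        = (LINT z|lborel. ?D z * b (p + s *\<^sub>R z))"
      unfolding U.cv_translate[OF b s(1)] d cv_def[of nker s b p] cv_def[of "kern e"]
      using U.integrable_cv_translate[OF b s(1)] U.integrable_cv[OF b] K.integrable_cv[OF b]
      by (simp add: left_diff_distrib mult.assoc)
    finally have Fs: "\<bar>F s\<bar> = s * \<bar>LINT z|lborel. ?D z * b (p + s *\<^sub>R z)\<bar>"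
      using s by (simp add: abs_mult)
    have "\<bar>LINT z|lborel. ?D z * b (p + s *\<^sub>R z)\<bar> \<le> (LINT z|lborel. \<bar>?D z * b (p + s *\<^sub>R z)\<bar>)"
      using integral_norm_bound[of lborel "\<lambda>z. ?D z * b (p + s *\<^sub>R z)"] by simp
    also have "\<dots> \<le> (LINT z|lborel. \<bar>?D z\<bar> * B)"
    proof (rule integral_mono)
      show "integrable lborel (\<lambda>z. \<bar>?D z\<bar> * B)"
        using i[OF one] by (intro integrable_mult_left integrable_abs) simp
      show "\<bar>?D z * b (p + s *\<^sub>R z)\<bar> \<le> \<bar>?D z\<bar> * B" for z
        unfolding abs_mult by (intro mult_left_mono bdd_borelD(2)[OF b]) auto
    qed (intro integrable_abs i[OF b])
    also have "\<dots> \<le> 14 * ball2 * \<bar>?t\<bar> powr (3/2) * B"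
      using nker_L1_Taylor[OF e, of ?t] B0 by (simp add: mult_right_mono)
    finally have "\<bar>F s\<bar> \<le> s * (14 * ball2 * \<bar>?t\<bar> powr (3/2) * B)"
      unfolding Fs using s by (intro mult_left_mono) auto
    also have "\<dots> = (14 * B * ball2 * \<bar>t\<bar> powr (3/2)) * s powr - (1/2)"
    proof -
      have e1: "\<bar>?t\<bar> powr (3/2) = \<bar>t\<bar> powr (3/2) * s powr - (3/2)"
        using s by (simp add: abs_divide powr_divide powr_minus_divide)
      have e2: "s * s powr - (3/2) = s powr - (1/2)"
        using s powr_add[of s 1 "- (3/2)"] by simp
      show ?thesis unfolding e1 e2[symmetric] by (simp only: mult_ac)
    qed
    finally show ?thesis .
  qed
  have 1: "\<bar>LINT s|ivl 0 1. F s\<bar> \<le> (14 * B * ball2 * \<bar>t\<bar> powr (3/2)) / (1 - 1/2)"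
  proof (rule integral_ivl_powr_bound[OF F, of "1/2"])
    show "0 \<le> 14 * B * ball2 * \<bar>t\<bar> powr (3/2)" using B0 ball2_nonneg by simp
  qed (simp_all add: Fle)
  have 2: "(LINT s|ivl 0 1. F s) = U.av b (p + t *\<^sub>R e) - U.av b p - t * V e b p"
  proof -
    note u = U.av_iter(3)[OF b] and k = K.av_iter(3)[OF b]
    have "(LINT s|ivl 0 1. F s) = (LINT s|ivl 0 1. clamp01 s * cv nker s b (p + t *\<^sub>R e) - clamp01 s * cv nker s b p)
        - (LINT s|ivl 0 1. t * (1 * cv (kern e) s b p))"
      unfolding F_def
      by (intro Bochner_Integration.integral_diff Bochner_Integration.integrable_diff integrable_mult_right u k)
    also have "(LINT s|ivl 0 1. clamp01 s * cv nker s b (p + t *\<^sub>R e) - clamp01 s * cv nker s b p)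
        = U.av b (p + t *\<^sub>R e) - U.av b p"
      unfolding U.av_iter(1)[OF b] by (intro Bochner_Integration.integral_diff u)
    also have "(LINT s|ivl 0 1. t * (1 * cv (kern e) s b p)) = t * V e b p"
      unfolding V_def K.av_iter(1)[OF b] by (rule integral_mult_right_zero)
    finally show ?thesis .
  qed
  show ?thesis using 1 unfolding 2 by (simp add: mult_ac)
qed

section \<open>The inverse Laplacian of mean-zero functions\<close>

definition mean0 :: "real \<Rightarrow> (R2 \<Rightarrow> real) \<Rightarrow> bool" where
  "mean0 B g \<longleftrightarrow> bdd_borel B g \<and> periodic2 g \<and> (LINT p|sqm 0 1. g p) = 0"

lemma mean0D:
  assumes "mean0 B g"
  shows "bdd_borel B g" "periodic2 g" "(LINT p|sqm 0 1. g p) = 0" "0 \<le> B" "\<bar>g p\<bar> \<le> B"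
  using assms bdd_borelD by (auto simp: mean0_def)

lemma integral_hker: "(LINT z|sqm (-1) 1. hker z) = 1"
  using mass_pos by (simp add: hker_def[abs_def] mass_def[symmetric])

lemma integral_half_cell:
  assumes g: "mean0 B g"
  shows "(LINT z|sqm (-1/2) (1/2). g (p + z)) = 0"
proof -
  have [measurable]: "g \<in> borel_measurable borel" using mean0D[OF g] bdd_borelD by blast
  let ?c = "(-1/2, -1/2) :: R2"
  have "(LINT z|sqm (-1/2) (1/2). g (p + z))
      = (LINT z|lborel. indicator (cbox (-1/2, -1/2) (1/2, 1/2)) z * g (p + z))"
    by (rule integral_sqm_lborel) measurable
  also have "\<dots> = (LINT z|lborel. indicator (cbox (-1/2, -1/2) (1/2, 1/2)) (z + ?c) * g (p + (z + ?c)))"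
    by (rule integral_lborel_translate[symmetric]) measurable
  also have "\<dots> = (LINT z|lborel. indicator (cbox (0, 0) (1, 1)) z * g (z + (p + ?c)))"
  proof (intro Bochner_Integration.integral_cong refl)
    fix z :: R2
    obtain x y where "z = (x, y)" by fastforce
    then have "z + ?c \<in> cbox (-1/2, -1/2) (1/2, 1/2) \<longleftrightarrow> z \<in> cbox (0, 0) (1, 1)"
      by auto
    moreover have "p + (z + ?c) = z + (p + ?c)" by (simp only: add_ac)
    ultimately show "indicator (cbox (-1/2, -1/2) (1/2, 1/2)) (z + ?c) * g (p + (z + ?c))
        = indicator (cbox (0, 0) (1, 1)) z * g (z + (p + ?c))"
      by (simp only: indicator_def)
  qed
  also have "\<dots> = (LINT z|sqm 0 1. g (z + (p + ?c)))"
    by (rule integral_sqm_lborel[symmetric]) measurable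
  also have "\<dots> = 0"
    using integral_cell_shift[OF mean0D(1,2)[OF g]] mean0D(3)[OF g] by simp
  finally show ?thesis .
qed

text \<open>The multiple \<open>1 / (2 mass)\<close> of the cell indicator lies below
  \<open>hker\<close> and annihilates mean-zero periodic functions. Subtracting it leaves a
  nonnegative kernel of mass \<open>1 - 1 / (2 mass)\<close>, at most 7/8 because
  \<open>mass <= 4\<close>.\<close>

lemma abs_H_le:
  assumes g: "mean0 B g"
  shows "\<bar>H.av g p\<bar> \<le> 7 / 8 * B"
proof -
  note gb = mean0D(1)[OF g]
  have [measurable]: "g \<in> borel_measurable borel" using gb bdd_borelD by blast
  let ?q = "\<lambda>z. hker z - indicator hcell z / (2 * mass)"
  have q0: "0 \<le> ?q z" for z
    using rho_ge_hcell[of z] mass_pos by (simp add: hker_def field_simps)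
  have gp: "bdd_borel B (\<lambda>z. g (p + z))" by (rule bdd_borel_compose[OF gb]) measurable
  have hc: "bdd_borel B (\<lambda>z. indicator hcell z * g (p + z))"
    by (rule bdd_borelI) (auto simp: indicator_def bdd_borelD(2)[OF gb] mean0D(4)[OF g])
  have ih: "integrable (sqm (-1) 1) hker" by (rule H.integrable_w)
  have ii: "integrable (sqm (-1) 1) (\<lambda>z. indicator hcell z / (2 * mass))"
    by (intro integrable_divide bdd_borel_sqm_integrable[of 1] bdd_borelI) (auto simp: indicator_def)
  have iq: "integrable (sqm (-1) 1) ?q" by (intro Bochner_Integration.integrable_diff ih ii)
  have z: "(LINT z|sqm (-1) 1. indicator hcell z * g (p + z)) = 0"
    using integral_hcell[of "\<lambda>z. g (p + z)"] integral_half_cell[OF g] by simp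
  have iqg: "integrable (sqm (-1) 1) (\<lambda>z. ?q z * g (p + z))"
    using H.integrable_av[OF gb] bdd_borel_sqm_integrable[OF hc, of "-1" 1]
    by (simp add: left_diff_distrib)
  have "(LINT z|sqm (-1) 1. ?q z * g (p + z)) = H.av g p - (LINT z|sqm (-1) 1. indicator hcell z * g (p + z)) / (2 * mass)"
    unfolding H.av_def using H.integrable_av[OF gb] bdd_borel_sqm_integrable[OF hc, of "-1" 1]
    by (simp add: left_diff_distrib)
  then have "\<bar>H.av g p\<bar> = \<bar>LINT z|sqm (-1) 1. ?q z * g (p + z)\<bar>" by (simp add: z)
  also have "\<dots> \<le> (LINT z|sqm (-1) 1. \<bar>?q z * g (p + z)\<bar>)"
    using integral_norm_bound[of "sqm (-1) 1" "\<lambda>z. ?q z * g (p + z)"] by simp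
  also have "\<dots> \<le> (LINT z|sqm (-1) 1. ?q z * B)"
  proof (intro integral_mono integrable_abs iqg integrable_mult_left iq)
    show "\<bar>?q z * g (p + z)\<bar> \<le> ?q z * B" for z
      unfolding abs_mult abs_of_nonneg[OF q0] by (intro mult_left_mono bdd_borelD(2)[OF gb] q0)
  qed
  also have "\<dots> = (1 - 1 / (2 * mass)) * B"
  proof -
    have "(LINT z|sqm (-1) 1. indicator hcell z * (1::real)) = 1"
      by (subst integral_hcell) (simp_all add: measure_sqm)
    then have "(LINT z|sqm (-1) 1. ?q z) = 1 - 1 / (2 * mass)"
      using ih ii by (simp add: integral_hker)
    then show ?thesis by simp
  qed
  also have "\<dots> \<le> 7 / 8 * B"
    using mass_le mass_pos mean0D(4)[OF g] by (intro mult_right_mono) (auto simp: field_simps)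
  finally show ?thesis .
qed

lemma mean0_H:
  assumes g: "mean0 B g"
  shows "mean0 (7 / 8 * B) (H.av g)"
  unfolding mean0_def
proof (intro conjI)
  show "bdd_borel (7 / 8 * B) (H.av g)"
    by (rule bdd_borelI[OF bdd_borelD(1)[OF H.bdd_borel_av[OF mean0D(1)[OF g]]] abs_H_le[OF g]])
  show "periodic2 (H.av g)" by (rule H.periodic2_av[OF mean0D(2)[OF g]])
  show "(LINT p|sqm 0 1. H.av g p) = 0"
    using H.integral_av[OF mean0D(1,2)[OF g]] mean0D(3)[OF g] by simp
qed

lemma mean0_H_pow:
  assumes g: "mean0 B g"
  shows "mean0 ((7 / 8) ^ n * B) ((H.av ^^ n) g)"
proof (induction n)
  case (Suc n)
  from mean0_H[OF this] show ?case by (simp add: mult.assoc)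
qed (use g in simp)

lemma abs_H_pow_le: "mean0 B g \<Longrightarrow> \<bar>(H.av ^^ n) g p\<bar> \<le> (7 / 8) ^ n * B"
  by (rule mean0D(5)[OF mean0_H_pow])

section \<open>The Neumann series\<close>

definition Bop :: "(R2 \<Rightarrow> real) \<Rightarrow> R2 \<Rightarrow> real" where
  "Bop g p = (\<Sum>n. (H.av ^^ n) g p)"

lemma seven_eighths_sums: "(\<lambda>n. (7 / 8) ^ n * B) sums (8 * B :: real)"
  using sums_mult2[OF geometric_sums[of "7/8 :: real"], of B] by simp

lemma summable_Bop: 
  assumes "mean0 B g"
  shows "summable (\<lambda>n. (H.av ^^ n) g p)"
  by (rule summable_comparison_test'[OF sums_summable[OF seven_eighths_sums[of B]]])
     (use abs_H_pow_le[OF assms] in simp)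

lemma abs_sum_H_pow_le:
  assumes "mean0 B g"
  shows "\<bar>\<Sum>n<N. (H.av ^^ n) g p\<bar> \<le> 8 * B"
proof -
  have "\<bar>\<Sum>n<N. (H.av ^^ n) g p\<bar> \<le> (\<Sum>n<N. (7 / 8) ^ n * B)"
    by (rule sum_abs[THEN order_trans]) (intro sum_mono abs_H_pow_le[OF assms])
  also have "\<dots> \<le> (\<Sum>n. (7 / 8) ^ n * B)"
    by (rule sum_le_suminf) (use sums_summable[OF seven_eighths_sums[of B]] mean0D(4)[OF assms] in auto)
  finally show ?thesis using sums_unique[OF seven_eighths_sums[of B]] by simp
qed

lemma Bop_partial_sums:
  assumes "mean0 B g"
  shows "(\<lambda>N. \<Sum>n<N. (H.av ^^ n) g p) \<longlonglongrightarrow> Bop g p"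
  unfolding Bop_def by (rule summable_LIMSEQ[OF summable_Bop[OF assms]])

lemma mean0_sum:
  assumes "mean0 B g"
  shows "mean0 (8 * B) (\<lambda>p. \<Sum>n<N. (H.av ^^ n) g p)"
  unfolding mean0_def
proof (intro conjI)
  have m [measurable]: "(H.av ^^ n) g \<in> borel_measurable borel" for n
    using mean0D(1)[OF mean0_H_pow[OF assms]] bdd_borelD by blast
  show "bdd_borel (8 * B) (\<lambda>p. \<Sum>n<N. (H.av ^^ n) g p)"
    by (rule bdd_borelI[OF _ abs_sum_H_pow_le[OF assms]]) measurable
  show "periodic2 (\<lambda>p. \<Sum>n<N. (H.av ^^ n) g p)"
    using mean0D(2)[OF mean0_H_pow[OF assms]] by (auto simp: periodic2_def intro!: sum.cong)
  show "(LINT p|sqm 0 1. (\<Sum>n<N. (H.av ^^ n) g p)) = 0"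
    by (subst Bochner_Integration.integral_sum)
       (auto intro!: bdd_borel_sqm_integrable[OF mean0D(1)[OF mean0_H_pow[OF assms]]]
         sum.neutral mean0D(3)[OF mean0_H_pow[OF assms]])
qed

lemma mean0_Bop:
  assumes g: "mean0 B g"
  shows "mean0 (8 * B) (Bop g)"
  unfolding mean0_def
proof (intro conjI)
  note S = mean0_sum[OF g]
  have m: "(\<lambda>p. \<Sum>n<N. (H.av ^^ n) g p) \<in> borel_measurable borel" for N
    using mean0D(1)[OF S] bdd_borelD by blast
  have mB: "Bop g \<in> borel_measurable borel"
    by (rule borel_measurable_LIMSEQ_real[OF Bop_partial_sums[OF g] m])
  show bB: "bdd_borel (8 * B) (Bop g)"
  proof (rule bdd_borelI[OF mB])
    show "\<bar>Bop g p\<bar> \<le> 8 * B" for p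
      by (rule LIMSEQ_le_const2[OF tendsto_rabs[OF Bop_partial_sums[OF g]]])
         (use abs_sum_H_pow_le[OF g] in auto)
  qed
  show "periodic2 (Bop g)"
    using mean0D(2)[OF mean0_H_pow[OF g]] by (auto simp: periodic2_def Bop_def)
  have "(\<lambda>N. LINT p|sqm 0 1. (\<Sum>n<N. (H.av ^^ n) g p)) \<longlonglongrightarrow> (LINT p|sqm 0 1. Bop g p)"
    by (rule integral_dominated_convergence[where w = "\<lambda>_. 8 * B"])
       (use m mB in \<open>auto intro!: AE_I2 Bop_partial_sums[OF g] abs_sum_H_pow_le[OF g]\<close>)
  then show "(LINT p|sqm 0 1. Bop g p) = 0"
    using mean0D(3)[OF S] by (simp add: LIMSEQ_const_iff)
qed

text \<open>Convolution raises the index of each term of a partial sum by one, so only the first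
  term is lost; dominated convergence carries this to the limit.\<close>

lemma H_Bop:
  assumes g: "mean0 B g"
  shows "H.av (Bop g) p = Bop g p - g p"
proof -
  have bd: "bdd_borel ((7 / 8) ^ n * B) ((H.av ^^ n) g)" for n
    by (rule mean0D(1)[OF mean0_H_pow[OF g]])
  have S: "H.av (\<lambda>p. \<Sum>n<N. (H.av ^^ n) g p) p = (\<Sum>n<Suc N. (H.av ^^ n) g p) - g p" for N
  proof (induction N)
    case 0
    then show ?case by (simp add: H.av_def)
  next
    case (Suc N)
    then show ?case
      using H.av_add[OF mean0D(1)[OF mean0_sum[OF g]] bd] by simp
  qed
  have "(\<lambda>N. H.av (\<lambda>p. \<Sum>n<N. (H.av ^^ n) g p) p) \<longlonglongrightarrow> H.av (Bop g) p"
    by (rule H.av_tendsto[OF mean0D(1)[OF mean0_sum[OF g]] mean0D(1)[OF mean0_Bop[OF g]] Bop_partial_sums[OF g]])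
  moreover have "(\<lambda>N. (\<Sum>n<Suc N. (H.av ^^ n) g p) - g p) \<longlonglongrightarrow> Bop g p - g p"
    by (intro tendsto_diff tendsto_const LIMSEQ_Suc[OF Bop_partial_sums[OF g]])
  ultimately show ?thesis
    unfolding S using LIMSEQ_unique by blast
qed

lemma mean0_diff:
  assumes "mean0 B g" "mean0 C h"
  shows "mean0 (B + C) (\<lambda>p. g p - h p)"
  unfolding mean0_def
proof (intro conjI)
  have [measurable]: "g \<in> borel_measurable borel" "h \<in> borel_measurable borel"
    using assms mean0D(1) bdd_borelD by blast+
  show "bdd_borel (B + C) (\<lambda>p. g p - h p)"
    by (rule bdd_borelI) (auto intro!: order_trans[OF abs_triangle_ineq4] add_mono mean0D(5)[OF assms(1)] mean0D(5)[OF assms(2)])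
  show "periodic2 (\<lambda>p. g p - h p)" using assms by (simp add: mean0_def periodic2_def)
  show "(LINT p|sqm 0 1. g p - h p) = 0"
    using bdd_borel_sqm_integrable[OF mean0D(1)[OF assms(1)]] bdd_borel_sqm_integrable[OF mean0D(1)[OF assms(2)]]
      mean0D(3)[OF assms(1)] mean0D(3)[OF assms(2)] by simp
qed

lemma H_pow_diff:
  assumes "mean0 B g" "mean0 C h"
  shows "(H.av ^^ n) (\<lambda>p. g p - h p) = (\<lambda>p. (H.av ^^ n) g p - (H.av ^^ n) h p)"
proof (induction n)
  case (Suc n)
  show ?case
    using H.av_diff[OF mean0D(1)[OF mean0_H_pow[OF assms(1)]] mean0D(1)[OF mean0_H_pow[OF assms(2)]]]
    by (simp add: Suc fun_eq_iff)
qed simp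

lemma Bop_diff:
  assumes "mean0 B g" "mean0 C h"
  shows "Bop (\<lambda>p. g p - h p) = (\<lambda>p. Bop g p - Bop h p)"
  unfolding Bop_def H_pow_diff[OF assms]
  using suminf_diff[OF summable_Bop[OF assms(1)] summable_Bop[OF assms(2)]] by simp

lemma H_pow_cmult: "(H.av ^^ n) (\<lambda>p. c * g p) = (\<lambda>p. c * (H.av ^^ n) g p)"
  by (induction n) (simp, simp only: funpow.simps o_apply, intro ext H.av_cmult)

lemma Bop_cmult:
  assumes "mean0 B g"
  shows "Bop (\<lambda>p. c * g p) = (\<lambda>p. c * Bop g p)"
  unfolding Bop_def H_pow_cmult using suminf_mult[OF summable_Bop[OF assms]] by simp

lemma H_pow_shift: "(H.av ^^ n) (\<lambda>p. g (p + c)) = (\<lambda>p. (H.av ^^ n) g (p + c))"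
  by (induction n) (simp, simp only: funpow.simps o_apply, intro ext H.av_shift)

lemma Bop_shift: "Bop (\<lambda>p. g (p + c)) = (\<lambda>p. Bop g (p + c))"
  unfolding Bop_def H_pow_shift ..

text \<open>Each power of the convolution preserves bounded pointwise limits, and the geometric
  majorant permits the interchange with the series (Tannery). The monotone iteration will provide
  only pointwise limits.\<close>

lemma Bop_tendsto:
  assumes f: "\<And>n. mean0 B (f n)" and g: "mean0 B g" and lim: "\<And>q. (\<lambda>n. f n q) \<longlonglongrightarrow> g q"
  shows "(\<lambda>n. Bop (f n) p) \<longlonglongrightarrow> Bop g p"
proof -
  have k: "(\<lambda>n. (H.av ^^ k) (f n) q) \<longlonglongrightarrow> (H.av ^^ k) g q" for k q
  proof (induction k arbitrary: q)
    case (Suc k)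
    show ?case
      using H.av_tendsto[OF mean0D(1)[OF mean0_H_pow[OF f]] mean0D(1)[OF mean0_H_pow[OF g]] Suc] by simp
  qed (use lim in simp)
  have "eventually (\<lambda>(k, n). norm ((H.av ^^ k) (f n) p) \<le> (7 / 8) ^ k * B) (sequentially \<times>\<^sub>F sequentially)"
    by (intro always_eventually) (auto intro: abs_H_pow_le[OF f])
  from tannerys_theorem[OF k this sums_summable[OF seven_eighths_sums]]
  show ?thesis unfolding Bop_def by simp
qed

definition ilap :: "(R2 \<Rightarrow> real) \<Rightarrow> R2 \<Rightarrow> real" where
  "ilap g = U.av (Bop g)"

lemma ilap_diff:
  assumes "mean0 B g" "mean0 C h"
  shows "ilap (\<lambda>p. g p - h p) = (\<lambda>p. ilap g p - ilap h p)"
  unfolding ilap_def Bop_diff[OF assms]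
  using U.av_diff[OF mean0D(1)[OF mean0_Bop[OF assms(1)]] mean0D(1)[OF mean0_Bop[OF assms(2)]]] by auto

lemma ilap_cmult: "mean0 B g \<Longrightarrow> ilap (\<lambda>p. c * g p) = (\<lambda>p. c * ilap g p)"
  unfolding ilap_def by (simp add: Bop_cmult U.av_cmult fun_eq_iff)

lemma ilap_shift: "ilap (\<lambda>p. g (p + c)) = (\<lambda>p. ilap g (p + c))"
  unfolding ilap_def Bop_shift by (simp add: U.av_shift fun_eq_iff)

lemma ilap_tendsto:
  assumes f: "\<And>n. mean0 B (f n)" and g: "mean0 B g" and lim: "\<And>q. (\<lambda>n. f n q) \<longlonglongrightarrow> g q"
  shows "(\<lambda>n. ilap (f n) p) \<longlonglongrightarrow> ilap g p"
  unfolding ilap_def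
  by (rule U.av_tendsto[OF mean0D(1)[OF mean0_Bop[OF f]] mean0D(1)[OF mean0_Bop[OF g]] Bop_tendsto[OF assms]])

lemma abs_ilap_le:
  assumes "mean0 B g"
  shows "\<bar>ilap g p\<bar> \<le> 32 * B"
proof -
  have "\<bar>ilap g p\<bar> \<le> U.wmass * (8 * B)"
    unfolding ilap_def by (rule U.abs_av_le[OF mean0D(1)[OF mean0_Bop[OF assms]]])
  also have "\<dots> \<le> 4 * (8 * B)"
    using U.wmass_le mean0D(4)[OF assms] by (intro mult_right_mono) auto
  finally show ?thesis by simp
qed

section \<open>Differentiability of the potential\<close>

lemma DERIV_of_power_bound:
  fixes f :: "real \<Rightarrow> real"
  assumes "\<And>h. \<bar>f (x + h) - f x - h * D\<bar> \<le> C * \<bar>h\<bar> powr (3/2)"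
  shows "(f has_real_derivative D) (at x)"
  unfolding DERIV_def
proof (rule LIM_zero_cancel, rule Lim_null_comparison)
  show "eventually (\<lambda>h. norm ((f (x + h) - f x) / h - D) \<le> C * \<bar>h\<bar> powr (1/2)) (at 0)"
  proof (rule eventually_at_filter[THEN iffD2], rule always_eventually, intro allI impI)
    fix h :: real assume h: "h \<noteq> 0"
    have "norm ((f (x + h) - f x) / h - D) = \<bar>f (x + h) - f x - h * D\<bar> / \<bar>h\<bar>"
      using h by (simp add: abs_divide[symmetric] diff_divide_distrib)
    also have "\<dots> \<le> C * \<bar>h\<bar> powr (3/2) / \<bar>h\<bar>"
      by (intro divide_right_mono assms) auto
    also have "\<bar>h\<bar> powr (3/2) = \<bar>h\<bar> powr (1/2) * \<bar>h\<bar>"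
      using powr_add[of "\<bar>h\<bar>" "1/2" 1] h by simp
    finally show "norm ((f (x + h) - f x) / h - D) \<le> C * \<bar>h\<bar> powr (1/2)" using h by simp
  qed
  show "((\<lambda>h. C * \<bar>h\<bar> powr (1/2)) \<longlongrightarrow> 0) (at 0)"
    by (auto intro!: tendsto_eq_intros tendsto_mult_right_zero)
qed

lemma continuous_Holder:
  fixes f :: "R2 \<Rightarrow> real"
  assumes "\<And>p q. \<bar>f p - f q\<bar> \<le> C * dist p q powr (1/2)"
  shows "continuous_on UNIV f"
  unfolding continuous_on_def
proof (intro ballI)
  fix p
  have "((\<lambda>q. f q - f p) \<longlongrightarrow> 0) (at p)"
  proof (rule Lim_null_comparison)
    show "eventually (\<lambda>q. norm (f q - f p) \<le> C * dist q p powr (1/2)) (at p)"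
      using assms by simp
    have "((\<lambda>q. dist q p) \<longlongrightarrow> dist p p) (at p)" by (intro tendsto_intros)
    then have "((\<lambda>q. dist q p powr (1/2)) \<longlongrightarrow> dist p p powr (1/2)) (at p)"
      by (intro tendsto_powr2) auto
    then show "((\<lambda>q. C * dist q p powr (1/2)) \<longlongrightarrow> 0) (at p)"
      by (intro tendsto_mult_right_zero) simp
  qed
  then show "(f \<longlongrightarrow> f p) (at p within UNIV)" by (rule LIM_zero_cancel)
qed

lemma continuous_V:
  assumes "norm e = 1" "bdd_borel B b"
  shows "continuous_on UNIV (V e b)"
  using V_Holder[OF assms, of "1/2"] by (intro continuous_Holder) simp

lemma nker_Lipschitz:
  assumes d: "norm d \<le> 1" and z: "norm z \<le> 2"
  shows "\<bar>nker (z - d) - nker z\<bar> \<le> 5 * norm d"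
proof -
  let ?y = "z - d"
  have y: "norm ?y \<le> 3" using norm_triangle_ineq4[of z d] d z by linarith
  have r: "\<bar>rho ?y - rho z\<bar> \<le> norm d * 5"
    using abs_rho_diff_le[of ?y z] y z mult_left_mono[of "norm ?y + norm z" 5 "norm d"] by simp
  have "\<bar>nker ?y - nker z\<bar> = \<bar>(rho ?y - rho z) * (rho ?y + rho z)\<bar> / (4 * mass)"
    using mass_pos unfolding nker_def
    by (simp add: abs_divide[symmetric] field_simps power2_eq_square abs_minus_commute)
  also have "\<dots> \<le> (norm d * 5 * 2) / (4 * mass)"
    unfolding abs_mult using r rho_bounds[of z] rho_bounds[of ?y] mass_pos
    by (intro divide_right_mono mult_mono) auto
  also have "\<dots> \<le> norm d * 5 * 2 / 2"
    using mass_ge by (intro divide_left_mono) auto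
  finally show ?thesis by simp
qed

lemma continuous_U:
  assumes "bdd_borel B b"
  shows "continuous_on UNIV (U.av b)"
proof (rule continuous_Holder)
  have "(LINT z|lborel. \<bar>nker (z - d) - nker z\<bar>) \<le> 7 * ball2 * norm d powr (1/2)" for d
    using kernel_L1_modulus[of nker 1 5 "1/2" d] nker_Lipschitz abs_nker_le
    by (simp add: kernels_eq_0)
  note H = U.av_Holder[OF assms _ _ this]
  show "\<bar>U.av b p - U.av b q\<bar> \<le> B * (7 * ball2) / (1 - 1/2) * dist p q powr (1/2)" for p q
    using H[of q "p - q"] ball2_nonneg by (simp add: dist_norm)
qed

lemma U_partials:
  assumes b: "bdd_borel B b"
  shows "((\<lambda>t. U.av b (t, y)) has_real_derivative V (1, 0) b (x, y)) (at x)"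
    and "((\<lambda>t. U.av b (x, t)) has_real_derivative V (0, 1) b (x, y)) (at y)"
proof -
  have e: "norm ((1, 0) :: R2) = 1" "norm ((0, 1) :: R2) = 1" by (simp_all add: norm_Pair)
  show "((\<lambda>t. U.av b (t, y)) has_real_derivative V (1, 0) b (x, y)) (at x)"
    using U_derivative_bound[OF e(1) b, of "(x, y)"] by (intro DERIV_of_power_bound) simp
  show "((\<lambda>t. U.av b (x, t)) has_real_derivative V (0, 1) b (x, y)) (at y)"
    using U_derivative_bound[OF e(2) b, of "(x, y)"] by (intro DERIV_of_power_bound) simp
qed

lemma px_eqI: "(\<And>x y. ((\<lambda>t. u (t, y)) has_real_derivative f (x, y)) (at x)) \<Longrightarrow> px u = f"
  by (auto simp: px_def fun_eq_iff intro!: DERIV_imp_deriv)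

lemma py_eqI: "(\<And>x y. ((\<lambda>t. u (x, t)) has_real_derivative f (x, y)) (at y)) \<Longrightarrow> py u = f"
  by (auto simp: py_def fun_eq_iff intro!: DERIV_imp_deriv)

lemma has_partialsI:
  "(\<And>x y. ((\<lambda>t. u (t, y)) has_real_derivative f (x, y)) (at x)) \<Longrightarrow>
   (\<And>x y. ((\<lambda>t. u (x, t)) has_real_derivative g (x, y)) (at y)) \<Longrightarrow> has_partials u"
  unfolding has_partials_def by (metis prod.collapse real_differentiable_def)

lemma has_partialsD:
  assumes "has_partials u"
  shows "((\<lambda>t. u (t, y)) has_real_derivative px u (x, y)) (at x)"
    and "((\<lambda>t. u (x, t)) has_real_derivative py u (x, y)) (at y)"
proof -
  have "(\<lambda>t. u (t, y)) differentiable (at x)" "(\<lambda>t. u (x, t)) differentiable (at y)"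
    using assms[unfolded has_partials_def, rule_format, of "(x, y)"] by auto
  then show "((\<lambda>t. u (t, y)) has_real_derivative px u (x, y)) (at x)"
    and "((\<lambda>t. u (x, t)) has_real_derivative py u (x, y)) (at y)"
    unfolding px_def py_def by (simp_all add: DERIV_deriv_iff_real_differentiable)
qed

lemma U_C1:
  assumes b: "bdd_borel B b"
  shows "px (U.av b) = V (1, 0) b" "py (U.av b) = V (0, 1) b" "C1 (U.av b)"
proof -
  show px: "px (U.av b) = V (1, 0) b" and py: "py (U.av b) = V (0, 1) b"
    by (rule px_eqI py_eqI; rule U_partials[OF b])+
  show "C1 (U.av b)"
    unfolding C1_def px py
    by (intro conjI continuous_U[OF b] continuous_V[OF _ b] has_partialsI[OF U_partials[OF b]])
       (simp_all add: norm_Pair)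
qed

text \<open>Continuous partials give a total derivative, needed for the chain rule along the rays
  \<open>s \<mapsto> p - s z\<close>.\<close>

lemma C1_has_derivative:
  assumes "C1 u"
  shows "(u has_derivative (\<lambda>(h, k). px u (x, y) * h + py u (x, y) * k)) (at (x, y))"
proof -
  note hp = has_partialsD[OF assms[unfolded C1_def, THEN conjunct2, THEN conjunct1]]
  have cy: "continuous_on UNIV (py u)" using assms by (simp add: C1_def)
  have "((\<lambda>(x, y). u (x, y)) has_derivative
     (\<lambda>(h, k). px u (x, y) * h + blinfun_apply (py u (x, y) *\<^sub>R id_blinfun) k)) (at (x, y) within UNIV \<times> UNIV)"
  proof (rule has_derivative_partialsI[where f = "\<lambda>x y. u (x, y)"
        and fy = "\<lambda>x y. py u (x, y) *\<^sub>R id_blinfun"])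
    show "((\<lambda>x. u (x, y)) has_derivative (*) (px u (x, y))) (at x within UNIV)"
      using hp(1) by (simp add: has_field_derivative_def)
    show "((\<lambda>y. u (x, y)) has_derivative blinfun_apply (py u (x, y) *\<^sub>R id_blinfun)) (at y within UNIV)" for x y
      using hp(2)[of x y] by (simp add: has_field_derivative_def scaleR_blinfun.rep_eq)
    have "continuous_on UNIV (\<lambda>p. py u p *\<^sub>R (id_blinfun :: real \<Rightarrow>\<^sub>L real))"
      by (intro continuous_intros cy)
    then show "continuous (at (x, y) within UNIV \<times> UNIV) (\<lambda>(x, y). py u (x, y) *\<^sub>R (id_blinfun :: real \<Rightarrow>\<^sub>L real))"
      by (simp add: continuous_on_eq_continuous_within case_prod_unfold)
  qed auto
  then show ?thesis
    by (simp add: scaleR_blinfun.rep_eq case_prod_unfold)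
qed

lemma C1_along_line:
  assumes "C1 u"
  shows "((\<lambda>s. u (p - s *\<^sub>R z)) has_real_derivative
    - (px u (p - s *\<^sub>R z) * fst z + py u (p - s *\<^sub>R z) * snd z)) (at s within S)"
proof -
  obtain x y where xy: "p - s *\<^sub>R z = (x, y)" by fastforce
  have l: "((\<lambda>s. p - s *\<^sub>R z) has_derivative (\<lambda>h. - (h *\<^sub>R z))) (at s within S)"
    by (auto intro!: derivative_eq_intros)
  have u: "(u has_derivative (\<lambda>(h, k). px u (x, y) * h + py u (x, y) * k)) (at (p - s *\<^sub>R z))"
    unfolding xy by (rule C1_has_derivative[OF assms])
  have "(\<lambda>(h, k). px u (x, y) * h + py u (x, y) * k) \<circ> (\<lambda>h. - (h *\<^sub>R z))
      = (*) (- (px u (x, y) * fst z + py u (x, y) * snd z))"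
    by (auto simp: fun_eq_iff o_def split_beta' algebra_simps)
  with diff_chain_within[OF l has_derivative_at_withinI[OF u]]
  show ?thesis
    unfolding has_field_derivative_def xy by (simp add: o_def)
qed

lemma periodic2_int:
  assumes "periodic2 u"
  shows "u (x + of_int m, y + of_int n) = u (x, y)"
  using periodic_int[of "\<lambda>x. u (x, y + of_int n)" x m] periodic_int[of "\<lambda>y. u (x, y)" y n] assms
  by (simp add: periodic2_def)

lemma periodic2_frac:
  assumes "periodic2 u"
  shows "u (frac x, frac y) = u (x, y)"
  using periodic2_int[OF assms, of x "- \<lfloor>x\<rfloor>" y "- \<lfloor>y\<rfloor>"] by (simp add: frac_def)

lemma frac_mem_unit_sq: "(frac x, frac y) \<in> unit_sq"
  by (simp add: unit_sq_def frac_lt_1 less_imp_le)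

lemma continuous_periodic_bdd:
  assumes c: "continuous_on UNIV u" and p: "periodic2 u"
  obtains B where "bdd_borel B u"
proof -
  have "compact (u ` unit_sq)"
    by (rule compact_continuous_image[OF continuous_on_subset[OF c]]) (auto simp: unit_sq_def)
  then obtain B where B: "\<forall>v \<in> u ` unit_sq. norm v \<le> B"
    using compact_imp_bounded bounded_iff by metis
  have "\<bar>u (x, y)\<bar> \<le> B" for x y
    using B frac_mem_unit_sq[of x y] periodic2_frac[OF p, of x y] by (auto simp: image_iff)
  then have "bdd_borel B u"
    by (intro bdd_borelI borel_measurable_continuous_onI c) auto
  then show thesis by (rule that)
qed

lemma continuous_periodic_uniform:
  assumes c: "continuous_on UNIV u" and p: "periodic2 u" and e: "0 < e"
  obtains d where "0 < d" "\<And>p q. dist p q < d \<Longrightarrow> \<bar>u p - u q\<bar> < e"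
proof -
  let ?K = "cbox (-1, -1) (2, 2) :: R2 set"
  have "uniformly_continuous_on ?K u"
    by (rule compact_uniformly_continuous[OF continuous_on_subset[OF c]]) auto
  then obtain d where d: "0 < d" "\<And>p q. p \<in> ?K \<Longrightarrow> q \<in> ?K \<Longrightarrow> dist q p < d \<Longrightarrow> dist (u q) (u p) < e"
    using e unfolding uniformly_continuous_on_def by metis
  have "\<bar>u P - u Q\<bar> < e" if PQ: "dist P Q < min d 1" for P Q
  proof -
    obtain x y where P: "P = (x, y)" by fastforce
    obtain x' y' where Q: "Q = (x', y')" by fastforce
    \<comment> \<open>Both points are shifted by the same integer vector: the first lands in [0,
      1)^2, the second, at distance below 1 from it, in [-1, 2]^2.\<close>
    let ?P = "(frac x, frac y)" and ?Q = "(x' + of_int (- \<lfloor>x\<rfloor>), y' + of_int (- \<lfloor>y\<rfloor>))"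
    have "?Q - ?P = Q - P" by (simp add: P Q frac_def)
    then have dst: "dist ?Q ?P = dist P Q" by (metis dist_norm dist_commute)
    have "\<bar>x' - x\<bar> \<le> dist P Q" "\<bar>y' - y\<bar> \<le> dist P Q"
      using dist_fst_le[of Q P] dist_snd_le[of Q P] by (auto simp: P Q dist_real_def dist_commute)
    then have "-1 \<le> x' - of_int \<lfloor>x\<rfloor>" "x' - of_int \<lfloor>x\<rfloor> \<le> 2" "-1 \<le> y' - of_int \<lfloor>y\<rfloor>" "y' - of_int \<lfloor>y\<rfloor> \<le> 2"
      using PQ frac_lt_1[of x] frac_lt_1[of y] frac_ge_0[of x] frac_ge_0[of y]
      unfolding frac_def by linarith+
    moreover have "-1 \<le> frac x" "frac x \<le> 2" "-1 \<le> frac y" "frac y \<le> 2"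
      using frac_lt_1[of x] frac_lt_1[of y] frac_ge_0[of x] frac_ge_0[of y] by linarith+
    ultimately have "?Q \<in> ?K" "?P \<in> ?K" by simp_all
    from d(2)[OF this(2,1)] have "dist (u ?Q) (u ?P) < e" using dst PQ by simp
    moreover have "u ?Q = u Q" "u ?P = u P"
      using periodic2_int[OF p] periodic2_frac[OF p] by (simp_all only: P Q)
    ultimately show ?thesis by (simp add: dist_real_def abs_minus_commute)
  qed
  with d(1) show thesis using that[of "min d 1"] by auto
qed

lemma periodic2_px_py:
  assumes "periodic2 u"
  shows "periodic2 (px u)" "periodic2 (py u)"
proof -
  have sh: "deriv (\<lambda>t. f t) (a + 1) = deriv f a" if "\<And>t. f (t + 1) = f t" for f :: "real \<Rightarrow> real" and a
  proof -
    have "(f has_real_derivative D) (at (a + 1)) \<longleftrightarrow> (f has_real_derivative D) (at a)" for D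
      using DERIV_shift[of f D a 1] that by simp
    then show ?thesis unfolding deriv_def by simp
  qed
  show "periodic2 (px u)"
    using assms sh[of "\<lambda>t. u (t, _)"] unfolding periodic2_def px_def by simp
  show "periodic2 (py u)"
    using assms sh[of "\<lambda>t. u (_, t)"] unfolding periodic2_def py_def by simp
qed

text \<open>Duality moves both kernels to the test function. There they combine to
  \<open>- hker z\<close> times the derivative of f along z, that is, \<open>hker z\<close> times
  the s-derivative of \<open>f (p - s z)\<close>. Integration over s leaves
  \<open>hker z * (f (p - z) - f p)\<close>, and a second use of duality returns \<open>hker\<close>
  to b.\<close>

lemma weak_identity:
  assumes b: "bdd_borel B b" "periodic2 b" and f: "C1 f" "periodic2 f"
  shows "(LINT p|sqm 0 1. V (1, 0) b p * px f p + V (0, 1) b p * py f p)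
    = (LINT p|sqm 0 1. (H.av b p - b p) * f p)"
proof -
  let ?X = "\<lambda>p. LINT t|svm. kern (1, 0) (snd t) * px f (p - fst t *\<^sub>R snd t)"
  let ?Y = "\<lambda>p. LINT t|svm. kern (0, 1) (snd t) * py f (p - fst t *\<^sub>R snd t)"
  let ?H = "\<lambda>p. LINT z|sqm (-1) 1. hker z * f (p - z)"
  have e: "norm ((1, 0) :: R2) = 1" "norm ((0, 1) :: R2) = 1" by (simp_all add: norm_Pair)
  interpret X: averaging svm "\<lambda>t. 1 * kern (1, 0) (snd t)" "\<lambda>t. fst t *\<^sub>R snd t" 2
    by (rule averaging_V[OF e(1)])
  interpret Y: averaging svm "\<lambda>t. 1 * kern (0, 1) (snd t)" "\<lambda>t. fst t *\<^sub>R snd t" 2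
    by (rule averaging_V[OF e(2)])
  interpret P: pair_sigma_finite "ivl 0 1" "sqm (-1) 1"
    by (intro pair_sigma_finite_finite ivl.finite_measure_axioms sqm.finite_measure_axioms)
  have cf: "continuous_on UNIV f" "continuous_on UNIV (px f)" "continuous_on UNIV (py f)"
    using f by (auto simp: C1_def)
  note pp = periodic2_px_py[OF f(2)]
  obtain C0 where C0: "bdd_borel C0 f" by (rule continuous_periodic_bdd[OF cf(1) f(2)])
  obtain Cx where Cx: "bdd_borel Cx (px f)" by (rule continuous_periodic_bdd[OF cf(2) pp(1)])
  obtain Cy where Cy: "bdd_borel Cy (py f)" by (rule continuous_periodic_bdd[OF cf(3) pp(2)])
  have [measurable]: "b \<in> borel_measurable borel" "f \<in> borel_measurable borel"
    "px f \<in> borel_measurable borel" "py f \<in> borel_measurable borel"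
    using b C0 Cx Cy bdd_borelD by blast+
  have V: "V (1, 0) = X.av" "V (0, 1) = Y.av" by (simp_all add: V_def)
  have iX: "integrable svm (\<lambda>t. kern (1, 0) (snd t) * px f (p - fst t *\<^sub>R snd t))"
    and iY: "integrable svm (\<lambda>t. kern (0, 1) (snd t) * py f (p - fst t *\<^sub>R snd t))" for p
  proof -
    have "bdd_borel Cx (\<lambda>q. px f (p - q))" by (rule bdd_borel_compose[OF Cx]) measurable
    from X.integrable_av[OF this, of 0] show "integrable svm (\<lambda>t. kern (1, 0) (snd t) * px f (p - fst t *\<^sub>R snd t))" by simp
    have "bdd_borel Cy (\<lambda>q. py f (p - q))" by (rule bdd_borel_compose[OF Cy]) measurable
    from Y.integrable_av[OF this, of 0] show "integrable svm (\<lambda>t. kern (0, 1) (snd t) * py f (p - fst t *\<^sub>R snd t))" by simp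
  qed
  have inner: "?X p
      + ?Y p
      = ?H p - f p" for p
  proof -
    let ?F = "\<lambda>s z. kern (1, 0) z * px f (p - s *\<^sub>R z) + kern (0, 1) z * py f (p - s *\<^sub>R z)"
    have i: "integrable (ivl 0 1 \<Otimes>\<^sub>M sqm (-1) 1) (\<lambda>(s, z). ?F s z)"
      using Bochner_Integration.integrable_add[OF iX iY, of p p] by (simp add: svm_def case_prod_unfold)
    have s: "(LINT s|ivl 0 1. ?F s z) = hker z * (f (p - z) - f p)" for z
    proof -
      let ?G = "\<lambda>s. - (px f (p - s *\<^sub>R z) * fst z + py f (p - s *\<^sub>R z) * snd z)"
      have m: "?G \<in> borel_measurable borel" by measurable
      have "bdd_borel (Cx * \<bar>fst z\<bar> + Cy * \<bar>snd z\<bar>) ?G"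
      proof (rule bdd_borelI[OF m])
        fix s
        have "\<bar>?G s\<bar> \<le> \<bar>px f (p - s *\<^sub>R z)\<bar> * \<bar>fst z\<bar> + \<bar>py f (p - s *\<^sub>R z)\<bar> * \<bar>snd z\<bar>"
          unfolding abs_mult[symmetric] by linarith
        also have "\<dots> \<le> Cx * \<bar>fst z\<bar> + Cy * \<bar>snd z\<bar>"
          by (intro add_mono mult_right_mono bdd_borelD(2)[OF Cx] bdd_borelD(2)[OF Cy]) auto
        finally show "\<bar>?G s\<bar> \<le> Cx * \<bar>fst z\<bar> + Cy * \<bar>snd z\<bar>" .
      qed
      then have "(LINT s|ivl 0 1. ?G s) = integral {0..1} ?G" by (rule integral_ivl_bdd(2))
      moreover have "(?G has_integral (f (p - 1 *\<^sub>R z) - f (p - 0 *\<^sub>R z))) {0..1}"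
        by (rule fundamental_theorem_of_calculus)
           (use C1_along_line[OF f(1)] in \<open>auto simp: has_real_derivative_iff_has_vector_derivative\<close>)
      ultimately have G: "(LINT s|ivl 0 1. ?G s) = f (p - z) - f p"
        by (simp add: integral_unique)
      have "?F s z = hker z * ?G s" for s
        unfolding kern_def hker_def by (cases z) (simp add: algebra_simps)
      then have "(LINT s|ivl 0 1. ?F s z) = (LINT s|ivl 0 1. hker z * ?G s)" by simp
      then show ?thesis using G by simp
    qed
    have fz: "bdd_borel C0 (\<lambda>z. f (p - z))" by (rule bdd_borel_compose[OF C0]) measurable
    have ih: "integrable (sqm (-1) 1) (\<lambda>z. hker z * f (p - z))"
      using H.integrable_av[OF fz, of 0] by simp
    have "?X p
      + ?Y p = (LINT t|svm. (\<lambda>(s, z). ?F s z) t)"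
      using iX iY by (simp add: case_prod_unfold)
    also have "\<dots> = (LINT z|sqm (-1) 1. LINT s|ivl 0 1. ?F s z)"
      unfolding svm_def by (rule P.integral_snd[OF i, symmetric])
    also have "\<dots> = (LINT z|sqm (-1) 1. hker z * f (p - z) - hker z * f p)"
      by (simp only: s right_diff_distrib)
    also have "\<dots> = ?H p - (LINT z|sqm (-1) 1. hker z) * f p"
      using ih H.integrable_w by simp
    finally show ?thesis by (simp add: integral_hker)
  qed
  have iVx: "integrable (sqm 0 1) (\<lambda>p. X.av b p * px f p)" and iVy: "integrable (sqm 0 1) (\<lambda>p. Y.av b p * py f p)"
    by (rule bdd_borel_sqm_integrable[OF bdd_borel_mult[OF X.bdd_borel_av[OF b(1)] Cx]]
          bdd_borel_sqm_integrable[OF bdd_borel_mult[OF Y.bdd_borel_av[OF b(1)] Cy]])+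
  have Ix: "bdd_borel (X.wmass * Cx) ?X"
    and Iy: "bdd_borel (Y.wmass * Cy) ?Y"
  proof -
    have "bdd_borel Cx (\<lambda>q. px f (- q))" by (rule bdd_borel_compose[OF Cx]) measurable
    from bdd_borel_compose[OF X.bdd_borel_av[OF this], of uminus]
    show "bdd_borel (X.wmass * Cx) ?X"
      unfolding X.av_def by simp
    have "bdd_borel Cy (\<lambda>q. py f (- q))" by (rule bdd_borel_compose[OF Cy]) measurable
    from bdd_borel_compose[OF Y.bdd_borel_av[OF this], of uminus]
    show "bdd_borel (Y.wmass * Cy) ?Y"
      unfolding Y.av_def by simp
  qed
  have "(LINT p|sqm 0 1. V (1, 0) b p * px f p + V (0, 1) b p * py f p)
      = (LINT p|sqm 0 1. X.av b p * px f p) + (LINT p|sqm 0 1. Y.av b p * py f p)"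
    unfolding V by (rule Bochner_Integration.integral_add[OF iVx iVy])
  also have "\<dots> = (LINT p|sqm 0 1. b p * ?X p)
      + (LINT p|sqm 0 1. b p * ?Y p)"
    using X.av_dual[OF b Cx pp(1)] Y.av_dual[OF b Cy pp(2)] by simp
  also have "\<dots> = (LINT p|sqm 0 1. b p * (?X p
      + ?Y p))"
    unfolding distrib_left
    by (rule Bochner_Integration.integral_add[symmetric];
        rule bdd_borel_sqm_integrable, rule bdd_borel_mult[OF b(1)], rule Ix Iy)
  also have "\<dots> = (LINT p|sqm 0 1. b p * ?H p - b p * f p)"
    by (simp only: inner right_diff_distrib)
  also have "\<dots> = (LINT p|sqm 0 1. b p * ?H p) - (LINT p|sqm 0 1. b p * f p)"
  proof (rule Bochner_Integration.integral_diff)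
    have "bdd_borel C0 (\<lambda>q. f (- q))" by (rule bdd_borel_compose[OF C0]) measurable
    from bdd_borel_compose[OF H.bdd_borel_av[OF this], of uminus]
    have "bdd_borel (H.wmass * C0) ?H"
      unfolding H.av_def by simp
    from bdd_borel_sqm_integrable[OF bdd_borel_mult[OF b(1) this]]
    show "integrable (sqm 0 1) (\<lambda>p. b p * ?H p)" .
  qed (rule bdd_borel_sqm_integrable[OF bdd_borel_mult[OF b(1) C0]])
  also have "\<dots> = (LINT p|sqm 0 1. H.av b p * f p) - (LINT p|sqm 0 1. b p * f p)"
    using H.av_dual[OF b C0 f(2)] by simp
  also have "\<dots> = (LINT p|sqm 0 1. (H.av b p - b p) * f p)"
    unfolding left_diff_distrib
    by (rule Bochner_Integration.integral_diff[symmetric])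
       (rule bdd_borel_sqm_integrable[OF bdd_borel_mult[OF H.bdd_borel_av[OF b(1)] C0]]
         bdd_borel_sqm_integrable[OF bdd_borel_mult[OF b(1) C0]])+
  finally show ?thesis .
qed

lemma cont_per_integrable:
  assumes "continuous_on UNIV u" "periodic2 u"
  shows "integrable (sqm a b) u"
  using continuous_periodic_bdd[OF assms] bdd_borel_sqm_integrable by metis

lemma cont_per_integral:
  assumes "continuous_on UNIV u" "periodic2 u"
  shows "integral unit_sq u = (LINT p|sqm 0 1. u p)"
  using continuous_periodic_bdd[OF assms] integral_unit_sq(2) by metis

lemma periodic2_ops:
  assumes "periodic2 u" "periodic2 v"
  shows "periodic2 (\<lambda>p. u p + v p)" "periodic2 (\<lambda>p. u p - v p)" "periodic2 (\<lambda>p. u p * v p)"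
  using assms by (simp_all add: periodic2_def)

lemma smooth2_C1: "smooth2 u \<Longrightarrow> C1 u"
  unfolding smooth2_def C1_def
  by (metis fold_simps pd_def)

lemma periodic2_ilap: "mean0 B g \<Longrightarrow> periodic2 (ilap g)"
  unfolding ilap_def by (rule U.periodic2_av[OF mean0D(2)[OF mean0_Bop]])

lemma C1_ilap: "mean0 B g \<Longrightarrow> C1 (ilap g)"
  unfolding ilap_def by (rule U_C1(3)[OF mean0D(1)[OF mean0_Bop]])

lemma weak_ilap:
  assumes g: "mean0 B g" and f: "C1 f" "periodic2 f"
  shows "(LINT p|sqm 0 1. px (ilap g) p * px f p + py (ilap g) p * py f p) = - (LINT p|sqm 0 1. g p * f p)"
proof -
  note b = mean0D(1,2)[OF mean0_Bop[OF g]]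
  have "(LINT p|sqm 0 1. px (ilap g) p * px f p + py (ilap g) p * py f p)
      = (LINT p|sqm 0 1. (H.av (Bop g) p - Bop g p) * f p)"
    unfolding ilap_def U_C1(1,2)[OF b(1)] by (rule weak_identity[OF b f])
  also have "\<dots> = (LINT p|sqm 0 1. - (g p * f p))"
    by (simp add: H_Bop[OF g])
  finally show ?thesis by simp
qed

lemma is_inv_lap_ilap:
  assumes g: "mean0 B g"
  shows "is_inv_lap g (ilap g)"
  unfolding is_inv_lap_def
proof (intro conjI allI impI)
  note p = periodic2_ilap[OF g] and C = C1_ilap[OF g]
  note gb = mean0D(1)[OF g] and b = mean0D(1,2)[OF mean0_Bop[OF g]]
  show "periodic2 (ilap g)" "C1 (ilap g)" by fact+
  have c: "continuous_on UNIV (ilap g)" "continuous_on UNIV (px (ilap g))" "continuous_on UNIV (py (ilap g))"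
    using C by (auto simp: C1_def)
  show "integral unit_sq (ilap g) = 0"
    unfolding cont_per_integral[OF c(1) p]
    unfolding ilap_def U.integral_av[OF b] by (simp add: mean0D(3)[OF mean0_Bop[OF g]])
  show "g integrable_on unit_sq" by (rule integral_unit_sq(1)[OF gb])
  fix \<phi> assume "smooth2 \<phi> \<and> periodic2 \<phi>"
  then have \<phi>: "C1 \<phi>" "periodic2 \<phi>" by (auto intro: smooth2_C1)
  have c\<phi>: "continuous_on UNIV \<phi>" "continuous_on UNIV (px \<phi>)" "continuous_on UNIV (py \<phi>)"
    using \<phi> by (auto simp: C1_def)
  obtain D where D: "bdd_borel D \<phi>" by (rule continuous_periodic_bdd[OF c\<phi>(1) \<phi>(2)])
  have "integral unit_sq (\<lambda>p. px (ilap g) p * px \<phi> p + py (ilap g) p * py \<phi> p)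
     = (LINT p|sqm 0 1. px (ilap g) p * px \<phi> p + py (ilap g) p * py \<phi> p)"
    by (intro cont_per_integral periodic2_ops periodic2_px_py p \<phi> continuous_intros c c\<phi>)
  also have "\<dots> = - (LINT p|sqm 0 1. g p * \<phi> p)"
    by (rule weak_ilap[OF g \<phi>])
  also have "\<dots> = - integral unit_sq (\<lambda>p. g p * \<phi> p)"
    by (simp add: integral_unit_sq(2)[OF bdd_borel_mult[OF gb D]])
  finally show "integral unit_sq (\<lambda>p. px (ilap g) p * px \<phi> p + py (ilap g) p * py \<phi> p)
     = - integral unit_sq (\<lambda>p. g p * \<phi> p)" .
qed

section \<open>Trigonometric test functions and uniqueness\<close>

text \<open>Amplitude, frequencies and phases are all free, so the family is closed under both
  partial derivatives: each multiplies the amplitude by a frequency and advances a phase by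
  pi/2.\<close>

definition trig :: "real \<Rightarrow> real \<Rightarrow> real \<Rightarrow> real \<Rightarrow> real \<Rightarrow> R2 \<Rightarrow> real" where
  "trig c \<alpha> \<beta> \<gamma> \<delta> p = c * cos (\<alpha> * fst p + \<beta>) * cos (\<gamma> * snd p + \<delta>)"

lemma trig_partials:
  "((\<lambda>t. trig c \<alpha> \<beta> \<gamma> \<delta> (t, y)) has_real_derivative trig (c * \<alpha>) \<alpha> (\<beta> + pi/2) \<gamma> \<delta> (x, y)) (at x)"
  "((\<lambda>t. trig c \<alpha> \<beta> \<gamma> \<delta> (x, t)) has_real_derivative trig (c * \<gamma>) \<alpha> \<beta> \<gamma> (\<delta> + pi/2) (x, y)) (at y)"
proof -
  have s: "cos (a + (b + pi / 2)) = - sin (a + b)" for a b :: real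
    by (simp add: cos_add sin_add)
  show "((\<lambda>t. trig c \<alpha> \<beta> \<gamma> \<delta> (t, y)) has_real_derivative trig (c * \<alpha>) \<alpha> (\<beta> + pi/2) \<gamma> \<delta> (x, y)) (at x)"
    unfolding trig_def fst_conv snd_conv s by (auto intro!: derivative_eq_intros)
  show "((\<lambda>t. trig c \<alpha> \<beta> \<gamma> \<delta> (x, t)) has_real_derivative trig (c * \<gamma>) \<alpha> \<beta> \<gamma> (\<delta> + pi/2) (x, y)) (at y)"
    unfolding trig_def fst_conv snd_conv s by (auto intro!: derivative_eq_intros)
qed

lemma px_trig: "px (trig c \<alpha> \<beta> \<gamma> \<delta>) = trig (c * \<alpha>) \<alpha> (\<beta> + pi/2) \<gamma> \<delta>"
  and py_trig: "py (trig c \<alpha> \<beta> \<gamma> \<delta>) = trig (c * \<gamma>) \<alpha> \<beta> \<gamma> (\<delta> + pi/2)"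
  by (rule px_eqI py_eqI, rule trig_partials)+

lemma continuous_trig: "continuous_on UNIV (trig c \<alpha> \<beta> \<gamma> \<delta>)"
  unfolding trig_def by (intro continuous_intros)

lemma smooth2_trig: "smooth2 (trig c \<alpha> \<beta> \<gamma> \<delta>)"
  unfolding smooth2_def
proof
  fix ds :: "bool list"
  have "\<exists>c' \<beta>' \<delta>'. fold pd ds (trig c \<alpha> \<beta> \<gamma> \<delta>) = trig c' \<alpha> \<beta>' \<gamma> \<delta>'"
  proof (induction ds arbitrary: c \<beta> \<delta>)
    case (Cons d ds)
    have "pd d (trig c \<alpha> \<beta> \<gamma> \<delta>) = (if d then trig (c * \<alpha>) \<alpha> (\<beta> + pi/2) \<gamma> \<delta> else trig (c * \<gamma>) \<alpha> \<beta> \<gamma> (\<delta> + pi/2))"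
      by (simp add: pd_def px_trig py_trig)
    then show ?case using Cons by (cases d) auto
  qed auto
  then show "continuous_on UNIV (fold pd ds (trig c \<alpha> \<beta> \<gamma> \<delta>)) \<and> has_partials (fold pd ds (trig c \<alpha> \<beta> \<gamma> \<delta>))"
    using continuous_trig has_partialsI[OF trig_partials] by metis
qed

text \<open>Cosines centred at a suffice to detect a value at a, since only the part of a function
  that is even about a matters there.\<close>

definition hc :: "nat \<Rightarrow> real \<Rightarrow> real \<Rightarrow> real" where
  "hc k a x = cos (2 * pi * real k * (x - a))"

lemma continuous_hc [continuous_intros]:
  fixes f :: "'a::t2_space \<Rightarrow> real"
  shows "continuous_on S f \<Longrightarrow> continuous_on S (\<lambda>x. hc k a (f x))"
  unfolding hc_def by (auto intro!: continuous_intros)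

lemma abs_hc_le: "\<bar>hc k a x\<bar> \<le> 1"
  by (simp add: hc_def)

definition cc :: "nat \<Rightarrow> nat \<Rightarrow> real \<Rightarrow> real \<Rightarrow> R2 \<Rightarrow> real" where
  "cc k l a b p = hc k a (fst p) * hc l b (snd p)"

lemma cc_eq_trig: "cc k l a b = trig 1 (2 * pi * real k) (- (2 * pi * real k * a)) (2 * pi * real l) (- (2 * pi * real l * b))"
  by (simp add: fun_eq_iff cc_def hc_def trig_def right_diff_distrib)

lemma hc_shift: "hc k a (x + 1) = hc k a x"
proof -
  have "2 * pi * real k * (x + 1 - a) = 2 * pi * real k * (x - a) + 2 * pi * real k" by (simp add: algebra_simps)
  then show ?thesis
    using cos_int_2pin[of "int k"] sin_int_2pin[of "int k"] by (simp add: hc_def cos_add)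
qed

lemma periodic2_cc: "periodic2 (cc k l a b)"
  by (simp add: periodic2_def cc_def hc_shift)

lemma smooth2_cc: "smooth2 (cc k l a b)"
  unfolding cc_eq_trig by (rule smooth2_trig)

lemma cc_second:
  "px (px (cc k l a b)) p = - (2 * pi * real k)\<^sup>2 * cc k l a b p"
  "py (py (cc k l a b)) p = - (2 * pi * real l)\<^sup>2 * cc k l a b p"
proof -
  have s: "cos (a + (b + pi / 2 + pi / 2)) = - cos (a + b)" for a b :: real
    by (simp add: cos_add sin_add)
  show "px (px (cc k l a b)) p = - (2 * pi * real k)\<^sup>2 * cc k l a b p"
    "py (py (cc k l a b)) p = - (2 * pi * real l)\<^sup>2 * cc k l a b p"
    unfolding cc_eq_trig px_trig py_trig unfolding trig_def s by (simp_all add: power2_eq_square)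
qed

text \<open>
  The powers of \<open>\<tau>(x) = 1 + cos(2\<pi>(x - a)) - cos(2\<pi>d)\<close> are trigonometric polynomials that blow up near \<open>a\<close> and
  stay bounded by 1 at distance more than \<open>d\<close> from \<open>a\<close>.
\<close>

lemma trig_zero_1d:
  fixes W :: "real \<Rightarrow> real"
  assumes c: "continuous_on UNIV W" and per: "\<And>x. W (x + 1) = W x"
    and orth: "\<And>k. (LINT x|ivl 0 1. W x * hc k a x) = 0"
  shows "W a \<le> 0"
proof (rule ccontr)
  assume "\<not> W a \<le> 0"
  then have Wa: "0 < W a" by simp
  have "\<exists>S. \<forall>x. \<bar>W x\<bar> \<le> S"
  proof -
    have "compact (W ` {0..1})"
      by (rule compact_continuous_image[OF continuous_on_subset[OF c]]) auto
    then obtain S where S: "\<forall>v \<in> W ` {0..1}. norm v \<le> S"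
      using compact_imp_bounded bounded_iff by metis
    have "\<bar>W x\<bar> \<le> S" for x
    proof -
      have "W (frac x) = W x" using periodic_int[of W x "- \<lfloor>x\<rfloor>"] per by (simp add: frac_def)
      moreover have "frac x \<in> {0..1}" by (simp add: frac_lt_1 less_imp_le)
      ultimately show ?thesis using S by (metis image_eqI real_norm_def)
    qed
    then show ?thesis by blast
  qed
  then obtain S where S: "\<And>x. \<bar>W x\<bar> \<le> S" by blast
  have bddW: "bdd_borel (S * C) (\<lambda>x. W x * f x)" if f: "continuous_on UNIV f" "\<And>x. \<bar>f x\<bar> \<le> C" for f C
  proof (rule bdd_borelI)
    show "(\<lambda>x. W x * f x) \<in> borel_measurable borel"
      by (intro borel_measurable_continuous_onI continuous_intros c f)
    show "\<bar>W x * f x\<bar> \<le> S * C" for x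
      unfolding abs_mult using S[of x] f(2)[of x] by (intro mult_mono) auto
  qed
  have "continuous (at a) W" using c by (simp add: continuous_on_eq_continuous_at)
  then obtain d0 where d0: "0 < d0" "\<And>x. dist x a < d0 \<Longrightarrow> dist (W x) (W a) < W a / 2"
    unfolding continuous_at_eps_delta using Wa half_gt_zero by metis
  \<comment> \<open>\<open>d <= 1/4\<close> keeps \<open>cos (2 pi d)\<close> nonnegative, so that
    \<open>A\<close> below lies in [0, 1].\<close>
  define d where "d = min (d0 / 2) (1 / 4)"
  have d: "0 < d" "d \<le> 1/4" "d < d0" using d0 by (auto simp: d_def)
  have Wd: "W a / 2 \<le> W (t + a)" if "\<bar>t\<bar> \<le> d" for t
  proof -
    have "dist (W (t + a)) (W a) < W a / 2" using d0(2)[of "t + a"] that d by (simp add: dist_real_def)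
    then show ?thesis unfolding dist_real_def by linarith
  qed
  define A where "A = 1 - cos (2 * pi * d)"
  define \<tau> where "\<tau> x = A + cos (2 * pi * (x - a))" for x
  have "0 \<le> 2 * pi * d" using d by simp
  then have "- (pi / 2) \<le> 2 * pi * d" using pi_gt_zero by linarith
  then have A: "0 \<le> A" "A \<le> 1"
    using d cos_le_one[of "2 * pi * d"] cos_ge_zero[of "2 * pi * d"] by (auto simp: A_def)
  have c\<tau>: "continuous_on UNIV (\<lambda>x. \<tau> x ^ n)" for n
    unfolding \<tau>_def by (intro continuous_intros)
  have \<tau>2: "\<bar>\<tau> x\<bar> \<le> 2" for x
    using A abs_cos_le_one[of "2 * pi * (x - a)"] unfolding \<tau>_def by linarith
  have \<tau>per: "\<tau> (x + 1) = \<tau> x" for x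
    using hc_shift[of 1 a x] by (simp add: \<tau>_def hc_def)
  have orth\<tau>: "(LINT x|ivl 0 1. W x * (\<tau> x ^ n * hc k a x)) = 0" for n k
  proof (induction n arbitrary: k)
    case (Suc n)
    have bc: "bdd_borel (S * (2 ^ n * 1)) (\<lambda>x. W x * (\<tau> x ^ n * hc j a x))" for j
    proof (rule bddW)
      show "continuous_on UNIV (\<lambda>x. \<tau> x ^ n * hc j a x)"
        by (intro continuous_intros c\<tau>)
      show "\<bar>\<tau> x ^ n * hc j a x\<bar> \<le> 2 ^ n * 1" for x
        unfolding abs_mult power_abs by (intro mult_mono power_mono \<tau>2 abs_hc_le) auto
    qed
    have I: "integrable (ivl 0 1) (\<lambda>x. W x * (\<tau> x ^ n * hc j a x))" for j
      by (rule bdd_borel_ivl_integrable[OF bc])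
    \<comment> \<open>Multiplying by the cosine of frequency 1 replaces frequency k by its two
      neighbours. At k = 0 the neighbour -1 is the same cosine as 1.\<close>
    define k1 where "k1 = (if k = 0 then 1 else k - 1)"
    have pr: "cos (2 * pi * (x - a)) * hc k a x
        = (hc (k + 1) a x + hc k1 a x) / 2" for x
    proof (cases "k = 0")
      case False
      have "2 * pi * real (k + 1) * (x - a) = 2 * pi * real k * (x - a) + 2 * pi * (x - a)"
        "2 * pi * real k1 * (x - a) = 2 * pi * real k * (x - a) - 2 * pi * (x - a)"
        using False by (simp_all add: k1_def algebra_simps of_nat_diff)
      then show ?thesis by (simp only: hc_def cos_add cos_diff) simp
    qed (simp add: k1_def hc_def)
    have "(LINT x|ivl 0 1. W x * (\<tau> x ^ Suc n * hc k a x))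
        = (LINT x|ivl 0 1. A * (W x * (\<tau> x ^ n * hc k a x))
          + (W x * (\<tau> x ^ n * hc (k + 1) a x)
          + W x * (\<tau> x ^ n * hc k1 a x)) / 2)"
    proof (intro Bochner_Integration.integral_cong refl)
      fix x
      have "\<tau> x ^ Suc n * hc k a x
        = \<tau> x ^ n * (A * hc k a x + cos (2 * pi * (x - a)) * hc k a x)"
        by (simp add: \<tau>_def algebra_simps)
      also have "\<dots> = \<tau> x ^ n * (A * hc k a x +
          (hc (k + 1) a x + hc k1 a x) / 2)"
        by (simp only: pr)
      finally have e: "\<tau> x ^ Suc n * hc k a x = \<tau> x ^ n * (A * hc k a x +
          (hc (k + 1) a x + hc k1 a x) / 2)" .
      have "w * (t * (A * c1 + (c2 + c3) / 2)) = A * (w * (t * c1)) + (w * (t * c2) + w * (t * c3)) / 2" for w t c1 c2 c3 :: real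
        by (simp add: field_simps)
      then show "W x * (\<tau> x ^ Suc n * hc k a x)
        = A * (W x * (\<tau> x ^ n * hc k a x))
          + (W x * (\<tau> x ^ n * hc (k + 1) a x)
          + W x * (\<tau> x ^ n * hc k1 a x)) / 2"
        unfolding e .
    qed
    also have "\<dots> = A * (LINT x|ivl 0 1. W x * (\<tau> x ^ n * hc k a x))
          + ((LINT x|ivl 0 1. W x * (\<tau> x ^ n * hc (k + 1) a x))
          + (LINT x|ivl 0 1. W x * (\<tau> x ^ n * hc k1 a x))) / 2"
      using I[of k] I[of "k + 1"] I[of k1] by (simp del: of_nat_add)
    also have "\<dots> = 0" unfolding Suc by simp
    finally show ?case .
  qed (use orth in simp)
  have zero: "(LINT t|ivl (-1/2) (1/2). W (t + a) * \<tau> (t + a) ^ n) = 0" for n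
  proof -
    have b: "bdd_borel (S * 2 ^ n) (\<lambda>x. W x * \<tau> x ^ n)"
      by (rule bddW[OF c\<tau>]) (simp add: power_abs power_mono[OF \<tau>2])
    have "(LINT t|ivl (-1/2) (1/2). W (t + a) * \<tau> (t + a) ^ n) = (LINT x|ivl 0 1. W (x + (a - 1/2)) * \<tau> (x + (a - 1/2)) ^ n)"
      using integral_ivl_shift[OF bdd_borel_shift[OF b, of a], of 0 1 "-1/2"] by (simp add: algebra_simps)
    also have "\<dots> = (LINT x|ivl 0 1. W x * \<tau> x ^ n)"
      by (rule integral_periodic_shift[OF b]) (simp add: per \<tau>per)
    also have "\<dots> = 0" using orth\<tau>[of n 0] by (simp add: hc_def)
    finally show ?thesis .
  qed
  define \<eta> where "\<eta> = cos (pi * d) - cos (2 * pi * d)"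
  have \<eta>: "0 < \<eta>"
    unfolding \<eta>_def using d cos_monotone_0_pi[of "pi * d" "2 * pi * d"] by simp
  have \<tau>t: "\<tau> (t + a) = 1 - cos (2 * pi * d) + cos (2 * pi * \<bar>t\<bar>)" for t
    by (cases "0 \<le> t") (simp_all add: \<tau>_def A_def)
  have big: "1 + \<eta> \<le> \<tau> (t + a)" if "\<bar>t\<bar> \<le> d / 2" for t
  proof -
    have "cos (pi * d) \<le> cos (2 * pi * \<bar>t\<bar>)"
      using that d by (intro cos_monotone_0_pi_le) auto
    then show ?thesis unfolding \<tau>t \<eta>_def by simp
  qed
  have pos: "0 \<le> \<tau> (t + a)" if "\<bar>t\<bar> \<le> d" for t
  proof -
    have "cos (2 * pi * d) \<le> cos (2 * pi * \<bar>t\<bar>)"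
      using that d by (intro cos_monotone_0_pi_le) auto
    then show ?thesis unfolding \<tau>t by simp
  qed
  have small: "\<bar>\<tau> (t + a)\<bar> \<le> 1" if "d \<le> \<bar>t\<bar>" "\<bar>t\<bar> \<le> 1/2" for t
  proof -
    have "cos (2 * pi * \<bar>t\<bar>) \<le> cos (2 * pi * d)"
      using that d by (intro cos_monotone_0_pi_le) auto
    moreover have "-1 \<le> cos (2 * pi * \<bar>t\<bar>)" by simp
    ultimately show ?thesis unfolding \<tau>t using A unfolding A_def by linarith
  qed
  \<comment> \<open>Within d / 2 of a the product grows geometrically with n, between d / 2 and d it
    is nonnegative, and beyond d it is at least -S. Over a full period the growing part wins,
    against orthogonality.\<close>
  have low: "W a / 2 * (1 + \<eta>) ^ n * indicator {-(d/2)..d/2} t - S \<le> W (t + a) * \<tau> (t + a) ^ n"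
    if t: "\<bar>t\<bar> \<le> 1/2" for n t
  proof -
    have S0: "0 \<le> S" using S[of a] by linarith
    consider "\<bar>t\<bar> \<le> d / 2" | "d / 2 < \<bar>t\<bar>" "\<bar>t\<bar> \<le> d" | "d \<le> \<bar>t\<bar>" by linarith
    then show ?thesis
    proof cases
      case 1
      then have "W a / 2 * (1 + \<eta>) ^ n \<le> W (t + a) * \<tau> (t + a) ^ n"
        using Wd[of t] big[of t] \<eta> Wa d by (intro mult_mono power_mono) auto
      moreover have "t \<in> {-(d/2)..d/2}" using 1 by auto
      ultimately show ?thesis using S0 by simp
    next
      case 2
      have "0 \<le> W (t + a) * \<tau> (t + a) ^ n"
        using Wd[of t] pos[of t] 2 Wa by (intro mult_nonneg_nonneg) auto
      moreover have "t \<notin> {-(d/2)..d/2}" using 2 by auto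
      ultimately show ?thesis using S0 by simp
    next
      case 3
      have "\<bar>W (t + a) * \<tau> (t + a) ^ n\<bar> \<le> S * 1"
        unfolding abs_mult power_abs using S[of "t + a"] small[OF 3 t] S0
        by (intro mult_mono power_le_one) auto
      moreover have "t \<notin> {-(d/2)..d/2}" using 3 d by auto
      ultimately show ?thesis by simp
    qed
  qed
  have bound: "W a / 2 * (1 + \<eta>) ^ n * d \<le> S" for n
  proof -
    let ?L = "\<lambda>t. W a / 2 * (1 + \<eta>) ^ n * indicator {-(d/2)..d/2} t - S"
    have b: "bdd_borel (S * 2 ^ n) (\<lambda>x. W x * \<tau> x ^ n)"
      by (rule bddW[OF c\<tau>]) (simp add: power_abs power_mono[OF \<tau>2])
    note b' = bdd_borel_shift[OF b, of a]
    have "((\<lambda>t. indicator {-(d/2)..d/2} t :: real) has_integral d) {-1/2..1/2}"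
    proof -
      have "((\<lambda>t. 1 :: real) has_integral (d/2 - -(d/2))) {-(d/2)..d/2}"
        using has_integral_const_real[of "1::real" "-(d/2)" "d/2"] d by simp
      then have "((\<lambda>t. 1 :: real) has_integral d) {-(d/2)..d/2}" by simp
      then have "((\<lambda>t. if t \<in> {-(d/2)..d/2} then 1 else 0 :: real) has_integral d) {-1/2..1/2}"
        by (subst has_integral_restrict) (use d in auto)
      then show ?thesis by (simp add: indicator_def[abs_def] of_bool_def)
    qed
    then have "(?L has_integral (W a / 2 * (1 + \<eta>) ^ n * d - S)) {-1/2..1/2}"
      using has_integral_const_real[of S "-1/2" "1/2"]
      by (intro has_integral_diff has_integral_mult_right) auto
    moreover have "((\<lambda>t. W (t + a) * \<tau> (t + a) ^ n) has_integral 0) {-1/2..1/2}"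
      using zero[of n] integral_ivl_bdd[OF b', of "-1/2" "1/2"] by (simp add: has_integral_integrable_integral)
    ultimately have "W a / 2 * (1 + \<eta>) ^ n * d - S \<le> 0"
      by (rule has_integral_le) (use low in auto)
    then show ?thesis by simp
  qed
  obtain n where n: "S / (W a / 2 * d) < (1 + \<eta>) ^ n"
    using real_arch_pow[of "1 + \<eta>" "S / (W a / 2 * d)"] \<eta> by auto
  then have "S < W a / 2 * (1 + \<eta>) ^ n * d"
    using Wa d by (simp add: field_simps)
  then show False using bound[of n] by simp
qed

lemma trig_zero_1d_eq:
  fixes W :: "real \<Rightarrow> real"
  assumes "continuous_on UNIV W" and "\<And>x. W (x + 1) = W x"
    and "\<And>k. (LINT x|ivl 0 1. W x * hc k a x) = 0"
  shows "W a = 0"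
proof -
  have "W a \<le> 0" by (rule trig_zero_1d[OF assms])
  moreover have "- W a \<le> 0"
    by (rule trig_zero_1d[where W = "\<lambda>x. - W x"]) (use assms in \<open>auto intro: continuous_intros\<close>)
  ultimately show ?thesis by simp
qed

lemma integral_sqm':
  fixes f :: "R2 \<Rightarrow> real"
  assumes "integrable (sqm a b) f"
  shows "(LINT p|sqm a b. f p) = (LINT y|ivl a b. LINT x|ivl a b. f (x, y))"
proof -
  have "integrable (ivl a b \<Otimes>\<^sub>M ivl a b) (\<lambda>(x, y). f (x, y))" using assms by (simp add: sqm_def)
  from ivlp.integral_snd[OF this] show ?thesis by (simp add: sqm_def)
qed

text \<open>The one-dimensional result is applied twice. For fixed l and b the coefficient in y is a
  continuous periodic function of x orthogonal to every cosine centred at any given point, hence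
  zero; then the slice in y is orthogonal to every \<open>hc l b\<close>.\<close>

lemma trig_zero:
  assumes c: "continuous_on UNIV w" and per: "periodic2 w"
    and orth: "\<And>k l a b. (LINT p|sqm 0 1. w p * cc k l a b p) = 0"
  shows "w (a, b) = 0"
proof -
  have Wz: "(LINT y|ivl 0 1. w (x, y) * hc l b y) = 0" for x l
  proof (rule trig_zero_1d_eq[where W = "\<lambda>x. LINT y|ivl 0 1. w (x, y) * hc l b y"])
    let ?g = "\<lambda>p. w p * hc l b (snd p)"
    let ?W = "\<lambda>x. LINT y|ivl 0 1. w (x, y) * hc l b y"
    have cg: "continuous_on UNIV ?g" by (intro continuous_intros c)
    have pg: "periodic2 ?g" using per by (simp add: periodic2_def hc_shift)
    obtain B where B: "bdd_borel B ?g" by (rule continuous_periodic_bdd[OF cg pg])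
    have i: "integrable (ivl 0 1) (\<lambda>y. w (x, y) * hc l b y)" for x
      using bdd_borel_ivl_integrable[OF bdd_borel_slice(1)[OF B]] by simp
    show "continuous_on UNIV ?W"
      unfolding continuous_on_iff
    proof (intro ballI allI impI)
      fix x e :: real assume e: "0 < e"
      obtain d where d: "0 < d" "\<And>p q. dist p q < d \<Longrightarrow> \<bar>?g p - ?g q\<bar> < e / 2"
        using continuous_periodic_uniform[OF cg pg, of "e / 2"] e by (metis half_gt_zero)
      have "dist (?W x') (?W x) < e" if x': "dist x' x < d" for x'
      proof -
        have "\<bar>?W x' - ?W x\<bar> = \<bar>LINT y|ivl 0 1. w (x', y) * hc l b y - w (x, y) * hc l b y\<bar>"
          using i by simp
        also have "\<dots> \<le> (LINT y|ivl 0 1. \<bar>w (x', y) * hc l b y - w (x, y) * hc l b y\<bar>)"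
          using integral_norm_bound[of "ivl 0 1" "\<lambda>y. w (x', y) * hc l b y - w (x, y) * hc l b y"]
          by simp
        also have "\<dots> \<le> (LINT y|ivl 0 1. e / 2)"
        proof (rule integral_mono)
          show "\<bar>w (x', y) * hc l b y - w (x, y) * hc l b y\<bar> \<le> e / 2" for y
            using d(2)[of "(x', y)" "(x, y)"] x' by (simp add: dist_Pair_Pair)
        qed (use i in auto)
        also have "\<dots> = e / 2" by (simp add: measure_ivl)
        finally show ?thesis using e by (simp add: dist_real_def)
      qed
      then show "\<exists>d>0. \<forall>x'\<in>UNIV. dist x' x < d \<longrightarrow> dist (?W x') (?W x) < e"
        using d(1) by blast
    qed
    show "?W (x + 1) = ?W x" for x
      using per by (simp add: periodic2_def)
    show "(LINT x'|ivl 0 1. ?W x' * hc k x x') = 0" for k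
    proof -
      have "integrable (sqm 0 1) (\<lambda>p. w p * cc k l x b p)"
        by (intro cont_per_integrable periodic2_ops per periodic2_cc continuous_intros c)
           (simp add: cc_eq_trig continuous_trig)
      from integral_sqm[OF this] orth[of k l x b]
      have "0 = (LINT x'|ivl 0 1. LINT y|ivl 0 1. w (x', y) * cc k l x b (x', y))" by simp
      also have "\<dots> = (LINT x'|ivl 0 1. ?W x' * hc k x x')"
        by (intro Bochner_Integration.integral_cong refl, subst integral_mult_left_zero[symmetric])
           (simp add: cc_def mult_ac)
      finally show ?thesis by simp
    qed
  qed
  show ?thesis
  proof (rule trig_zero_1d_eq[where W = "\<lambda>y. w (a, y)"])
    show "continuous_on UNIV (\<lambda>y. w (a, y))"
      by (rule continuous_on_compose2[OF c]) (auto intro: continuous_intros)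
  qed (use per Wz in \<open>auto simp: periodic2_def\<close>)
qed

section \<open>Integration by parts and uniqueness\<close>

lemma mean_partials:
  assumes u: "C1 u" "periodic2 u"
  shows "(LINT p|sqm 0 1. px u p) = 0" "(LINT p|sqm 0 1. py u p) = 0"
proof -
  have c: "continuous_on UNIV (px u)" "continuous_on UNIV (py u)" and hp: "has_partials u"
    using u by (auto simp: C1_def)
  note pp = periodic2_px_py[OF u(2)]
  obtain Bx where Bx: "bdd_borel Bx (px u)" by (rule continuous_periodic_bdd[OF c(1) pp(1)])
  obtain By where By: "bdd_borel By (py u)" by (rule continuous_periodic_bdd[OF c(2) pp(2)])
  have "(LINT x|ivl 0 1. px u (x, y)) = 0" for y
  proof -
    have "((\<lambda>x. px u (x, y)) has_integral (u (1, y) - u (0, y))) {0..1}"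
      by (rule fundamental_theorem_of_calculus)
         (auto simp: has_real_derivative_iff_has_vector_derivative[symmetric]
           intro: has_field_derivative_at_within has_partialsD(1)[OF hp])
    moreover have "u (1, y) = u (0, y)" using u(2)[unfolded periodic2_def, rule_format, of 0 y] by simp
    ultimately show ?thesis
      using integral_ivl_bdd(2)[OF bdd_borel_slice(2)[OF Bx]] by (simp add: integral_unique)
  qed
  then show "(LINT p|sqm 0 1. px u p) = 0"
    using integral_sqm'[OF bdd_borel_sqm_integrable[OF Bx]] by simp
  have "(LINT y|ivl 0 1. py u (x, y)) = 0" for x
  proof -
    have "((\<lambda>y. py u (x, y)) has_integral (u (x, 1) - u (x, 0))) {0..1}"
      by (rule fundamental_theorem_of_calculus)
         (auto simp: has_real_derivative_iff_has_vector_derivative[symmetric]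
           intro: has_field_derivative_at_within has_partialsD(2)[OF hp])
    moreover have "u (x, 1) = u (x, 0)" using u(2)[unfolded periodic2_def, rule_format, of x 0] by simp
    ultimately show ?thesis
      using integral_ivl_bdd(2)[OF bdd_borel_slice(1)[OF By]] by (simp add: integral_unique)
  qed
  then show "(LINT p|sqm 0 1. py u p) = 0"
    using integral_sqm[OF bdd_borel_sqm_integrable[OF By]] by simp
qed

lemma partials_mult:
  assumes "has_partials u" "has_partials v"
  shows "px (\<lambda>p. u p * v p) = (\<lambda>p. px u p * v p + u p * px v p)"
    "py (\<lambda>p. u p * v p) = (\<lambda>p. py u p * v p + u p * py v p)" "has_partials (\<lambda>p. u p * v p)"
proof -
  note U = has_partialsD[OF assms(1)] and V = has_partialsD[OF assms(2)]
  have X: "((\<lambda>t. u (t, y) * v (t, y)) has_real_derivative (\<lambda>p. px u p * v p + u p * px v p) (x, y)) (at x)" for x y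
    using DERIV_mult[OF U(1)[of y x] V(1)[of y x]] by (simp add: mult.commute add.commute)
  have Y: "((\<lambda>t. u (x, t) * v (x, t)) has_real_derivative (\<lambda>p. py u p * v p + u p * py v p) (x, y)) (at y)" for x y
    using DERIV_mult[OF U(2)[of x y] V(2)[of x y]] by (simp add: mult.commute add.commute)
  show "px (\<lambda>p. u p * v p) = (\<lambda>p. px u p * v p + u p * px v p)" by (rule px_eqI[OF X])
  show "py (\<lambda>p. u p * v p) = (\<lambda>p. py u p * v p + u p * py v p)" by (rule py_eqI[OF Y])
  show "has_partials (\<lambda>p. u p * v p)" by (rule has_partialsI[OF X Y])
qed

lemma partials_add:
  assumes "has_partials u" "has_partials v"
  shows "px (\<lambda>p. u p + v p) = (\<lambda>p. px u p + px v p)"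
    "py (\<lambda>p. u p + v p) = (\<lambda>p. py u p + py v p)" "has_partials (\<lambda>p. u p + v p)"
proof -
  note U = has_partialsD[OF assms(1)] and V = has_partialsD[OF assms(2)]
  have X: "((\<lambda>t. u (t, y) + v (t, y)) has_real_derivative (\<lambda>p. px u p + px v p) (x, y)) (at x)" for x y
    using DERIV_add[OF U(1) V(1)] by simp
  have Y: "((\<lambda>t. u (x, t) + v (x, t)) has_real_derivative (\<lambda>p. py u p + py v p) (x, y)) (at y)" for x y
    using DERIV_add[OF U(2) V(2)] by simp
  show "px (\<lambda>p. u p + v p) = (\<lambda>p. px u p + px v p)" by (rule px_eqI[OF X])
  show "py (\<lambda>p. u p + v p) = (\<lambda>p. py u p + py v p)" by (rule py_eqI[OF Y])
  show "has_partials (\<lambda>p. u p + v p)" by (rule has_partialsI[OF X Y])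
qed

lemma partials_diff:
  assumes "has_partials u" "has_partials v"
  shows "px (\<lambda>p. u p - v p) = (\<lambda>p. px u p - px v p)"
    "py (\<lambda>p. u p - v p) = (\<lambda>p. py u p - py v p)" "has_partials (\<lambda>p. u p - v p)"
proof -
  note U = has_partialsD[OF assms(1)] and V = has_partialsD[OF assms(2)]
  have X: "((\<lambda>t. u (t, y) - v (t, y)) has_real_derivative (\<lambda>p. px u p - px v p) (x, y)) (at x)" for x y
    using DERIV_diff[OF U(1) V(1)] by simp
  have Y: "((\<lambda>t. u (x, t) - v (x, t)) has_real_derivative (\<lambda>p. py u p - py v p) (x, y)) (at y)" for x y
    using DERIV_diff[OF U(2) V(2)] by simp
  show "px (\<lambda>p. u p - v p) = (\<lambda>p. px u p - px v p)" by (rule px_eqI[OF X])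
  show "py (\<lambda>p. u p - v p) = (\<lambda>p. py u p - py v p)" by (rule py_eqI[OF Y])
  show "has_partials (\<lambda>p. u p - v p)" by (rule has_partialsI[OF X Y])
qed

lemma C1_diff: "C1 u \<Longrightarrow> C1 v \<Longrightarrow> C1 (\<lambda>p. u p - v p)"
  unfolding C1_def by (simp add: partials_diff continuous_on_diff)

lemma C1_mult: "C1 u \<Longrightarrow> C1 v \<Longrightarrow> C1 (\<lambda>p. u p * v p)"
  unfolding C1_def by (simp add: partials_mult continuous_on_mult continuous_on_add)

lemma integration_by_parts:
  assumes u: "C1 u" "periodic2 u" and v: "C1 v" "periodic2 v"
  shows "(LINT p|sqm 0 1. u p * px v p) = - (LINT p|sqm 0 1. px u p * v p)"
    "(LINT p|sqm 0 1. u p * py v p) = - (LINT p|sqm 0 1. py u p * v p)"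
proof -
  note m = mean_partials[OF C1_mult[OF u(1) v(1)] periodic2_ops(3)[OF u(2) v(2)]]
  have hp: "has_partials u" "has_partials v" using u v by (auto simp: C1_def)
  have c: "continuous_on UNIV u" "continuous_on UNIV (px u)" "continuous_on UNIV (py u)"
    "continuous_on UNIV v" "continuous_on UNIV (px v)" "continuous_on UNIV (py v)"
    using u v by (auto simp: C1_def)
  have i: "integrable (sqm 0 1) (\<lambda>p. px u p * v p)" "integrable (sqm 0 1) (\<lambda>p. u p * px v p)"
    "integrable (sqm 0 1) (\<lambda>p. py u p * v p)" "integrable (sqm 0 1) (\<lambda>p. u p * py v p)"
    by (intro cont_per_integrable continuous_intros c periodic2_ops periodic2_px_py u v)+
  show "(LINT p|sqm 0 1. u p * px v p) = - (LINT p|sqm 0 1. px u p * v p)"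
    "(LINT p|sqm 0 1. u p * py v p) = - (LINT p|sqm 0 1. py u p * v p)"
    using m i unfolding partials_mult[OF hp] by simp_all
qed

lemma smooth2_pd: "smooth2 u \<Longrightarrow> smooth2 (px u)" "smooth2 u \<Longrightarrow> smooth2 (py u)"
  unfolding smooth2_def
proof -
  assume a: "\<forall>ds. continuous_on UNIV (fold pd ds u) \<and> has_partials (fold pd ds u)"
  show "\<forall>ds. continuous_on UNIV (fold pd ds (px u)) \<and> has_partials (fold pd ds (px u))"
    using a[rule_format, of "True # ds" for ds] by (simp add: pd_def)
  show "\<forall>ds. continuous_on UNIV (fold pd ds (py u)) \<and> has_partials (fold pd ds (py u))"
    using a[rule_format, of "False # ds" for ds] by (simp add: pd_def)
qed

text \<open>The difference w of two solutions has vanishing weak Laplacian. Testing with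
  \<open>cc k l a b\<close> and moving both derivatives onto this eigenfunction multiplies the
  coefficient of w by \<open>4 pi^2 (k^2 + l^2)\<close>; the remaining case k = l = 0 is the zero
  mean.\<close>

lemma is_inv_lap_unique:
  assumes u: "is_inv_lap g u" and v: "is_inv_lap g v"
  shows "u = v"
proof -
  define w where "w = (\<lambda>p. u p - v p)"
  have uC: "C1 u" "periodic2 u" and vC: "C1 v" "periodic2 v"
    using u v by (auto simp: is_inv_lap_def)
  have w: "C1 w" "periodic2 w"
    unfolding w_def by (intro C1_diff periodic2_ops uC vC)+
  have hp: "has_partials u" "has_partials v" using uC vC by (auto simp: C1_def)
  have pw: "px w = (\<lambda>p. px u p - px v p)" "py w = (\<lambda>p. py u p - py v p)"
    unfolding w_def using partials_diff[OF hp] by auto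
  have cw: "continuous_on UNIV u" "continuous_on UNIV (px u)" "continuous_on UNIV (py u)"
    "continuous_on UNIV v" "continuous_on UNIV (px v)" "continuous_on UNIV (py v)"
    "continuous_on UNIV w" "continuous_on UNIV (px w)" "continuous_on UNIV (py w)"
    using uC vC w by (auto simp: C1_def)
  have mw: "(LINT p|sqm 0 1. w p) = 0"
  proof -
    have "integral unit_sq u = 0" "integral unit_sq v = 0" using u v by (auto simp: is_inv_lap_def)
    then have "(LINT p|sqm 0 1. u p) = 0" "(LINT p|sqm 0 1. v p) = 0"
      using cont_per_integral uC(2) vC(2) cw by auto
    then show ?thesis
      unfolding w_def using cont_per_integrable[OF cw(1) uC(2)] cont_per_integrable[OF cw(4) vC(2)] by simp
  qed
  have "(LINT p|sqm 0 1. w p * cc k l a b p) = 0" for k l a b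
  proof (cases "k = 0 \<and> l = 0")
    case True
    then show ?thesis using mw by (simp add: cc_def hc_def)
  next
    case False
    let ?f = "cc k l a b"
    have f: "smooth2 ?f" "periodic2 ?f" by (rule smooth2_cc periodic2_cc)+
    note f1 = smooth2_C1[OF f(1)] and fx = smooth2_C1[OF smooth2_pd(1)[OF f(1)]]
      and fy = smooth2_C1[OF smooth2_pd(2)[OF f(1)]] and fp = periodic2_px_py[OF f(2)]
    have cf: "continuous_on UNIV ?f" "continuous_on UNIV (px ?f)" "continuous_on UNIV (py ?f)"
      using f1 by (auto simp: C1_def)
    have I: "(LINT p|sqm 0 1. px z p * px ?f p + py z p * py ?f p) = - integral unit_sq (\<lambda>p. g p * ?f p)"
      if z: "is_inv_lap g z" for z
    proof -
      have zC: "C1 z" "periodic2 z" using z by (auto simp: is_inv_lap_def)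
      then have cz: "continuous_on UNIV (px z)" "continuous_on UNIV (py z)" by (auto simp: C1_def)
      have "integral unit_sq (\<lambda>p. px z p * px ?f p + py z p * py ?f p) = - integral unit_sq (\<lambda>p. g p * ?f p)"
        using z f by (auto simp: is_inv_lap_def)
      moreover have "integral unit_sq (\<lambda>p. px z p * px ?f p + py z p * py ?f p)
          = (LINT p|sqm 0 1. px z p * px ?f p + py z p * py ?f p)"
        by (intro cont_per_integral continuous_intros cz cf periodic2_ops periodic2_px_py zC f)
      ultimately show ?thesis by simp
    qed
    have ii: "integrable (sqm 0 1) (\<lambda>p. px u p * px ?f p + py u p * py ?f p)"
      "integrable (sqm 0 1) (\<lambda>p. px v p * px ?f p + py v p * py ?f p)"
      "integrable (sqm 0 1) (\<lambda>p. px w p * px ?f p)" "integrable (sqm 0 1) (\<lambda>p. py w p * py ?f p)"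
      by (intro cont_per_integrable continuous_intros cw cf periodic2_ops periodic2_px_py uC vC w f)+
    have "0 = (LINT p|sqm 0 1. px u p * px ?f p + py u p * py ?f p) - (LINT p|sqm 0 1. px v p * px ?f p + py v p * py ?f p)"
      using I[OF u] I[OF v] by simp
    also have "\<dots> = (LINT p|sqm 0 1. (px u p * px ?f p + py u p * py ?f p) - (px v p * px ?f p + py v p * py ?f p))"
      by (rule Bochner_Integration.integral_diff[OF ii(1,2), symmetric])
    also have "\<dots> = (LINT p|sqm 0 1. px w p * px ?f p + py w p * py ?f p)"
      unfolding pw by (simp add: algebra_simps)
    also have "\<dots> = (LINT p|sqm 0 1. px w p * px ?f p) + (LINT p|sqm 0 1. py w p * py ?f p)"
      by (rule Bochner_Integration.integral_add[OF ii(3,4)])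
    also have "\<dots> = - (LINT p|sqm 0 1. w p * px (px ?f) p) - (LINT p|sqm 0 1. w p * py (py ?f) p)"
      using integration_by_parts(1)[OF w fx fp(1)] integration_by_parts(2)[OF w fy fp(2)] by simp
    also have "\<dots> = ((2 * pi * real k)\<^sup>2 + (2 * pi * real l)\<^sup>2) * (LINT p|sqm 0 1. w p * ?f p)"
      unfolding cc_second by (simp add: mult.left_commute[of "w _"] distrib_right)
    finally show ?thesis
      using False by (simp add: sum_power2_eq_zero_iff)
  qed
  from trig_zero[OF cw(7) w(2) this] have "w p = 0" for p by (cases p) simp
  then show ?thesis by (auto simp: w_def fun_eq_iff)
qed

lemma inv_lap_eq:
  assumes "mean0 B g"
  shows "inv_lap g = ilap g"
  unfolding inv_lap_def
proof (rule the_equality)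
  show *: "is_inv_lap g (ilap g)" by (rule is_inv_lap_ilap[OF assms])
  show "u = ilap g" if "is_inv_lap g u" for u by (rule is_inv_lap_unique[OF that *])
qed

section \<open>Regularity of the inverse Laplacian\<close>

lemma mean0_shift:
  assumes "mean0 B g"
  shows "mean0 B (\<lambda>p. g (p + c))"
  unfolding mean0_def
proof (intro conjI)
  show "bdd_borel B (\<lambda>p. g (p + c))" by (rule bdd_borel_compose[OF mean0D(1)[OF assms]]) measurable
  obtain c1 c2 where c: "c = (c1, c2)" by fastforce
  have "g (x + 1 + c1, y) = g (x + c1, y)" "g (x, y + 1 + c2) = g (x, y + c2)" for x y
    using mean0D(2)[OF assms, unfolded periodic2_def, rule_format, of "x + c1" y]
      mean0D(2)[OF assms, unfolded periodic2_def, rule_format, of x "y + c2"] by (simp_all add: add_ac)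
  then show "periodic2 (\<lambda>p. g (p + c))" by (simp add: periodic2_def c)
  show "(LINT p|sqm 0 1. g (p + c)) = 0"
    using integral_cell_shift[OF mean0D(1,2)[OF assms]] mean0D(3)[OF assms] by simp
qed

lemma mean0_cmult:
  assumes "mean0 B g"
  shows "mean0 (\<bar>c\<bar> * B) (\<lambda>p. c * g p)"
  unfolding mean0_def
proof (intro conjI bdd_borelI)
  have [measurable]: "g \<in> borel_measurable borel" using mean0D(1)[OF assms] bdd_borelD by blast
  show "(\<lambda>p. c * g p) \<in> borel_measurable borel" by measurable
  show "\<bar>c * g p\<bar> \<le> \<bar>c\<bar> * B" for p
    unfolding abs_mult by (intro mult_left_mono mean0D(5)[OF assms]) auto
  show "periodic2 (\<lambda>p. c * g p)" using mean0D(2)[OF assms] by (simp add: periodic2_def)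
  show "(LINT p|sqm 0 1. c * g p) = 0" using mean0D(3)[OF assms] by simp
qed

lemma mean0_bound:
  assumes "mean0 B g" "\<And>p. \<bar>g p\<bar> \<le> C"
  shows "mean0 C g"
  using assms unfolding mean0_def bdd_borel_def by blast

text \<open>
  Differentiation commutes with \<open>ilap\<close> because \<open>ilap\<close> is linear, translation invariant and bounded in the
  sup norm, and difference quotients of a periodic \<open>C\<^sup>1\<close> function converge uniformly.
\<close>

lemma ilap_directional:
  assumes g: "mean0 B g" and D: "mean0 C D" "continuous_on UNIV D"
    and e: "norm e = 1"
    and mvt: "\<And>p h. \<exists>\<theta>. \<bar>\<theta>\<bar> \<le> \<bar>h\<bar> \<and> g (p + h *\<^sub>R e) - g p = h * D (p + \<theta> *\<^sub>R e)"
  shows "((\<lambda>h. (ilap g (p + h *\<^sub>R e) - ilap g p) / h) \<longlongrightarrow> ilap D p) (at 0)"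
proof (rule LIM_I)
  fix r :: real assume r: "0 < r"
  \<comment> \<open>The sup bound for \<open>ilap\<close> has constant 32, so an error r / 64 in the
    difference quotient becomes at most r / 2.\<close>
  obtain d where d: "0 < d" "\<And>p q. dist p q < d \<Longrightarrow> \<bar>D p - D q\<bar> < r / 64"
    using continuous_periodic_uniform[OF D(2) mean0D(2)[OF D(1)], of "r / 64"] r by auto
  have "norm ((ilap g (p + h *\<^sub>R e) - ilap g p) / h - ilap D p) < r" if h: "h \<noteq> 0" "\<bar>h\<bar> < d" for h
  proof -
    let ?q = "\<lambda>q. 1 / h * (g (q + h *\<^sub>R e) - g q)"
    note gs = mean0_shift[OF g, of "h *\<^sub>R e"]
    note m1 = mean0_diff[OF gs g]
    note m2 = mean0_cmult[OF m1, of "1 / h"]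
    have bound: "\<bar>?q q - D q\<bar> \<le> r / 64" for q
    proof -
      obtain \<theta> where th: "\<bar>\<theta>\<bar> \<le> \<bar>h\<bar>" "g (q + h *\<^sub>R e) - g q = h * D (q + \<theta> *\<^sub>R e)"
        using mvt by blast
      have "dist (q + \<theta> *\<^sub>R e) q < d" using th(1) h(2) e by (simp add: dist_norm)
      from d(2)[OF this] show ?thesis using th(2) h(1) by simp
    qed
    have "mean0 (r / 64) (\<lambda>q. ?q q - D q)"
      by (rule mean0_bound[OF mean0_diff[OF m2 D(1)] bound])
    then have "\<bar>ilap (\<lambda>q. ?q q - D q) p\<bar> \<le> 32 * (r / 64)" by (rule abs_ilap_le)
    moreover have "ilap (\<lambda>q. ?q q - D q) p = (ilap g (p + h *\<^sub>R e) - ilap g p) / h - ilap D p"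
      unfolding ilap_diff[OF m2 D(1)] ilap_cmult[OF m1] ilap_diff[OF gs g] ilap_shift by simp
    ultimately show ?thesis using r by simp
  qed
  then show "\<exists>s>0. \<forall>h. h \<noteq> 0 \<and> norm (h - 0) < s \<longrightarrow> norm ((ilap g (p + h *\<^sub>R e) - ilap g p) / h - ilap D p) < r"
    using d(1) by auto
qed

lemma DERIV_mvt_abs:
  fixes f f' :: "real \<Rightarrow> real"
  assumes "\<And>x. (f has_real_derivative f' x) (at x)"
  shows "\<exists>\<theta>. \<bar>\<theta>\<bar> \<le> \<bar>h\<bar> \<and> f (x + h) - f x = h * f' (x + \<theta>)"
proof (cases "h = 0")
  case False
  show ?thesis
  proof (cases "0 < h")
    case True
    from MVT2[of x "x + h" f f'] assms True obtain z where "x < z" "z < x + h" "f (x + h) - f x = h * f' z"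
      by auto
    then show ?thesis by (intro exI[of _ "z - x"]) auto
  next
    case neg: False
    from MVT2[of "x + h" x f f'] assms neg False obtain z where z: "x + h < z" "z < x" "f x - f (x + h) = - h * f' z"
      by auto
    then have "f (x + h) - f x = h * f' z" by linarith
    then show ?thesis using z by (intro exI[of _ "z - x"]) auto
  qed
qed auto

lemma mean0_partials:
  assumes "C1 g" "periodic2 g"
  obtains C where "mean0 C (px g)" "mean0 C (py g)"
proof -
  have c: "continuous_on UNIV (px g)" "continuous_on UNIV (py g)" using assms by (auto simp: C1_def)
  note pp = periodic2_px_py[OF assms(2)]
  obtain Cx where Cx: "bdd_borel Cx (px g)" by (rule continuous_periodic_bdd[OF c(1) pp(1)])
  obtain Cy where Cy: "bdd_borel Cy (py g)" by (rule continuous_periodic_bdd[OF c(2) pp(2)])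
  have 1: "mean0 Cx (px g)" "mean0 Cy (py g)"
    using Cx Cy pp mean_partials[OF assms] by (auto simp: mean0_def)
  have "mean0 (max Cx Cy) (px g)" "mean0 (max Cx Cy) (py g)"
    by (rule mean0_bound[OF 1(1)] mean0_bound[OF 1(2)]; use mean0D(5)[OF 1(1)] mean0D(5)[OF 1(2)] in \<open>simp add: le_max_iff_disj\<close>)+
  then show thesis by (rule that)
qed

lemma ilap_partials:
  assumes g: "mean0 B g" "C1 g"
  shows "px (ilap g) = ilap (px g)" "py (ilap g) = ilap (py g)"
proof -
  have hp: "has_partials g" and c: "continuous_on UNIV (px g)" "continuous_on UNIV (py g)"
    using g by (auto simp: C1_def)
  obtain C where C: "mean0 C (px g)" "mean0 C (py g)" by (rule mean0_partials[OF g(2) mean0D(2)[OF g(1)]])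
  show "px (ilap g) = ilap (px g)"
  proof (rule px_eqI)
    fix x y :: real
    have "\<exists>\<theta>. \<bar>\<theta>\<bar> \<le> \<bar>h\<bar> \<and> g (p + h *\<^sub>R (1, 0)) - g p = h * px g (p + \<theta> *\<^sub>R (1, 0))" for p h
      using DERIV_mvt_abs[of "\<lambda>t. g (t, snd p)" "\<lambda>t. px g (t, snd p)" h "fst p"] has_partialsD(1)[OF hp]
      by (cases p) simp
    from ilap_directional[OF g(1) C(1) c(1) _ this, of "(x, y)"]
    show "((\<lambda>t. ilap g (t, y)) has_real_derivative ilap (px g) (x, y)) (at x)"
      unfolding DERIV_def by (simp add: norm_Pair)
  qed
  show "py (ilap g) = ilap (py g)"
  proof (rule py_eqI)
    fix x y :: real
    have "\<exists>\<theta>. \<bar>\<theta>\<bar> \<le> \<bar>h\<bar> \<and> g (p + h *\<^sub>R (0, 1)) - g p = h * py g (p + \<theta> *\<^sub>R (0, 1))" for p h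
      using DERIV_mvt_abs[of "\<lambda>t. g (fst p, t)" "\<lambda>t. py g (fst p, t)" h "snd p"] has_partialsD(2)[OF hp]
      by (cases p) simp
    from ilap_directional[OF g(1) C(2) c(2) _ this, of "(x, y)"]
    show "((\<lambda>t. ilap g (x, t)) has_real_derivative ilap (py g) (x, y)) (at y)"
      unfolding DERIV_def by (simp add: norm_Pair)
  qed
qed

text \<open>An inductive reading of \<open>smooth2\<close>: peeling off the derivative applied first
  matches \<open>fold\<close>, and products, compositions and \<open>ilap\<close> can be treated by
  induction on k.\<close>

primrec Ck :: "nat \<Rightarrow> (R2 \<Rightarrow> real) \<Rightarrow> bool" where
  "Ck 0 u \<longleftrightarrow> continuous_on UNIV u"
| "Ck (Suc k) u \<longleftrightarrow> continuous_on UNIV u \<and> has_partials u \<and> Ck k (px u) \<and> Ck k (py u)"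

lemma Ck_continuous: "Ck k u \<Longrightarrow> continuous_on UNIV u"
  by (cases k) auto

lemma Ck_Suc_imp: "Ck (Suc k) u \<Longrightarrow> Ck k u"
proof (induction k arbitrary: u)
  case (Suc k)
  then have "Ck (Suc k) (px u)" "Ck (Suc k) (py u)" "continuous_on UNIV u" "has_partials u"
    unfolding Ck.simps(2)[of "Suc k"] by blast+
  then show ?case using Suc.IH[of "px u"] Suc.IH[of "py u"] unfolding Ck.simps(2)[of k u] by blast
qed simp

lemma C1_iff_Ck: "C1 u \<longleftrightarrow> Ck (Suc 0) u"
  by (auto simp: C1_def)

lemma Ck_imp_C1: "Ck (Suc k) u \<Longrightarrow> C1 u"
  unfolding C1_def using Ck_continuous[of k] by simp

lemma smooth2_iff_Ck: "smooth2 u \<longleftrightarrow> (\<forall>k. Ck k u)"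
proof
  assume "\<forall>k. Ck k u"
  then have "\<forall>k. Ck k (fold pd ds u)" for ds
  proof (induction ds arbitrary: u)
    case (Cons d ds)
    have "\<forall>k. Ck k (pd d u)" using Cons.prems[rule_format, of "Suc k" for k] by (simp add: pd_def)
    from Cons.IH[OF this] show ?case by simp
  qed simp
  then show "smooth2 u"
    unfolding smooth2_def by (metis Ck.simps(2))
next
  assume "smooth2 u"
  then have "Ck k u" for k
  proof (induction k arbitrary: u)
    case 0
    then show ?case using smooth2_C1 by (auto simp: C1_def)
  next
    case (Suc k)
    then show ?case using smooth2_C1[of u] smooth2_pd[of u] by (auto simp: C1_def)
  qed
  then show "\<forall>k. Ck k u" by blast
qed

lemma Ck_add: "Ck k u \<Longrightarrow> Ck k v \<Longrightarrow> Ck k (\<lambda>p. u p + v p)"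
  by (induction k arbitrary: u v) (simp_all add: partials_add continuous_on_add)

lemma Ck_mult: "Ck k u \<Longrightarrow> Ck k v \<Longrightarrow> Ck k (\<lambda>p. u p * v p)"
proof (induction k arbitrary: u v)
  case (Suc k)
  then have "Ck k u" "Ck k v" using Ck_Suc_imp by blast+
  with Suc show ?case by (auto simp: partials_mult continuous_on_mult intro!: Ck_add)
qed (auto simp: continuous_on_mult)

lemma smooth1D:
  assumes "smooth1 f"
  shows "(f has_real_derivative deriv f x) (at x)" "smooth1 (deriv f)" "continuous_on S f"
proof -
  have d: "f differentiable (at x)" for x using assms[unfolded smooth1_def, rule_format, of 0 x] by simp
  then show "(f has_real_derivative deriv f x) (at x)" for x
    by (simp add: DERIV_deriv_iff_real_differentiable)
  show "smooth1 (deriv f)"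
    unfolding smooth1_def using assms[unfolded smooth1_def, rule_format, of "Suc n" for n]
    by (simp add: funpow_swap1)
  show "continuous_on S f"
    using d by (intro continuous_at_imp_continuous_on ballI) (simp add: differentiable_imp_continuous_within)
qed

text \<open>The induction varies f as well, because the chain rule replaces f by its
  derivative.\<close>

lemma Ck_compose: "smooth1 f \<Longrightarrow> Ck k u \<Longrightarrow> Ck k (\<lambda>p. f (u p))"
proof (induction k arbitrary: f u)
  case 0
  then show ?case using continuous_on_compose2[OF smooth1D(3)[OF 0(1), of UNIV]] by auto
next
  case (Suc k)
  note f = smooth1D[OF Suc.prems(1)]
  have hp: "has_partials u" using Suc.prems by simp
  have X: "((\<lambda>t. f (u (t, y))) has_real_derivative (\<lambda>p. deriv f (u p) * px u p) (x, y)) (at x)" for x y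
    using DERIV_chain2[OF f(1) has_partialsD(1)[OF hp, of y x]] by simp
  have Y: "((\<lambda>t. f (u (x, t))) has_real_derivative (\<lambda>p. deriv f (u p) * py u p) (x, y)) (at y)" for x y
    using DERIV_chain2[OF f(1) has_partialsD(2)[OF hp, of x y]] by simp
  have "px (\<lambda>p. f (u p)) = (\<lambda>p. deriv f (u p) * px u p)" by (rule px_eqI[OF X])
  moreover have "py (\<lambda>p. f (u p)) = (\<lambda>p. deriv f (u p) * py u p)" by (rule py_eqI[OF Y])
  moreover have "has_partials (\<lambda>p. f (u p))" by (rule has_partialsI[OF X Y])
  moreover have "Ck k (\<lambda>p. deriv f (u p))"
    by (rule Suc.IH[OF f(2) Ck_Suc_imp[OF Suc.prems(2)]])
  moreover have "continuous_on UNIV (\<lambda>p. f (u p))"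
    using continuous_on_compose2[OF f(3)[of UNIV]] Suc.prems(2) by auto
  ultimately show ?case using Suc.prems(2) by (auto intro: Ck_mult)
qed

text \<open>\<open>ilap\<close> commutes with both partials, so the gain of one derivative for
  bounded data propagates to every order.\<close>

lemma Ck_ilap:
  assumes "mean0 B g" "Ck k g"
  shows "Ck (Suc k) (ilap g)"
  using assms
proof (induction k arbitrary: B g)
  case 0
  then show ?case using C1_ilap C1_iff_Ck by blast
next
  case (Suc k)
  have C1g: "C1 g" by (rule Ck_imp_C1[OF Suc.prems(2)])
  obtain C where C: "mean0 C (px g)" "mean0 C (py g)"
    by (rule mean0_partials[OF C1g mean0D(2)[OF Suc.prems(1)]])
  have "Ck (Suc k) (ilap (px g))" "Ck (Suc k) (ilap (py g))"
    using Suc.IH[OF C(1)] Suc.IH[OF C(2)] Suc.prems(2) by auto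
  then show ?case
    using C1_ilap[OF Suc.prems(1)] unfolding Ck.simps(2)[of "Suc k"] ilap_partials[OF Suc.prems(1) C1g]
    by (auto simp: C1_def)
qed

text \<open>The defect between the Laplacian and g is continuous and periodic, and the weak equation
  with integration by parts makes it orthogonal to every \<open>cc\<close>; such a function
  vanishes.\<close>

lemma laplacian_ilap:
  assumes g: "mean0 B g" "C1 g"
  shows "px (px (ilap g)) p + py (py (ilap g)) p = g p"
proof -
  let ?u = "ilap g"
  have C2: "Ck (Suc (Suc 0)) ?u" by (rule Ck_ilap[OF g(1)]) (use g(2) C1_iff_Ck in blast)
  then have Cx: "C1 (px ?u)" and Cy: "C1 (py ?u)" using C1_iff_Ck by auto
  note pu = periodic2_px_py[OF periodic2_ilap[OF g(1)]]
  have cg: "continuous_on UNIV g" using g(2) by (simp add: C1_def)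
  have c: "continuous_on UNIV (px (px ?u))" "continuous_on UNIV (py (py ?u))"
    "continuous_on UNIV (px ?u)" "continuous_on UNIV (py ?u)"
    using Cx Cy by (auto simp: C1_def)
  define w where "w = (\<lambda>p. px (px ?u) p + py (py ?u) p - g p)"
  have cw: "continuous_on UNIV w" unfolding w_def by (intro continuous_intros c cg)
  have pw: "periodic2 w" unfolding w_def by (intro periodic2_ops periodic2_px_py pu mean0D(2)[OF g(1)])
  have "(LINT p|sqm 0 1. w p * cc k l a b p) = 0" for k l a b
  proof -
    let ?f = "cc k l a b"
    have f: "C1 ?f" "periodic2 ?f" by (rule smooth2_C1[OF smooth2_cc] periodic2_cc)+
    have cf: "continuous_on UNIV ?f" "continuous_on UNIV (px ?f)" "continuous_on UNIV (py ?f)"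
      using f by (auto simp: C1_def)
    have i: "integrable (sqm 0 1) (\<lambda>p. px (px ?u) p * ?f p)" "integrable (sqm 0 1) (\<lambda>p. py (py ?u) p * ?f p)"
      "integrable (sqm 0 1) (\<lambda>p. g p * ?f p)"
      "integrable (sqm 0 1) (\<lambda>p. px ?u p * px ?f p)" "integrable (sqm 0 1) (\<lambda>p. py ?u p * py ?f p)"
      by (intro cont_per_integrable continuous_intros c cg cf periodic2_ops periodic2_px_py pu mean0D(2)[OF g(1)] f)+
    have "(LINT p|sqm 0 1. w p * ?f p) = (LINT p|sqm 0 1. px (px ?u) p * ?f p) + (LINT p|sqm 0 1. py (py ?u) p * ?f p)
        - (LINT p|sqm 0 1. g p * ?f p)"
      unfolding w_def left_diff_distrib distrib_right using i by simp
    also have "\<dots> = - ((LINT p|sqm 0 1. px ?u p * px ?f p) + (LINT p|sqm 0 1. py ?u p * py ?f p))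
        - (LINT p|sqm 0 1. g p * ?f p)"
      using integration_by_parts(1)[OF Cx pu(1) f] integration_by_parts(2)[OF Cy pu(2) f] by simp
    also have "\<dots> = 0"
      using weak_ilap[OF g(1) f] i by simp
    finally show ?thesis .
  qed
  from trig_zero[OF cw pw this] show ?thesis by (cases p) (simp add: w_def)
qed

section \<open>Odd symmetry and the maximum principle\<close>

definition flips :: "(R2 \<Rightarrow> R2) set" where
  "flips = {\<lambda>p. (- fst p, snd p), \<lambda>p. (fst p, - snd p)}"

lemma flipsD:
  assumes "R \<in> flips"
  shows "R (p + q) = R p + R q" "R (s *\<^sub>R p) = s *\<^sub>R R p" "norm (R p) = norm p"
    "R \<in> borel_measurable borel"
proof -
  from assms consider "R = (\<lambda>p. (- fst p, snd p))" | "R = (\<lambda>p. (fst p, - snd p))"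
    unfolding flips_def by blast
  then have *: "R (p + q) = R p + R q \<and> R (s *\<^sub>R p) = s *\<^sub>R R p \<and> norm (R p) = norm p \<and> R \<in> borel_measurable borel"
    by cases (simp_all add: prod_eq_iff norm_prod_def borel_measurable_continuous_onI continuous_intros)
  then show "R (p + q) = R p + R q" "R (s *\<^sub>R p) = s *\<^sub>R R p" "norm (R p) = norm p"
    "R \<in> borel_measurable borel" by blast+
qed

lemma integral_ivl_flip:
  fixes f :: "real \<Rightarrow> real"
  assumes "f \<in> borel_measurable borel"
  shows "(LINT x|ivl (-1) 1. f (- x)) = (LINT x|ivl (-1) 1. f x)"
proof -
  have m: "(\<lambda>x. f (- x)) \<in> borel_measurable borel" using assms by measurable
  have "(LINT x|ivl (-1) 1. f x) = (LINT x|lborel. indicator {-1..1} x * f x)"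
    by (rule integral_ivl_lborel[OF assms])
  also have "\<dots> = \<bar>- 1\<bar> *\<^sub>R (LINT x|lborel. indicator {-1..1} (0 + (- 1) * x) * f (0 + (- 1) * x))"
    by (rule lborel_integral_real_affine) simp
  also have "\<dots> = (LINT x|lborel. indicator {-1..1} x * f (- x))"
    by (simp, intro Bochner_Integration.integral_cong refl) (auto simp: indicator_def)
  also have "\<dots> = (LINT x|ivl (-1) 1. f (- x))"
    by (rule integral_ivl_lborel[OF m, symmetric])
  finally show ?thesis by simp
qed

lemma integral_sqm_flip:
  assumes f: "bdd_borel B f" and R: "R \<in> flips"
  shows "(LINT z|sqm (-1) 1. f (R z)) = (LINT z|sqm (-1) 1. f z)"
proof -
  have fR: "bdd_borel B (\<lambda>z. f (R z))" by (rule bdd_borel_compose[OF f flipsD(4)[OF R]])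
  note i = bdd_borel_sqm_integrable[OF f] bdd_borel_sqm_integrable[OF fR]
  have m: "(\<lambda>x. f (x, y)) \<in> borel_measurable borel" "(\<lambda>y. f (x, y)) \<in> borel_measurable borel" for x y
    using bdd_borel_slice[OF f] bdd_borelD by blast+
  from R consider "R = (\<lambda>p. (- fst p, snd p))" | "R = (\<lambda>p. (fst p, - snd p))" unfolding flips_def by blast
  then show ?thesis
  proof cases
    case 1
    then show ?thesis
      using integral_sqm'[OF i(1)] integral_sqm'[OF i(2)] integral_ivl_flip[OF m(1)] by simp
  next
    case 2
    then show ?thesis
      using integral_sqm[OF i(1)] integral_sqm[OF i(2)] integral_ivl_flip[OF m(2)] by simp
  qed
qed

lemma rho_flip: "R \<in> flips \<Longrightarrow> rho (R z) = rho z"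
  unfolding rho_def using flipsD(3)[of R z] by simp

lemma flip_kernel_integral:
  assumes g: "bdd_borel B g" and R: "R \<in> flips" and k: "bdd_borel C k" "\<And>z. k (R z) = k z"
  shows "(LINT z|sqm (-1) 1. k z * g (R (p + s *\<^sub>R z))) = (LINT z|sqm (-1) 1. k z * g (R p + s *\<^sub>R z))"
proof -
  have "bdd_borel B (\<lambda>z. g (R p + s *\<^sub>R z))" by (rule bdd_borel_compose[OF g]) measurable
  from integral_sqm_flip[OF bdd_borel_mult[OF k(1) this] R]
  show ?thesis by (simp add: k(2) flipsD(1,2)[OF R])
qed

lemma H_flip:
  assumes g: "bdd_borel B g" and R: "R \<in> flips"
  shows "H.av (\<lambda>p. g (R p)) p = H.av g (R p)"
proof -
  have "bdd_borel 2 hker" by (rule bdd_borelI[OF borel_kernels(1)]) (simp add: hker_bounds)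
  from flip_kernel_integral[OF g R this, of p 1] show ?thesis
    unfolding H.av_def by (simp add: hker_def rho_flip[OF R])
qed

lemma U_flip:
  assumes g: "bdd_borel B g" and R: "R \<in> flips"
  shows "U.av (\<lambda>p. g (R p)) p = U.av g (R p)"
proof -
  have n: "bdd_borel 1 nker" by (rule bdd_borelI[OF borel_kernels(2) abs_nker_le])
  have gR: "bdd_borel B (\<lambda>p. g (R p))" by (rule bdd_borel_compose[OF g flipsD(4)[OF R]])
  have "cv nker s (\<lambda>p. g (R p)) p = cv nker s g (R p)" for s
    unfolding U.cv_sqm[OF g] U.cv_sqm[OF gR]
    by (rule flip_kernel_integral[OF g R n]) (simp add: nker_def rho_flip[OF R])
  then show ?thesis unfolding U.av_iter(1)[OF g] U.av_iter(1)[OF gR] by simp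
qed

text \<open>Radial kernels and a symmetric square of integration make every ingredient commute with
  the two reflections.\<close>

lemma ilap_flip:
  assumes g: "mean0 B g" and R: "R \<in> flips"
  shows "ilap (\<lambda>p. g (R p)) = (\<lambda>p. ilap g (R p))"
proof -
  have pow: "(H.av ^^ n) (\<lambda>p. g (R p)) = (\<lambda>p. (H.av ^^ n) g (R p))" for n
  proof (induction n)
    case (Suc n)
    show ?case
      using H_flip[OF mean0D(1)[OF mean0_H_pow[OF g]] R] by (simp add: Suc)
  qed simp
  have "Bop (\<lambda>p. g (R p)) = (\<lambda>p. Bop g (R p))" unfolding Bop_def pow ..
  then show ?thesis
    unfolding ilap_def using U_flip[OF mean0D(1)[OF mean0_Bop[OF g]] R] by auto
qed

definition odd2 :: "(R2 \<Rightarrow> real) \<Rightarrow> bool" where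
  "odd2 u \<longleftrightarrow> (\<forall>x y. u (- x, y) = - u (x, y) \<and> u (x, - y) = - u (x, y))"

lemma odd2D:
  assumes "odd2 u"
  shows "u (- x, y) = - u (x, y)" "u (x, - y) = - u (x, y)"
  using assms unfolding odd2_def by blast+

lemma odd2_ilap:
  assumes g: "mean0 B g" "odd2 g"
  shows "odd2 (ilap g)"
proof -
  have R: "ilap g (R p) = - ilap g p" if R: "R \<in> flips" "\<And>p. g (R p) = - g p" for R p
  proof -
    have eq: "(\<lambda>p. g (R p)) = (\<lambda>p. - 1 * g p)" using R(2) by (simp only: mult_minus1)
    have "ilap g (R p) = ilap (\<lambda>p. g (R p)) p"
      using fun_cong[OF ilap_flip[OF g(1) R(1)], of p] by (rule sym)
    also have "\<dots> = - 1 * ilap g p"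
      unfolding eq by (rule fun_cong[OF ilap_cmult[OF g(1)]])
    finally show ?thesis by simp
  qed
  have fl: "(\<lambda>p. (- fst p, snd p)) \<in> flips" "(\<lambda>p. (fst p, - snd p)) \<in> flips"
    by (simp_all add: flips_def)
  have "g (- fst p, snd p) = - g p" "g (fst p, - snd p) = - g p" for p
    by (cases p; simp add: odd2D[OF g(2)])+
  note Rx = R[OF fl(1) this(1)] and Ry = R[OF fl(2) this(2)]
  have "ilap g (- x, y) = - ilap g (x, y)" "ilap g (x, - y) = - ilap g (x, y)" for x y
    using Rx[of "(x, y)"] Ry[of "(x, y)"] unfolding fst_conv snd_conv .
  then show ?thesis unfolding odd2_def by blast
qed

text \<open>The lines at 1/2 and -1/2 coincide on the torus, so oddness forces zeros there as well
  as on the axes. These are the Dirichlet conditions for the square of side 1/2.\<close>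

lemma odd2_boundary:
  assumes "odd2 u" "periodic2 u"
  shows "u (0, y) = 0" "u (1/2, y) = 0" "u (x, 0) = 0" "u (x, 1/2) = 0"
proof -
  show "u (0, y) = 0"
    using odd2D(1)[OF assms(1), of 0 y] unfolding minus_zero equal_neg_zero .
  show "u (x, 0) = 0"
    using odd2D(2)[OF assms(1), of x 0] unfolding minus_zero equal_neg_zero .
  have h: "- (1/2) + 1 = (1/2 :: real)" by simp
  have 1: "u (1/2, y) = u (- (1/2), y)" "u (x, 1/2) = u (x, - (1/2))"
    using assms(2)[unfolded periodic2_def, rule_format, of "- (1/2)" y]
      assms(2)[unfolded periodic2_def, rule_format, of x "- (1/2)"] unfolding h by blast+
  show "u (1/2, y) = 0"
    using trans[OF 1(1) odd2D(1)[OF assms(1)]] unfolding equal_neg_zero .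
  show "u (x, 1/2) = 0"
    using trans[OF 1(2) odd2D(2)[OF assms(1)]] unfolding equal_neg_zero .
qed

text \<open>The reflection \<open>x \<mapsto> 1 - x\<close> preserves the cell and, by oddness and
  periodicity, reverses the sign.\<close>

lemma mean0_odd2:
  assumes u: "bdd_borel B u" "periodic2 u" "odd2 u"
  shows "mean0 B u"
proof -
  have "(LINT x|ivl 0 1. u (x, y)) = 0" for y
  proof -
    have m: "(\<lambda>x. u (x, y)) \<in> borel_measurable borel" using bdd_borel_slice(2)[OF u(1)] bdd_borelD by blast
    have m': "(\<lambda>x. u (1 - x, y)) \<in> borel_measurable borel" using m by measurable
    have e: "u (1 - x, y) = - u (x, y)" for x
      using u(2)[unfolded periodic2_def, rule_format, of "- x" y] odd2D(1)[OF u(3), of x y] by simp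
    have "(LINT x|ivl 0 1. u (x, y)) = (LINT x|lborel. indicator {0..1} x * u (x, y))"
      by (rule integral_ivl_lborel[OF m])
    also have "\<dots> = \<bar>- 1\<bar> *\<^sub>R (LINT x|lborel. indicator {0..1} (1 + (- 1) * x) * u (1 + (- 1) * x, y))"
      by (rule lborel_integral_real_affine) simp
    also have "\<dots> = (LINT x|lborel. indicator {0..1} x * u (1 - x, y))"
      by (simp, intro Bochner_Integration.integral_cong refl) (auto simp: indicator_def)
    also have "\<dots> = (LINT x|ivl 0 1. u (1 - x, y))"
      by (rule integral_ivl_lborel[OF m', symmetric])
    also have "\<dots> = - (LINT x|ivl 0 1. u (x, y))" by (simp add: e)
    finally show ?thesis by simp
  qed
  then show ?thesis
    using u integral_sqm'[OF bdd_borel_sqm_integrable[OF u(1)]] by (simp add: mean0_def)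
qed

section \<open>The maximum principle on the quarter cell\<close>

lemma second_derivative_at_max:
  fixes f f' :: "real \<Rightarrow> real"
  assumes f: "\<And>x. (f has_real_derivative f' x) (at x)" and f': "(f' has_real_derivative D) (at x)"
    and d: "0 < d" and max: "\<And>t. \<bar>t - x\<bar> < d \<Longrightarrow> f t \<le> f x"
  shows "D \<le> 0"
proof (rule ccontr)
  assume "\<not> D \<le> 0"
  then have D: "0 < D" by simp
  have z: "f' x = 0" by (rule DERIV_local_max[OF f d]) (use max in \<open>auto simp: abs_minus_commute\<close>)
  obtain e where e: "0 < e" "\<And>h. 0 < h \<Longrightarrow> h < e \<Longrightarrow> f' x < f' (x + h)"
    using DERIV_pos_inc_right[OF f' D] by blast
  define h where "h = min d e / 2"
  have h: "0 < h" "h < d" "h < e" using d e by (auto simp: h_def)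
  from MVT2[of x "x + h" f f'] f h obtain s where s: "x < s" "s < x + h" "f (x + h) - f x = h * f' s" by auto
  have "0 < f' s" using e(2)[of "s - x"] s h z by simp
  then have "f x < f (x + h)" using s(3) h mult_pos_pos[of h "f' s"] by linarith
  then show False using max[of "x + h"] h by simp
qed

text \<open>Adding \<open>\<eta> (x^2 + y^2)\<close> makes the Laplacian strictly positive, which is
  incompatible with an interior maximum of the sum.\<close>

lemma max_principle:
  assumes u: "continuous_on UNIV u" "has_partials u" "has_partials (px u)" "has_partials (py u)"
    and bd: "\<And>x y. u (0, y) \<le> 0" "\<And>x y. u (1/2, y) \<le> 0" "\<And>x. u (x, 0) \<le> 0" "\<And>x. u (x, 1/2) \<le> 0"
    and sub: "\<And>x y. 0 < x \<Longrightarrow> x < 1/2 \<Longrightarrow> 0 < y \<Longrightarrow> y < 1/2 \<Longrightarrow> 0 \<le> px (px u) (x, y) + py (py u) (x, y)"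
    and xy: "0 \<le> x" "x \<le> 1/2" "0 \<le> y" "y \<le> 1/2"
  shows "u (x, y) \<le> 0"
proof -
  let ?Q = "cbox (0, 0) (1/2, 1/2) :: R2 set"
  have "u (x, y) \<le> \<eta>" if \<eta>: "0 < \<eta>" for \<eta>
  proof -
    define v where "v = (\<lambda>p. u p + \<eta> * ((fst p)\<^sup>2 + (snd p)\<^sup>2))"
    have cv: "continuous_on ?Q v"
      unfolding v_def by (intro continuous_intros continuous_on_subset[OF u(1)]) auto
    have "(0, 0) \<in> ?Q" by simp
    then have "?Q \<noteq> {}" by blast
    then obtain m where m: "m \<in> ?Q" "\<And>q. q \<in> ?Q \<Longrightarrow> v q \<le> v m"
      using continuous_attains_sup[OF compact_cbox _ cv] by blast
    obtain a b where ab: "m = (a, b)" by fastforce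
    have r: "0 \<le> a" "a \<le> 1/2" "0 \<le> b" "b \<le> 1/2" using m(1) by (auto simp: ab)
    \<comment> \<open>On the sides u is nonpositive, so a positive value at the maximiser of v
      forces it into the interior.\<close>
    have um: "u m \<le> 0"
    proof (rule ccontr)
      assume n: "\<not> u m \<le> 0"
      then have "a \<noteq> 0" "a \<noteq> 1/2" "b \<noteq> 0" "b \<noteq> 1/2" using bd unfolding ab by metis+
      then have i: "0 < a" "a < 1/2" "0 < b" "b < 1/2" using r by auto
      define d where "d = min (min a (1/2 - a)) (min b (1/2 - b))"
      have d: "0 < d" using i by (auto simp: d_def)
      have 1: "px (px u) (a, b) + 2 * \<eta> \<le> 0"
      proof (rule second_derivative_at_max[where f = "\<lambda>t. v (t, b)" and f' = "\<lambda>t. px u (t, b) + 2 * \<eta> * t", OF _ _ d])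
        show "((\<lambda>t. v (t, b)) has_real_derivative px u (t, b) + 2 * \<eta> * t) (at t)" for t
          unfolding v_def by (auto intro!: derivative_eq_intros has_partialsD(1)[OF u(2)])
        show "((\<lambda>t. px u (t, b) + 2 * \<eta> * t) has_real_derivative px (px u) (a, b) + 2 * \<eta>) (at a)"
          by (auto intro!: derivative_eq_intros has_partialsD(1)[OF u(3)])
        show "v (t, b) \<le> v (a, b)" if "\<bar>t - a\<bar> < d" for t
          using m(2)[of "(t, b)"] that r unfolding ab d_def by (auto simp: abs_less_iff)
      qed
      have 2: "py (py u) (a, b) + 2 * \<eta> \<le> 0"
      proof (rule second_derivative_at_max[where f = "\<lambda>t. v (a, t)" and f' = "\<lambda>t. py u (a, t) + 2 * \<eta> * t", OF _ _ d])
        show "((\<lambda>t. v (a, t)) has_real_derivative py u (a, t) + 2 * \<eta> * t) (at t)" for t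
          unfolding v_def by (auto intro!: derivative_eq_intros has_partialsD(2)[OF u(2)])
        show "((\<lambda>t. py u (a, t) + 2 * \<eta> * t) has_real_derivative py (py u) (a, b) + 2 * \<eta>) (at b)"
          by (auto intro!: derivative_eq_intros has_partialsD(2)[OF u(4)])
        show "v (a, t) \<le> v (a, b)" if "\<bar>t - b\<bar> < d" for t
          using m(2)[of "(a, t)"] that r unfolding ab d_def by (auto simp: abs_less_iff)
      qed
      show False using sub[OF i] 1 2 \<eta> by linarith
    qed
    have "u (x, y) \<le> v (x, y)" using \<eta> by (simp add: v_def)
    also have "\<dots> \<le> v m" by (rule m(2)) (use xy in auto)
    also have "\<dots> \<le> \<eta> * 1"
    proof -
      have "a\<^sup>2 \<le> (1/2)\<^sup>2" "b\<^sup>2 \<le> (1/2)\<^sup>2" using r by (auto intro: power_mono)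
      then have "a\<^sup>2 + b\<^sup>2 \<le> 1" by (simp add: power2_eq_square)
      then have "\<eta> * (a\<^sup>2 + b\<^sup>2) \<le> \<eta> * 1" using \<eta> by (intro mult_left_mono) auto
      then show ?thesis using um unfolding v_def ab by simp
    qed
    finally show ?thesis by simp
  qed
  then show ?thesis by (rule field_le_epsilon[of _ 0, simplified])
qed

section \<open>The regularised sign function\<close>

lemma smooth1I:
  assumes "\<And>x. f differentiable (at x)" "smooth1 (deriv f)"
  shows "smooth1 f"
  unfolding smooth1_def
proof (intro allI)
  fix n x
  show "(deriv ^^ n) f differentiable (at x)"
    using assms(1) assms(2)[unfolded smooth1_def, rule_format, of "n - 1" x]
    by (cases n) (simp_all add: funpow_swap1)
qed

lemma smooth1_rescale:
  assumes "smooth1 f"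
  shows "smooth1 (\<lambda>t. c * f (t / e))"
  unfolding smooth1_def
proof
  fix n
  show "\<forall>x. (deriv ^^ n) (\<lambda>t. c * f (t / e)) differentiable (at x)"
    using assms
  proof (induction n arbitrary: f c)
    case 0
    have d: "f differentiable (at x)" for x using 0[unfolded smooth1_def, rule_format, of 0 x] by simp
    have "(\<lambda>t. f (t / e)) differentiable (at x)" for x
      using differentiable_compose[of f "\<lambda>t. t / e" x UNIV] d by (simp add: divide_inverse)
    then show ?case by simp
  next
    case (Suc n)
    have "((\<lambda>t. c * f (t / e)) has_real_derivative (c / e) * deriv f (t / e)) (at t)" for t
    proof -
      have "((\<lambda>t. t / e) has_real_derivative 1 / e) (at t)" by (rule DERIV_cdivide[OF DERIV_ident])
      from DERIV_cmult[OF DERIV_chain2[OF smooth1D(1)[OF Suc.prems] this], of c]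
      show ?thesis by simp
    qed
    then have "deriv (\<lambda>t. c * f (t / e)) = (\<lambda>t. (c / e) * deriv f (t / e))"
      by (auto intro!: DERIV_imp_deriv)
    then show ?case
      using Suc.IH[OF smooth1D(2)[OF Suc.prems], of "c / e"] by (simp add: funpow_swap1 del: funpow.simps add: funpow_Suc_right)
  qed
qed

locale mollifier =
  fixes K :: "real \<Rightarrow> real"
  assumes smooth: "smooth1 K" and nonneg: "\<And>x. K x \<ge> 0" and even: "\<And>x. K (- x) = K x"
    and supp: "closure {x. K x \<noteq> 0} \<subseteq> {-1<..<1}" and int1: "(K has_integral 1) UNIV"
begin

lemma K_0: "1 \<le> \<bar>x\<bar> \<Longrightarrow> K x = 0"
  using supp closure_subset[of "{x. K x \<noteq> 0}"] by (force simp: subset_iff abs_le_iff)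

context
  fixes e :: real
  assumes e: "0 < e"
begin

lemma Keps_0: "e \<le> \<bar>s\<bar> \<Longrightarrow> Keps K e s = 0"
  using e by (simp add: Keps_def K_0 field_simps abs_divide)

lemma Keps_nonneg: "0 \<le> Keps K e s"
  using e nonneg by (simp add: Keps_def)

lemma smooth_Keps: "smooth1 (\<lambda>t. c * Keps K e t)"
  using smooth1_rescale[OF smooth, of "c / e" e] by (simp add: Keps_def)

lemma continuous_Keps: "continuous_on S (Keps K e)"
  using smooth1D(3)[OF smooth_Keps[of 1], of S] by simp

lemma Keps_integral:
  assumes "a \<le> - e" "e \<le> b"
  shows "integral {a..b} (Keps K e) = 1"
proof -
  have "(K has_integral 1) (cbox (-1) 1)"
    using int1 has_integral_restrict_UNIV[of "cbox (-1) 1" K 1] K_0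
    by (smt (verit, best) box_real(2) atLeastAtMost_iff has_integral_cong abs_le_iff has_integral_eq)
  from has_integral_affinity[OF this, of "1 / e" 0]
  have "((\<lambda>x. K (x / e)) has_integral e) ((\<lambda>x. e * x) ` {-1..1})"
    using e by (simp add: divide_inverse mult.commute)
  moreover have "(\<lambda>x. e * x) ` {-1..1} = {-e..e}"
    using e image_mult_atLeastAtMost[of e "-1" 1] by simp
  ultimately have "((\<lambda>x. K (x / e)) has_integral e) {-e..e}" by simp
  from has_integral_divide[OF this, of e] have "(Keps K e has_integral 1) {-e..e}"
    using e by (simp add: Keps_def[abs_def])
  then have "(Keps K e has_integral 1) {a..b}"
    by (rule has_integral_on_superset) (use assms Keps_0 in \<open>auto simp: abs_le_iff\<close>)
  then show ?thesis by (rule integral_unique)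
qed

text \<open>\<open>Feps\<close> is 1 minus twice the distribution function of the mollifier. The
  lower limit a is left free so that it can be placed below any t before differentiating.\<close>

lemma Feps_eq:
  assumes a: "a \<le> - e" "a \<le> t"
  shows "Feps K e t = 1 - 2 * integral {a..t} (Keps K e)"
proof -
  define b where "b = max e t"
  have b: "e \<le> b" "t \<le> b" by (auto simp: b_def)
  have i: "Keps K e integrable_on {c..d}" for c d by (rule integrable_continuous_real[OF continuous_Keps])
  \<comment> \<open>\<open>sgnp 0 = -1\<close>: the point s = t is exceptional for the left interval
    but not for the right one.\<close>
  have 1: "((\<lambda>s. sgnp (t - s) * Keps K e s) has_integral integral {a..t} (Keps K e)) {a..t}"
    by (rule has_integral_spike_finite[OF _ _ integrable_integral[OF i], of "{t}"]) (auto simp: sgnp_def)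
  have 2: "((\<lambda>s. sgnp (t - s) * Keps K e s) has_integral - integral {t..b} (Keps K e)) {t..b}"
    by (rule has_integral_spike_finite[OF _ _ has_integral_neg[OF integrable_integral[OF i]], of "{}"]) (auto simp: sgnp_def)
  have "((\<lambda>s. sgnp (t - s) * Keps K e s) has_integral (integral {a..t} (Keps K e) + - integral {t..b} (Keps K e))) {a..b}"
    by (rule has_integral_combine[OF a(2) b(2) 1 2])
  then have "((\<lambda>s. sgnp (t - s) * Keps K e s) has_integral (integral {a..t} (Keps K e) + - integral {t..b} (Keps K e))) UNIV"
    by (rule has_integral_on_superset) (use a b Keps_0 in \<open>auto simp: abs_le_iff not_le\<close>)
  then have "Feps K e t = integral {t..b} (Keps K e) - integral {a..t} (Keps K e)"
    by (simp add: Feps_def integral_unique)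
  moreover have "integral {a..t} (Keps K e) + integral {t..b} (Keps K e) = 1"
    using Henstock_Kurzweil_Integration.integral_combine[OF a(2) b(2) i] Keps_integral[OF a(1) b(1)] by simp
  ultimately show ?thesis by simp
qed

lemma Feps_derivative: "(Feps K e has_real_derivative - 2 * Keps K e t) (at t)"
proof -
  define a where "a = min (- e) t - 1"
  have a: "a \<le> - e" "a < t" by (auto simp: a_def)
  have "((\<lambda>x. integral {a..x} (Keps K e)) has_real_derivative Keps K e t) (at t within {a..t + 1})"
    by (rule integral_has_real_derivative[OF continuous_Keps]) (use a in auto)
  then have "((\<lambda>x. integral {a..x} (Keps K e)) has_real_derivative Keps K e t) (at t)"
    using a at_within_Icc_at[of a t "t + 1"] by simp
  from DERIV_diff[OF DERIV_const DERIV_cmult[OF this, of 2], of 1]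
  have d: "((\<lambda>x. 1 - 2 * integral {a..x} (Keps K e)) has_real_derivative - 2 * Keps K e t) (at t)" by simp
  show ?thesis
    by (rule DERIV_cong_ev[THEN iffD1, OF refl _ refl d])
       (use a Feps_eq[OF a(1)] in \<open>auto intro: eventually_mono[OF eventually_gt_at_top] simp: eventually_nhds intro!: exI[of _ "{a<..}"]\<close>)
qed

lemma smooth_Feps: "smooth1 (Feps K e)"
proof (rule smooth1I)
  show "Feps K e differentiable (at x)" for x
    using Feps_derivative[of x] real_differentiable_def by blast
  have "deriv (Feps K e) = (\<lambda>t. - 2 * Keps K e t)"
    using Feps_derivative by (auto intro!: DERIV_imp_deriv)
  then show "smooth1 (deriv (Feps K e))" using smooth_Keps[of "- 2"] by simp
qed

lemma Feps_antimono: "s \<le> t \<Longrightarrow> Feps K e t \<le> Feps K e s"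
  by (rule DERIV_nonpos_imp_nonincreasing)
     (use Feps_derivative Keps_nonneg in \<open>auto intro!: exI[of _ "- 2 * Keps K e _"] simp: mult_nonpos_nonneg\<close>)

lemma Feps_ge: "e \<le> t \<Longrightarrow> Feps K e t = - 1"
  using Feps_eq[of "- e" t] Keps_integral[of "- e" t] e by simp

lemma Feps_le: "t \<le> - e \<Longrightarrow> Feps K e t = 1"
  using Feps_eq[of t t] by simp

lemma abs_Feps_le: "\<bar>Feps K e t\<bar> \<le> 1"
  using Feps_antimono[of t "max t e"] Feps_antimono[of "min t (- e)" t]
    Feps_ge[of "max t e"] Feps_le[of "min t (- e)"] by simp

text \<open>Evenness of K makes the derivative of \<open>Feps K e t + Feps K e (- t)\<close> vanish,
  and at t = e the sum is -1 + 1.\<close>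

lemma Feps_odd: "Feps K e (- t) = - Feps K e t"
proof -
  have "((\<lambda>t. Feps K e t + Feps K e (- t)) has_real_derivative 0) (at t)" for t
  proof -
    have "Keps K e (- t) = Keps K e t" using even[of "t / e"] by (simp add: Keps_def)
    moreover have "((\<lambda>t. Feps K e (- t)) has_real_derivative (- 2 * Keps K e (- t)) * (- 1)) (at t)"
      by (rule DERIV_chain2[OF Feps_derivative]) (auto intro!: derivative_eq_intros)
    ultimately show ?thesis using DERIV_add[OF Feps_derivative[of t]] by fastforce
  qed
  then have "Feps K e t + Feps K e (- t) = Feps K e e + Feps K e (- e)"
    using DERIV_isconst_all[of "\<lambda>t. Feps K e t + Feps K e (- t)" t e] by blast
  then show ?thesis using Feps_ge[of e] Feps_le[of "- e"] by simp
qed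

lemma Feps_nonneg: "t \<le> 0 \<Longrightarrow> 0 \<le> Feps K e t"
  using Feps_antimono[of t 0] Feps_odd[of 0] by simp

end

end

section \<open>The barrier and the monotone iteration\<close>

definition sn :: "real \<Rightarrow> real" where "sn x = sin (2 * pi * x)"
definition cs :: "real \<Rightarrow> real" where "cs x = cos (2 * pi * x)"

lemma DERIV_sn: "(sn has_real_derivative 2 * pi * cs x) (at x)"
  unfolding sn_def[abs_def] cs_def by (auto intro!: derivative_eq_intros)

lemma DERIV_cs: "(cs has_real_derivative - (2 * pi * sn x)) (at x)"
  unfolding sn_def cs_def[abs_def] by (auto intro!: derivative_eq_intros)

lemma sn_odd: "sn (- x) = - sn x" by (simp add: sn_def)

lemma sn_shift: "sn (x + 1) = sn x"
proof -
  have "2 * pi * (x + 1) = 2 * pi * x + 2 * pi" by (simp add: algebra_simps)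
  then show ?thesis by (simp add: sn_def)
qed

lemma cs_sn: "(cs x)\<^sup>2 = 1 - (sn x)\<^sup>2"
  unfolding cs_def sn_def by (rule cos_squared_eq)

lemma sn_bounds: "\<bar>sn x\<bar> \<le> 1" by (simp add: sn_def)

lemma sn_nonneg: "0 \<le> x \<Longrightarrow> x \<le> 1/2 \<Longrightarrow> 0 \<le> sn x"
  unfolding sn_def by (rule sin_ge_zero) auto

text \<open>
  \<open>K\<close> may vanish near 0, so \<open>F\<^sub>\<epsilon>\<close> may vanish near 0 and the barrier \<open>- amp pr(x) pr(y)\<close> has to be superharmonic
  near the sides of the square. The cube makes \<open>pr\<close> convex enough near its zeros; \<open>amp\<close> makes the Laplacian
  at most 1 elsewhere.
\<close>

definition pr :: "real \<Rightarrow> real" where "pr x = sn x + sn x ^ 3"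
definition pr' :: "real \<Rightarrow> real" where "pr' x = 2 * pi * cs x * (1 + 3 * (sn x)\<^sup>2)"
definition pr'' :: "real \<Rightarrow> real" where "pr'' x = 4 * pi\<^sup>2 * sn x * (5 - 9 * (sn x)\<^sup>2)"

lemma DERIV_pr: "(pr has_real_derivative pr' x) (at x)"
proof -
  have "((\<lambda>x. sn x + sn x ^ 3) has_real_derivative (2 * pi * cs x + 3 * sn x ^ 2 * (2 * pi * cs x))) (at x)"
    by (rule derivative_eq_intros DERIV_sn refl)+ simp
  then show ?thesis unfolding pr_def[abs_def] pr'_def by (simp add: algebra_simps)
qed

lemma DERIV_pr': "(pr' has_real_derivative pr'' x) (at x)"
proof -
  have "((\<lambda>x. 2 * pi * cs x * (1 + 3 * (sn x)\<^sup>2)) has_real_derivative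
     (2 * pi * - (2 * pi * sn x)) * (1 + 3 * (sn x)\<^sup>2) + (3 * (2 * sn x * (2 * pi * cs x))) * (2 * pi * cs x)) (at x)"
    by (rule derivative_eq_intros DERIV_sn DERIV_cs refl)+ (simp_all add: algebra_simps)
  moreover have "(2 * pi * - (2 * pi * sn x)) * (1 + 3 * (sn x)\<^sup>2) + (3 * (2 * sn x * (2 * pi * cs x))) * (2 * pi * cs x)
     = 4 * pi\<^sup>2 * sn x * (- (1 + 3 * (sn x)\<^sup>2) + 6 * (cs x)\<^sup>2)"
    by (simp add: algebra_simps power2_eq_square)
  moreover have "\<dots> = pr'' x" unfolding cs_sn pr''_def by (simp add: algebra_simps)
  ultimately show ?thesis unfolding pr'_def[abs_def] by simp
qed

definition amp :: real where "amp = 1 / (64 * pi\<^sup>2)"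

lemma amp_pos: "0 < amp" by (simp add: amp_def)

lemma amp_le: "amp \<le> 1 / 64"
proof -
  have "1 \<le> pi\<^sup>2" using pi_ge_two by (simp add: one_le_power)
  then show ?thesis by (simp add: amp_def field_simps)
qed

definition start :: "R2 \<Rightarrow> real" where "start p = - (amp * pr (fst p) * pr (snd p))"

lemma separated_partials:
  fixes f g f' g' :: "real \<Rightarrow> real"
  assumes f: "\<And>x. (f has_real_derivative f' x) (at x)" and g: "\<And>x. (g has_real_derivative g' x) (at x)"
  shows "px (\<lambda>p. - (c * f (fst p) * g (snd p))) = (\<lambda>p. - (c * f' (fst p) * g (snd p)))"
    "py (\<lambda>p. - (c * f (fst p) * g (snd p))) = (\<lambda>p. - (c * f (fst p) * g' (snd p)))"
    "has_partials (\<lambda>p. - (c * f (fst p) * g (snd p)))"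
proof -
  let ?u = "\<lambda>p. - (c * f (fst p) * g (snd p))"
  have X: "((\<lambda>t. ?u (t, y)) has_real_derivative (\<lambda>p. - (c * f' (fst p) * g (snd p))) (x, y)) (at x)" for x y
    using DERIV_minus[OF DERIV_cmult[OF f[of x], of "c * g y"]] by (simp add: mult_ac)
  have Y: "((\<lambda>t. ?u (x, t)) has_real_derivative (\<lambda>p. - (c * f (fst p) * g' (snd p))) (x, y)) (at y)" for x y
    using DERIV_minus[OF DERIV_cmult[OF g[of y], of "c * f x"]] by (simp add: mult_ac)
  show "px ?u = (\<lambda>p. - (c * f' (fst p) * g (snd p)))" by (rule px_eqI[OF X])
  show "py ?u = (\<lambda>p. - (c * f (fst p) * g' (snd p)))" by (rule py_eqI[OF Y])
  show "has_partials ?u" by (rule has_partialsI[OF X Y])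
qed

lemma start_partials:
  "px start = (\<lambda>p. - (amp * pr' (fst p) * pr (snd p)))"
  "py start = (\<lambda>p. - (amp * pr (fst p) * pr' (snd p)))"
  "px (px start) = (\<lambda>p. - (amp * pr'' (fst p) * pr (snd p)))"
  "py (py start) = (\<lambda>p. - (amp * pr (fst p) * pr'' (snd p)))"
  "has_partials start" "has_partials (px start)" "has_partials (py start)"
  unfolding start_def[abs_def] separated_partials[OF DERIV_pr DERIV_pr]
    separated_partials[OF DERIV_pr' DERIV_pr] separated_partials[OF DERIV_pr DERIV_pr']
  by (rule refl separated_partials(3)[OF DERIV_pr DERIV_pr] separated_partials(3)[OF DERIV_pr' DERIV_pr]
      separated_partials(3)[OF DERIV_pr DERIV_pr'])+

lemma C1_start: "C1 start"
  unfolding C1_def start_partials(1,2)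
proof (intro conjI start_partials(5))
  have c: "continuous_on UNIV pr" "continuous_on UNIV pr'"
    by (rule DERIV_continuous_on, rule has_field_derivative_at_within, rule DERIV_pr DERIV_pr')+
  have "continuous_on UNIV (\<lambda>p :: R2. f (fst p))" "continuous_on UNIV (\<lambda>p :: R2. f (snd p))"
    if "continuous_on UNIV f" for f :: "real \<Rightarrow> real"
    by (rule continuous_on_compose2[OF that]; auto intro: continuous_intros)+
  note cc = this(1)[OF c(1)] this(2)[OF c(1)] this(1)[OF c(2)] this(2)[OF c(2)]
  show "continuous_on UNIV start" unfolding start_def[abs_def] by (intro continuous_intros cc)
  show "continuous_on UNIV (\<lambda>p. - (amp * pr' (fst p) * pr (snd p)))" by (intro continuous_intros cc)
  show "continuous_on UNIV (\<lambda>p. - (amp * pr (fst p) * pr' (snd p)))" by (intro continuous_intros cc)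
qed

lemma periodic2_start: "periodic2 start"
  by (simp add: periodic2_def start_def pr_def sn_shift)

lemma odd2_start: "odd2 start"
proof -
  have "pr (- x) = - pr x" for x by (simp add: pr_def sn_odd)
  then show ?thesis by (simp add: odd2_def start_def)
qed

lemma start_le:
  assumes "0 \<le> x" "x \<le> 1/2" "0 \<le> y" "y \<le> 1/2"
  shows "start (x, y) \<le> - (amp * (sn x * sn y))"
proof -
  have s: "0 \<le> sn x" "0 \<le> sn y" using assms by (auto intro: sn_nonneg)
  then have "sn x \<le> pr x" "sn y \<le> pr y" by (auto simp: pr_def)
  then have "sn x * sn y \<le> pr x * pr y" using s by (intro mult_mono) auto
  then have "amp * (sn x * sn y) \<le> amp * (pr x * pr y)" using amp_pos by (intro mult_left_mono) auto
  then show ?thesis by (simp add: start_def mult.assoc)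
qed

lemma laplacian_start:
  "px (px start) (x, y) + py (py start) (x, y)
    = - (4 * pi\<^sup>2 * amp * (sn x * sn y) * (10 - 4 * ((sn x)\<^sup>2 + (sn y)\<^sup>2) - 18 * ((sn x)\<^sup>2 * (sn y)\<^sup>2)))"
  unfolding start_partials(3,4) pr_def pr''_def by (simp add: algebra_simps power2_eq_square power3_eq_cube)

text \<open>Either alternative bounds the Laplacian by \<open>Feps K e (start (x, y))\<close> once
  \<open>e <= amp / 4\<close>: the first because \<open>Feps\<close> is nonnegative at nonpositive
  arguments, the second because it equals 1 up to -e. The bracket in the Laplacian turns negative
  only where both sines exceed 1/2, and there \<open>start\<close> is well below zero.\<close>

lemma start_subsolution:
  assumes x: "0 \<le> sn x" and y: "0 \<le> sn y"
  shows "px (px start) (x, y) + py (py start) (x, y) \<le> 0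
    \<or> (px (px start) (x, y) + py (py start) (x, y) \<le> 1 \<and> start (x, y) \<le> - (amp / 4))"
proof -
  define S where "S = (sn x)\<^sup>2"
  define T where "T = (sn y)\<^sup>2"
  have S: "0 \<le> S" "S \<le> 1" and T: "0 \<le> T" "T \<le> 1"
    using sn_bounds[of x] sn_bounds[of y] by (auto simp: S_def T_def abs_square_le_1)
  let ?b = "10 - 4 * (S + T) - 18 * (S * T)"
  have L: "px (px start) (x, y) + py (py start) (x, y) = 4 * pi\<^sup>2 * amp * (sn x * sn y) * (- ?b)"
    unfolding laplacian_start S_def T_def by (rule mult_minus_right[symmetric])
  have c: "0 \<le> 4 * pi\<^sup>2 * amp * (sn x * sn y)" using x y amp_pos by simp
  show ?thesis
  proof (cases "0 \<le> ?b")
    case True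
    then have "px (px start) (x, y) + py (py start) (x, y) \<le> 0"
      unfolding L using c by (intro mult_nonneg_nonpos) auto
    then show ?thesis ..
  next
    case False
    \<comment> \<open>If one of S, T is at most 1/4, the bracket is at least 10 - 5 - 9/2 =
      1/2.\<close>
    have ST: "1/4 < S \<and> 1/4 < T"
    proof (rule ccontr)
      assume "\<not> (1/4 < S \<and> 1/4 < T)"
      then consider "S \<le> 1/4" | "T \<le> 1/4" by linarith
      then have "S * T \<le> 1/4 \<and> S + T \<le> 5/4"
      proof cases
        case 1 then show ?thesis using S T mult_mono[of S "1/4" T 1] by auto
      next
        case 2 then show ?thesis using S T mult_mono[of S 1 T "1/4"] by auto
      qed
      then have "S * T \<le> 1/4" "S + T \<le> 5/4" by blast+
      moreover have "0 \<le> 10 - 4 * A - 18 * B" if "B \<le> 1/4" "A \<le> 5/4" for A B :: real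
        using that by linarith
      ultimately show False using False by blast
    qed
    have h: "1/2 < sn x" "1/2 < sn y"
    proof -
      have "(1/2)\<^sup>2 < (sn x)\<^sup>2" "(1/2)\<^sup>2 < (sn y)\<^sup>2" using ST by (simp_all add: S_def T_def power2_eq_square)
      then show "1/2 < sn x" "1/2 < sn y" using x y power_less_imp_less_base by blast+
    qed
    have "sn x \<le> 1" "sn y \<le> 1" using sn_bounds[of x] sn_bounds[of y] by auto
    then have "sn x * sn y \<le> 1" using x y by (simp add: mult_le_one)
    \<comment> \<open>The bound 4 * 2 + 18 - 10 = 16 is the source of \<open>amp\<close>: the
      prefactor \<open>4 pi^2 amp\<close> equals 1/16.\<close>
    moreover have "- ?b \<le> 16" "0 \<le> - ?b"
      using S T mult_le_one[of S T] False by auto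
    ultimately have "(sn x * sn y) * (- ?b) \<le> 1 * 16" using x y by (intro mult_mono) auto
    from mult_left_mono[OF this, of "4 * pi\<^sup>2 * amp"]
    have "px (px start) (x, y) + py (py start) (x, y) \<le> 4 * pi\<^sup>2 * amp * 16"
      unfolding L using amp_pos by (simp add: mult.assoc)
    also have "\<dots> = 1" by (simp add: amp_def)
    finally have l: "px (px start) (x, y) + py (py start) (x, y) \<le> 1" .
    have "1/2 \<le> pr x" "1/2 \<le> pr y" using h by (simp_all add: pr_def add_increasing2)
    then have "1/2 * (1/2) \<le> pr x * pr y" by (intro mult_mono) auto
    from mult_left_mono[OF this, of amp] have "start (x, y) \<le> - (amp / 4)"
      using amp_pos by (simp add: start_def mult.assoc)
    with l show ?thesis by blast
  qed
qed

text \<open>Unlike \<open>sgnp\<close> it equals 1 at 0, so the folding identity below holds on the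
  axes without appeal to boundary values.\<close>

definition fold_sgn :: "real \<Rightarrow> real" where
  "fold_sgn x = (if 0 \<le> x - of_int (round x) then 1 else - 1)"

definition fold_abs :: "real \<Rightarrow> real" where
  "fold_abs x = \<bar>x - of_int (round x)\<bar>"

lemma fold_abs_bounds: "0 \<le> fold_abs x" "fold_abs x \<le> 1/2"
  using of_int_round_abs_le[of x] by (simp_all add: fold_abs_def abs_minus_commute)

lemma fold_odd2:
  assumes u: "odd2 u" "periodic2 u"
  shows "u (x, y) = fold_sgn x * fold_sgn y * u (fold_abs x, fold_abs y)"
proof -
  let ?x = "x - of_int (round x)" and ?y = "y - of_int (round y)"
  have "u (x, y) = u (?x, ?y)"
    using periodic2_int[OF u(2), of x "- round x" y "- round y"] by simp
  also have "\<dots> = fold_sgn x * u (fold_abs x, ?y)"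
    using odd2D(1)[OF u(1), of ?x ?y] by (simp add: fold_sgn_def fold_abs_def)
  also have "u (fold_abs x, ?y) = fold_sgn y * u (fold_abs x, fold_abs y)"
    using odd2D(2)[OF u(1), of "fold_abs x" ?y] by (simp add: fold_sgn_def fold_abs_def)
  finally show ?thesis by simp
qed

section \<open>The monotone iteration and its limit\<close>

context mollifier
begin

primrec iter :: "real \<Rightarrow> nat \<Rightarrow> R2 \<Rightarrow> real" where
  "iter e 0 = start"
| "iter e (Suc n) = ilap (\<lambda>p. Feps K e (iter e n p))"

lemma Feps_mean0:
  assumes e: "0 < e" and u: "u \<in> borel_measurable borel" "periodic2 u" "odd2 u"
  shows "mean0 1 (\<lambda>p. Feps K e (u p))" "odd2 (\<lambda>p. Feps K e (u p))"
proof -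
  have m: "(\<lambda>p. Feps K e (u p)) \<in> borel_measurable borel"
    using borel_measurable_continuous_onI[OF smooth1D(3)[OF smooth_Feps[OF e], of UNIV]] u(1)
    by (rule measurable_compose[rotated])
  show o: "odd2 (\<lambda>p. Feps K e (u p))"
    unfolding odd2_def by (simp only: odd2D[OF u(3)] Feps_odd[OF e]) simp
  show "mean0 1 (\<lambda>p. Feps K e (u p))"
    by (rule mean0_odd2[OF bdd_borelI[OF m abs_Feps_le[OF e]] _ o]) (use u(2) in \<open>simp add: periodic2_def\<close>)
qed

lemma iter_regular:
  assumes e: "0 < e"
  shows "C1 (iter e n) \<and> periodic2 (iter e n) \<and> odd2 (iter e n)"
proof (induction n)
  case 0
  show ?case using C1_start periodic2_start odd2_start by simp
next
  case (Suc n)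
  have "iter e n \<in> borel_measurable borel"
    using Suc by (auto simp: C1_def intro: borel_measurable_continuous_onI)
  note F = Feps_mean0[OF e this]
  show ?case
    using C1_ilap[OF F(1)] periodic2_ilap[OF F(1)] odd2_ilap[OF F] Suc by simp
qed

lemma Feps_iter:
  assumes e: "0 < e"
  shows "mean0 1 (\<lambda>p. Feps K e (iter e n p))" "C1 (\<lambda>p. Feps K e (iter e n p))"
proof -
  have "iter e n \<in> borel_measurable borel"
    using iter_regular[OF e, of n] by (auto simp: C1_def intro: borel_measurable_continuous_onI)
  then show "mean0 1 (\<lambda>p. Feps K e (iter e n p))"
    using Feps_mean0(1)[OF e] iter_regular[OF e, of n] by blast
  show "C1 (\<lambda>p. Feps K e (iter e n p))"
    using Ck_compose[OF smooth_Feps[OF e], of "Suc 0"] iter_regular[OF e, of n] C1_iff_Ck by blast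
qed

lemma iter_C2:
  assumes e: "0 < e"
  shows "has_partials (iter e n)" "has_partials (px (iter e n))" "has_partials (py (iter e n))"
    "px (px (iter e (Suc n))) p + py (py (iter e (Suc n))) p = Feps K e (iter e n p)"
proof -
  have C2: "Ck (Suc (Suc 0)) (iter e (Suc n))" for n
    using Ck_ilap[OF Feps_iter(1)[OF e], of "Suc 0"] Feps_iter(2)[OF e] C1_iff_Ck by simp
  show "has_partials (iter e n)" using iter_regular[OF e, of n] by (auto simp: C1_def)
  show "has_partials (px (iter e n))" "has_partials (py (iter e n))"
    using C2 start_partials(6,7) by (cases n; auto)+
  show "px (px (iter e (Suc n))) p + py (py (iter e (Suc n))) p = Feps K e (iter e n p)"
    using laplacian_ilap[OF Feps_iter[OF e]] by simp
qed

text \<open>The difference of successive iterates has zero boundary values by oddness. Its Laplacian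
  is \<open>Feps K e (iter e n)\<close> minus the Laplacian of \<open>iter e n\<close>, nonnegative
  by \<open>sub\<close>, so the maximum principle applies.\<close>

lemma iter_step:
  assumes e: "0 < e" and xy: "0 \<le> x" "x \<le> 1/2" "0 \<le> y" "y \<le> 1/2"
    and sub: "\<And>x y. 0 < x \<Longrightarrow> x < 1/2 \<Longrightarrow> 0 < y \<Longrightarrow> y < 1/2 \<Longrightarrow>
      px (px (iter e n)) (x, y) + py (py (iter e n)) (x, y) \<le> Feps K e (iter e n (x, y))"
  shows "iter e (Suc n) (x, y) \<le> iter e n (x, y)"
proof -
  let ?u = "iter e (Suc n)" and ?v = "iter e n"
  define D where "D = (\<lambda>p. ?u p - ?v p)"
  note u = iter_C2(1-3)[OF e, of "Suc n"] and v = iter_C2(1-3)[OF e, of n]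
  note pD = partials_diff[OF u(1) v(1)]
  have c: "continuous_on UNIV ?u" "continuous_on UNIV ?v"
    using iter_regular[OF e, of "Suc n"] iter_regular[OF e, of n] unfolding C1_def by blast+
  have z: "?u (0, y) = 0" "?u (1/2, y) = 0" "?u (x, 0) = 0" "?u (x, 1/2) = 0"
    "?v (0, y) = 0" "?v (1/2, y) = 0" "?v (x, 0) = 0" "?v (x, 1/2) = 0" for x y
    using odd2_boundary[of ?u] odd2_boundary[of ?v] iter_regular[OF e, of "Suc n"] iter_regular[OF e, of n] by blast+
  have "D (x, y) \<le> 0"
  proof (rule max_principle[OF _ _ _ _ _ _ _ _ _ xy])
    show "continuous_on UNIV D" unfolding D_def by (intro continuous_intros c)
    show "has_partials D" "has_partials (px D)" "has_partials (py D)"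
      unfolding D_def pD(1,2) by (rule partials_diff(3), rule u, rule v)+
    show "D (0, y) \<le> 0" "D (1/2, y) \<le> 0" "D (x, 0) \<le> 0" "D (x, 1/2) \<le> 0" for x y
      unfolding D_def z by simp_all
    fix x y :: real assume r: "0 < x" "x < 1/2" "0 < y" "y < 1/2"
    have "px (px D) (x, y) + py (py D) (x, y)
        = (px (px ?u) (x, y) + py (py ?u) (x, y)) - (px (px ?v) (x, y) + py (py ?v) (x, y))"
      unfolding D_def pD(1,2) partials_diff(1)[OF u(2) v(2)] partials_diff(2)[OF u(3) v(3)] by simp
    then show "0 \<le> px (px D) (x, y) + py (py D) (x, y)"
      using iter_C2(4)[OF e, of n "(x, y)"] sub[OF r] by linarith
  qed
  then show ?thesis by (simp add: D_def)
qed

text \<open>Once \<open>iter e (Suc n) <= iter e n\<close> on the square, the Laplacian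
  \<open>Feps K e (iter e n)\<close> of \<open>iter e (Suc n)\<close> is at most
  \<open>Feps K e (iter e (Suc n))\<close>, because \<open>Feps\<close> decreases; this is the
  hypothesis of the next step. The condition \<open>e <= amp / 4\<close> starts the induction at the
  barrier.\<close>

lemma iter_decreasing:
  assumes e: "0 < e" "e \<le> amp / 4" and xy: "0 \<le> x" "x \<le> 1/2" "0 \<le> y" "y \<le> 1/2"
  shows "iter e (Suc n) (x, y) \<le> iter e n (x, y)"
  using xy
proof (induction n arbitrary: x y)
  case 0
  show ?case
  proof (rule iter_step[OF e(1) 0])
    fix x y :: real assume r: "0 < x" "x < 1/2" "0 < y" "y < 1/2"
    have s: "0 \<le> sn x" "0 \<le> sn y" using r by (auto intro: sn_nonneg)
    have st: "start (x, y) \<le> 0"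
    proof -
      have "0 \<le> amp * (sn x * sn y)" using s amp_pos by simp
      then show ?thesis using start_le[of x y] r by linarith
    qed
    from start_subsolution[OF s]
    show "px (px (iter e 0)) (x, y) + py (py (iter e 0)) (x, y) \<le> Feps K e (iter e 0 (x, y))"
    proof
      assume "px (px start) (x, y) + py (py start) (x, y) \<le> 0"
      then show ?thesis using Feps_nonneg[OF e(1) st] by simp
    next
      assume a: "px (px start) (x, y) + py (py start) (x, y) \<le> 1 \<and> start (x, y) \<le> - (amp / 4)"
      then have "Feps K e (start (x, y)) = 1" using e by (intro Feps_le) auto
      then show ?thesis using a by simp
    qed
  qed
next
  case (Suc n)
  show ?case
  proof (rule iter_step[OF e(1) Suc.prems])
    fix x y :: real assume r: "0 < x" "x < 1/2" "0 < y" "y < 1/2"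
    have "iter e (Suc n) (x, y) \<le> iter e n (x, y)" using Suc.IH r by simp
    then show "px (px (iter e (Suc n))) (x, y) + py (py (iter e (Suc n))) (x, y) \<le> Feps K e (iter e (Suc n) (x, y))"
      unfolding iter_C2(4)[OF e(1)] by (rule Feps_antimono[OF e(1)])
  qed
qed

text \<open>Bounded pointwise convergence passes through \<open>Feps\<close> and
  \<open>ilap\<close>, so the merely measurable limit solves the fixed point equation, and
  regularity follows from that equation. The upper bound is inherited from \<open>start\<close>
  because the iterates decrease.\<close>

lemma solution_exists:
  assumes e: "0 < e" "e \<le> amp / 4"
  obtains \<psi> where "\<psi> = ilap (\<lambda>p. Feps K e (\<psi> p))" "mean0 1 (\<lambda>p. Feps K e (\<psi> p))"
    "periodic2 \<psi>" "odd2 \<psi>" "smooth2 \<psi>"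
    "\<And>x y. 0 \<le> x \<Longrightarrow> x \<le> 1/2 \<Longrightarrow> 0 \<le> y \<Longrightarrow> y \<le> 1/2 \<Longrightarrow> \<psi> (x, y) \<le> - (amp * (sn x * sn y))"
proof -
  have dec: "decseq (\<lambda>n. iter e n (x, y))" if "0 \<le> x" "x \<le> 1/2" "0 \<le> y" "y \<le> 1/2" for x y
    using iter_decreasing[OF e that] by (intro decseq_SucI)
  \<comment> \<open>From the first step on, the sup bound of \<open>ilap\<close> gives 32;
    \<open>start\<close> is covered by its own value.\<close>
  have low: "- (max 32 (- start (x, y))) \<le> iter e n (x, y)" for n x y
  proof (cases n)
    case (Suc m)
    have "\<bar>iter e n (x, y)\<bar> \<le> 32 * 1"
      unfolding Suc iter.simps by (rule abs_ilap_le[OF Feps_iter(1)[OF e(1)]])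
    then show ?thesis by linarith
  qed simp
  have conv: "convergent (\<lambda>n. iter e n p)" for p
  proof -
    obtain x y where p: "p = (x, y)" by fastforce
    note r = fold_abs_bounds[of x] fold_abs_bounds[of y]
    obtain L where "(\<lambda>n. iter e n (fold_abs x, fold_abs y)) \<longlonglongrightarrow> L"
      using decseq_convergent[OF dec[OF r] allI[OF low]] by blast
    then have "(\<lambda>n. fold_sgn x * fold_sgn y * iter e n (fold_abs x, fold_abs y)) \<longlonglongrightarrow> fold_sgn x * fold_sgn y * L"
      by (intro tendsto_intros)
    moreover have "iter e n (x, y) = fold_sgn x * fold_sgn y * iter e n (fold_abs x, fold_abs y)" for n
      using iter_regular[OF e(1), of n] by (intro fold_odd2) auto
    ultimately show ?thesis unfolding p convergent_def by auto
  qed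
  define \<psi> where "\<psi> p = lim (\<lambda>n. iter e n p)" for p
  have lim: "(\<lambda>n. iter e n p) \<longlonglongrightarrow> \<psi> p" for p
    unfolding \<psi>_def using conv[of p] convergent_LIMSEQ_iff by blast
  have m: "\<psi> \<in> borel_measurable borel"
    by (rule borel_measurable_LIMSEQ_real[OF lim])
       (use iter_regular[OF e(1)] in \<open>auto simp: C1_def intro: borel_measurable_continuous_onI\<close>)
  have per: "iter e n (x + 1, y) = iter e n (x, y)" "iter e n (x, y + 1) = iter e n (x, y)"
    and odd: "iter e n (- x, y) = - iter e n (x, y)" "iter e n (x, - y) = - iter e n (x, y)" for n x y
    using iter_regular[OF e(1), of n] unfolding periodic2_def odd2_def by blast+
  have p: "periodic2 \<psi>" unfolding periodic2_def \<psi>_def per by simp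
  have o: "odd2 \<psi>"
  proof -
    have "(\<lambda>n. - iter e n (x, y)) \<longlonglongrightarrow> \<psi> (- x, y)" "(\<lambda>n. - iter e n (x, y)) \<longlonglongrightarrow> \<psi> (x, - y)" for x y
      using lim[of "(- x, y)"] lim[of "(x, - y)"] by (simp_all only: odd)
    from this[THEN LIMSEQ_unique, OF tendsto_minus[OF lim]]
    have "\<psi> (- x, y) = - \<psi> (x, y)" "\<psi> (x, - y) = - \<psi> (x, y)" for x y .
    then show ?thesis unfolding odd2_def by blast
  qed
  note F = Feps_mean0[OF e(1) m p o]
  have Fc: "isCont (Feps K e) t" for t
    using DERIV_isCont[OF Feps_derivative[OF e(1)]] .
  have fp: "\<psi> = ilap (\<lambda>p. Feps K e (\<psi> p))"
  proof
    fix q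
    have "(\<lambda>n. ilap (\<lambda>p. Feps K e (iter e n p)) q) \<longlonglongrightarrow> ilap (\<lambda>p. Feps K e (\<psi> p)) q"
      by (rule ilap_tendsto[OF Feps_iter(1)[OF e(1)] F(1)]) (rule isCont_tendsto_compose[OF Fc lim])
    moreover have "(\<lambda>n. ilap (\<lambda>p. Feps K e (iter e n p)) q) \<longlonglongrightarrow> \<psi> q"
      using LIMSEQ_Suc[OF lim[of q]] by simp
    ultimately show "\<psi> q = ilap (\<lambda>p. Feps K e (\<psi> p)) q" using LIMSEQ_unique by blast
  qed
  \<comment> \<open>Bootstrap: each passage through \<open>Feps K e\<close> and \<open>ilap\<close>
    gains one derivative.\<close>
  have "Ck k \<psi>" for k
  proof (induction k)
    case 0
    have "C1 \<psi>" using C1_ilap[OF F(1)] fp by simp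
    then show ?case by (simp add: C1_def)
  next
    case (Suc k)
    have "Ck (Suc k) (ilap (\<lambda>p. Feps K e (\<psi> p)))"
      by (rule Ck_ilap[OF F(1) Ck_compose[OF smooth_Feps[OF e(1)] Suc]])
    then show ?case using fp by simp
  qed
  then have sm: "smooth2 \<psi>" by (simp add: smooth2_iff_Ck)
  have up: "\<psi> (x, y) \<le> - (amp * (sn x * sn y))" if r: "0 \<le> x" "x \<le> 1/2" "0 \<le> y" "y \<le> 1/2" for x y
  proof -
    have "\<psi> (x, y) \<le> iter e 0 (x, y)" by (rule decseq_ge[OF dec[OF r] lim])
    then show ?thesis using start_le[OF r] by simp
  qed
  show thesis by (rule that[OF fp F(1) p o sm up])
qed

end

section \<open>Size of the vorticity difference\<close>

text \<open>Half angles stay in [0, pi/4], where the cosine is at least \<open>sqrt 2 / 2\<close>.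
  This factor enters twice, through the mean value theorem for sin and through the double angle
  formula, and \<open>2 * (sqrt 2 / 2)^2 = 1\<close>.\<close>

lemma sin_ge_half:
  assumes "0 \<le> \<theta>" "\<theta> \<le> pi / 2"
  shows "\<theta> / 2 \<le> sin \<theta>"
proof -
  have c: "sqrt 2 / 2 \<le> cos t" if "0 \<le> t" "t \<le> pi / 4" for t
    using cos_monotone_0_pi_le[of t "pi / 4"] that pi_gt_zero by (simp add: cos_45)
  let ?t = "\<theta> / 2"
  have t: "0 \<le> ?t" "?t \<le> pi / 4" using assms by auto
  have s: "?t * (sqrt 2 / 2) \<le> sin ?t"
  proof (cases "?t = 0")
    case False
    then have "0 < ?t" using t by simp
    from MVT2[OF this, of sin cos] obtain z where z: "0 < z" "z < ?t" "sin ?t - sin 0 = (?t - 0) * cos z"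
      by (auto simp: DERIV_sin)
    have "?t * (sqrt 2 / 2) \<le> ?t * cos z" using t z c[of z] by (intro mult_left_mono) auto
    then show ?thesis using z(3) by simp
  qed simp
  have "?t = 2 * ((?t * (sqrt 2 / 2)) * (sqrt 2 / 2))" by simp
  also have "\<dots> \<le> 2 * (sin ?t * cos ?t)"
    using s c[OF t] t by (intro mult_left_mono mult_mono) (auto intro: order_trans[OF _ s])
  also have "\<dots> = sin \<theta>" using sin_double[of ?t] by simp
  finally show ?thesis .
qed

lemma abs_le_sn: "\<bar>t\<bar> \<le> 1/4 \<Longrightarrow> \<bar>t\<bar> \<le> \<bar>sn t\<bar>"
proof -
  assume t: "\<bar>t\<bar> \<le> 1/4"
  have "2 * pi * \<bar>t\<bar> \<le> pi / 2" using t mult_left_mono[of "\<bar>t\<bar>" "1/4" "2 * pi"] by simp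
  then have "2 * pi * \<bar>t\<bar> / 2 \<le> sin (2 * pi * \<bar>t\<bar>)" by (intro sin_ge_half) auto
  moreover have "1 * \<bar>t\<bar> \<le> pi * \<bar>t\<bar>" using pi_ge_two by (intro mult_right_mono) auto
  moreover have "sin (2 * pi * \<bar>t\<bar>) \<le> \<bar>sn t\<bar>" by (cases "0 \<le> t") (auto simp: sn_def)
  ultimately show ?thesis by simp
qed

lemma sn_half: "sn (x - 1/2) = - sn x"
proof -
  have "2 * pi * (x - 1/2) = 2 * pi * x - pi" by (simp add: algebra_simps)
  then show ?thesis by (simp add: sn_def sin_diff)
qed

text \<open>The witness c is a zero of \<open>sn\<close> at distance at most 1/4 from x.\<close>

lemma sn_lower:
  assumes "0 \<le> x" "x \<le> 1"
  obtains c :: real where "c \<in> {0, 1/2, 1}" "\<bar>x - c\<bar> \<le> \<bar>sn x\<bar>"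
proof -
  consider "x \<le> 1/4" | "1/4 \<le> x" "x \<le> 3/4" | "3/4 \<le> x" by linarith
  then show thesis
  proof cases
    case 1
    then show thesis using abs_le_sn[of x] assms that[of 0] by simp
  next
    case 2
    then have "\<bar>x - 1/2\<bar> \<le> \<bar>sn (x - 1/2)\<bar>" by (intro abs_le_sn) linarith
    then show thesis using that[of "1/2"] by (simp only: sn_half abs_minus_cancel) simp
  next
    case 3
    then have "\<bar>x - 1\<bar> \<le> \<bar>sn (x - 1)\<bar>" using assms by (intro abs_le_sn) linarith
    then show thesis using that[of 1] sn_shift[of "x - 1"] by simp
  qed
qed

lemma continuous_sn: "continuous_on S sn"
  unfolding sn_def[abs_def] by (intro continuous_intros)

lemma borel_sn [measurable]: "sn \<in> borel_measurable borel"
  by (rule borel_measurable_continuous_onI[OF continuous_sn])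

lemma integral_ivl_indicator_le:
  fixes a b :: real
  assumes "a \<le> b"
  shows "(LINT y|ivl 0 1. indicator {a..b} y :: real) \<le> b - a"
proof -
  have "(LINT y|ivl 0 1. indicator {a..b} y :: real) = (LINT y|lborel. indicator {0..1} y * indicator {a..b} y)"
    by (rule integral_ivl_lborel) measurable
  also have "\<dots> \<le> (LINT y|lborel. indicator {a..b} y)"
  proof (rule integral_mono)
    show i: "integrable lborel (\<lambda>y. indicator {a..b} y :: real)" using assms by simp
    show "integrable lborel (\<lambda>y. indicator {0..1} y * indicator {a..b} y :: real)"
      by (rule Bochner_Integration.integrable_bound[OF i]) (auto simp: indicator_def)
  qed (auto simp: indicator_def)
  also have "\<dots> = b - a" using assms by simp
  finally show ?thesis .
qed

lemma bdd_borel_indicator: "A \<in> sets borel \<Longrightarrow> bdd_borel 1 (indicator A :: _ \<Rightarrow> real)"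
  by (rule bdd_borelI) (auto simp: indicator_def)

lemma sublevel_sn_le:
  assumes t: "0 \<le> t"
  shows "(LINT y|ivl 0 1. indicator {y. \<bar>sn y\<bar> < t} y :: real) \<le> 6 * t"
proof -
  have m: "{y. \<bar>sn y\<bar> < t} \<in> sets borel" by measurable
  have i: "integrable (ivl 0 1) (indicator A :: _ \<Rightarrow> real)" if "A \<in> sets borel" for A
    by (rule bdd_borel_ivl_integrable[OF bdd_borel_indicator[OF that]])
  let ?I = "\<lambda>c y. indicator {c - t..c + t} y :: real"
  have "(LINT y|ivl 0 1. indicator {y. \<bar>sn y\<bar> < t} y :: real) \<le> (LINT y|ivl 0 1. ?I 0 y + ?I (1/2) y + ?I 1 y)"
  proof (rule integral_mono_AE)
    show "AE y in ivl 0 1. indicator {y. \<bar>sn y\<bar> < t} y \<le> ?I 0 y + ?I (1/2) y + ?I 1 y"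
      using AE_ivl_01
    proof eventually_elim
      case (elim y)
      obtain c where "c \<in> {0, 1/2, 1}" "\<bar>y - c\<bar> \<le> \<bar>sn y\<bar>" using sn_lower[of y] elim by auto
      then show ?case by (auto simp: indicator_def abs_le_iff)
    qed
  qed (intro i m Bochner_Integration.integrable_add; measurable)+
  also have "\<dots> = (LINT y|ivl 0 1. ?I 0 y) + (LINT y|ivl 0 1. ?I (1/2) y) + (LINT y|ivl 0 1. ?I 1 y)"
    using i by simp
  also have "\<dots> \<le> 2 * t + 2 * t + 2 * t"
    using integral_ivl_indicator_le[of "0 - t" "0 + t"] integral_ivl_indicator_le[of "1/2 - t" "1/2 + t"]
      integral_ivl_indicator_le[of "1 - t" "1 + t"] t by (intro add_mono) auto
  finally show ?thesis by simp
qed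

text \<open>The integrand majorises \<open>min 1 (\<eta> / |x - c|)\<close>, the shape of the slices
  of the critical set; its logarithmic primitive is the source of the logarithm in the final
  rate.\<close>

lemma log_integral_le:
  assumes \<eta>: "0 < \<eta>" "\<eta> \<le> 1" and c: "0 \<le> c" "c \<le> 1"
  shows "(LINT x|ivl 0 1. 2 * \<eta> / (\<eta> + \<bar>x - c\<bar>)) \<le> 4 * \<eta> * (1 - ln \<eta>)"
    "bdd_borel 2 (\<lambda>x. 2 * \<eta> / (\<eta> + \<bar>x - c\<bar>))"
proof -
  let ?f = "\<lambda>x. 2 * \<eta> / (\<eta> + \<bar>x - c\<bar>)"
  have pos: "\<eta> + \<bar>x - c\<bar> > 0" for x using \<eta> by (simp add: add_pos_nonneg)
  show b: "bdd_borel 2 ?f"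
  proof (rule bdd_borelI)
    show "\<bar>?f x\<bar> \<le> 2" for x using \<eta> pos[of x] by (simp add: abs_of_pos field_simps)
  qed measurable
  have l: "(?f has_integral (2 * \<eta> * ln (\<eta> + c) - 2 * \<eta> * ln \<eta>)) {0..c}"
  proof -
    have "((\<lambda>x. 2 * \<eta> / (\<eta> + (c - x))) has_integral
        (- (2 * \<eta> * ln (\<eta> + (c - c))) - - (2 * \<eta> * ln (\<eta> + (c - 0))))) {0..c}"
    proof (rule fundamental_theorem_of_calculus[OF c(1)])
      fix x assume "x \<in> {0..c}"
      then have "0 < \<eta> + (c - x)" using \<eta> by auto
      then show "((\<lambda>x. - (2 * \<eta> * ln (\<eta> + (c - x)))) has_vector_derivative 2 * \<eta> / (\<eta> + (c - x))) (at x within {0..c})"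
        unfolding has_real_derivative_iff_has_vector_derivative[symmetric]
        by (auto intro!: derivative_eq_intros)
    qed
    then have "((\<lambda>x. 2 * \<eta> / (\<eta> + (c - x))) has_integral (2 * \<eta> * ln (\<eta> + c) - 2 * \<eta> * ln \<eta>)) {0..c}" by simp
    then show ?thesis by (rule has_integral_eq[rotated]) auto
  qed
  have r: "(?f has_integral (2 * \<eta> * ln (\<eta> + (1 - c)) - 2 * \<eta> * ln \<eta>)) {c..1}"
  proof -
    have "((\<lambda>x. 2 * \<eta> / (\<eta> + (x - c))) has_integral
        (2 * \<eta> * ln (\<eta> + (1 - c)) - 2 * \<eta> * ln (\<eta> + (c - c)))) {c..1}"
    proof (rule fundamental_theorem_of_calculus[OF c(2)])
      fix x assume "x \<in> {c..1}"
      then have "0 < \<eta> + (x - c)" using \<eta> by auto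
      then show "((\<lambda>x. 2 * \<eta> * ln (\<eta> + (x - c))) has_vector_derivative 2 * \<eta> / (\<eta> + (x - c))) (at x within {c..1})"
        unfolding has_real_derivative_iff_has_vector_derivative[symmetric]
        by (auto intro!: derivative_eq_intros)
    qed
    then have "((\<lambda>x. 2 * \<eta> / (\<eta> + (x - c))) has_integral (2 * \<eta> * ln (\<eta> + (1 - c)) - 2 * \<eta> * ln \<eta>)) {c..1}" by simp
    then show ?thesis by (rule has_integral_eq[rotated]) auto
  qed
  have ln2: "ln (\<eta> + d) \<le> 1" if "0 \<le> d" "d \<le> 1" for d
    using ln_le_minus_one[of "\<eta> + d"] \<eta> that by simp
  have "(LINT x|ivl 0 1. ?f x) = (2 * \<eta> * ln (\<eta> + c) - 2 * \<eta> * ln \<eta>) + (2 * \<eta> * ln (\<eta> + (1 - c)) - 2 * \<eta> * ln \<eta>)"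
    unfolding integral_ivl_bdd(2)[OF b] by (rule integral_unique[OF has_integral_combine[OF c l r]])
  also have "\<dots> \<le> (2 * \<eta> * 1 - 2 * \<eta> * ln \<eta>) + (2 * \<eta> * 1 - 2 * \<eta> * ln \<eta>)"
    using \<eta> c ln2[of c] ln2[of "1 - c"] by (intro add_mono diff_right_mono mult_left_mono) auto
  also have "\<dots> = 4 * \<eta> * (1 - ln \<eta>)" by (simp add: algebra_simps)
  finally show "(LINT x|ivl 0 1. ?f x) \<le> 4 * \<eta> * (1 - ln \<eta>)" .
qed

text \<open>The slice at x has measure at most 1 and at most \<open>6 \<delta> / |sn x|\<close>,
  hence at most \<open>2 \<eta> / (\<eta> + |x - c|)\<close> with \<open>\<eta> = 6 \<delta>\<close>
  and c a zero of \<open>sn\<close> near x. Three zeros give the factor 3 * 4 * 6 = 72.\<close>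

lemma sublevel_product_le:
  assumes \<delta>: "0 < \<delta>" "6 * \<delta> \<le> 1"
  shows "(LINT p|sqm 0 1. indicator {p. \<bar>sn (fst p) * sn (snd p)\<bar> < \<delta>} p :: real) \<le> 72 * \<delta> * (1 - ln (6 * \<delta>))"
proof -
  define \<eta> where "\<eta> = 6 * \<delta>"
  have \<eta>: "0 < \<eta>" "\<eta> \<le> 1" using \<delta> by (auto simp: \<eta>_def)
  let ?E = "{p. \<bar>sn (fst p) * sn (snd p)\<bar> < \<delta>} :: R2 set"
  have cE: "continuous_on UNIV (\<lambda>p :: R2. \<bar>sn (fst p) * sn (snd p)\<bar>)"
    by (intro continuous_intros continuous_on_compose2[OF continuous_sn[of UNIV]]) auto
  have "open ?E" by (rule open_Collect_less[OF cE continuous_on_const])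
  then have mE: "?E \<in> sets borel" by simp
  note bE = bdd_borel_indicator[OF mE]
  let ?J = "\<lambda>c x. 2 * \<eta> / (\<eta> + \<bar>x - c\<bar>)"
  have iJ: "integrable (ivl 0 1) (?J c)" if "0 \<le> c" "c \<le> 1" for c
    by (rule bdd_borel_ivl_integrable[OF log_integral_le(2)[OF \<eta> that]])
  have nJ: "0 \<le> ?J c x" for c x using \<eta> by simp
  have inner: "(LINT y|ivl 0 1. indicator ?E (x, y) :: real) \<le> ?J 0 x + ?J (1/2) x + ?J 1 x" if x: "0 < x" "x \<le> 1" for x
  proof -
    obtain c where c: "c \<in> {0, 1/2, 1}" "\<bar>x - c\<bar> \<le> \<bar>sn x\<bar>" using sn_lower[of x] x by auto
    have "(LINT y|ivl 0 1. indicator ?E (x, y) :: real) \<le> ?J c x"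
    proof (cases "\<bar>x - c\<bar> \<le> \<eta>")
      case True
      have "(LINT y|ivl 0 1. indicator ?E (x, y) :: real) \<le> (LINT y|ivl 0 1. 1)"
        by (intro integral_mono bdd_borel_ivl_integrable[OF bdd_borel_slice(1)[OF bE]])
           (auto simp: indicator_def)
      also have "\<dots> = 1" by (simp add: measure_ivl)
      also have "\<dots> \<le> ?J c x"
      proof -
        have "0 < \<eta> + \<bar>x - c\<bar>" using \<eta> by simp
        then show ?thesis using True by (simp add: field_simps)
      qed
      finally show ?thesis .
    next
      case False
      then have p: "0 < \<bar>x - c\<bar>" "0 < \<bar>sn x\<bar>" using \<eta> c(2) by auto
      have "(x, y) \<in> ?E \<longleftrightarrow> y \<in> {y. \<bar>sn y\<bar> < \<delta> / \<bar>sn x\<bar>}" for y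
        using p(2) by (simp add: abs_mult field_simps)
      then have "(LINT y|ivl 0 1. indicator ?E (x, y) :: real) = (LINT y|ivl 0 1. indicator {y. \<bar>sn y\<bar> < \<delta> / \<bar>sn x\<bar>} y)"
        by (simp only: indicator_def)
      also have "\<dots> \<le> 6 * (\<delta> / \<bar>sn x\<bar>)" by (rule sublevel_sn_le) (use \<delta> in auto)
      also have "\<dots> = \<eta> / \<bar>sn x\<bar>" by (simp add: \<eta>_def)
      also have "\<dots> \<le> \<eta> / \<bar>x - c\<bar>" using p c(2) \<eta> by (intro divide_left_mono) auto
      also have "\<dots> \<le> ?J c x"
      proof -
        have "\<eta> * (\<eta> + \<bar>x - c\<bar>) \<le> 2 * \<eta> * \<bar>x - c\<bar>" using False \<eta> by simp
        then show ?thesis using p(1) \<eta> by (simp add: divide_le_eq le_divide_eq add_pos_pos mult.commute)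
      qed
      finally show ?thesis .
    qed
    moreover have "?J c x \<le> ?J 0 x + ?J (1/2) x + ?J 1 x"
    proof -
      have "j \<le> u + v + w" if "j = u \<or> j = v \<or> j = w" "0 \<le> u" "0 \<le> v" "0 \<le> w" for j u v w :: real
        using that by linarith
      then show ?thesis using c(1) nJ by (metis insert_iff singletonD)
    qed
    ultimately show ?thesis by linarith
  qed
  have "(LINT p|sqm 0 1. indicator ?E p :: real) = (LINT x|ivl 0 1. LINT y|ivl 0 1. indicator ?E (x, y))"
    by (rule integral_sqm[OF bdd_borel_sqm_integrable[OF bE]])
  also have "\<dots> \<le> (LINT x|ivl 0 1. ?J 0 x + ?J (1/2) x + ?J 1 x)"
  proof (rule integral_mono_AE)
    show "integrable (ivl 0 1) (\<lambda>x. LINT y|ivl 0 1. indicator ?E (x, y) :: real)"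
      using bdd_borel_integral_slice(1)[OF bE, of 0 1]
      by (auto intro: bdd_borel_ivl_integrable)
    show "integrable (ivl 0 1) (\<lambda>x. ?J 0 x + ?J (1/2) x + ?J 1 x)"
      by (intro Bochner_Integration.integrable_add iJ) auto
    show "AE x in ivl 0 1. (LINT y|ivl 0 1. indicator ?E (x, y) :: real) \<le> ?J 0 x + ?J (1/2) x + ?J 1 x"
      using AE_ivl_01 by eventually_elim (use inner in blast)
  qed
  also have "\<dots> = (LINT x|ivl 0 1. ?J 0 x) + (LINT x|ivl 0 1. ?J (1/2) x) + (LINT x|ivl 0 1. ?J 1 x)"
  proof -
    have a: "integrable (ivl 0 1) (?J 0)" "integrable (ivl 0 1) (?J (1/2))" "integrable (ivl 0 1) (?J 1)"
      by (intro iJ; simp)+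
    show ?thesis
      using Bochner_Integration.integral_add[OF Bochner_Integration.integrable_add[OF a(1,2)] a(3)]
        Bochner_Integration.integral_add[OF a(1,2)] by linarith
  qed
  also have "\<dots> \<le> 4 * \<eta> * (1 - ln \<eta>) + 4 * \<eta> * (1 - ln \<eta>) + 4 * \<eta> * (1 - ln \<eta>)"
    by (intro add_mono log_integral_le(1)[OF \<eta>]) auto
  finally show ?thesis by (simp add: \<eta>_def)
qed

text \<open>The value -1 of \<open>sgnp\<close> at 0 breaks oddness on the axes, so
  \<open>mean0_odd2\<close> does not apply and the mean is computed directly.\<close>

lemma mean0_bc_vort: "mean0 1 bc_vort"
proof -
  let ?s = "\<lambda>x :: real. sgnp (x - of_int (round x))"
  have ms [measurable]: "?s \<in> borel_measurable borel" unfolding sgnp_def round_def by measurable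
  have sb: "\<bar>?s x\<bar> \<le> 1" for x by (simp add: sgnp_def)
  have bs: "bdd_borel 1 ?s" by (rule bdd_borelI[OF ms sb])
  have rs: "?s (x + 1) = ?s x" for x
  proof -
    have "round (x + 1) = round x + 1" unfolding round_def by linarith
    then show ?thesis by simp
  qed
  have int0: "(LINT x|ivl 0 1. ?s x) = 0"
  proof -
    have 1: "(?s has_integral 1/2) {0..1/2}"
    proof (rule has_integral_spike_finite[of "{0, 1/2}"])
      show "((\<lambda>_. 1) has_integral (1/2 :: real)) {0..1/2 :: real}" using has_integral_const_real[of "1 :: real" 0 "1/2"] by simp
      show "?s x = 1" if "x \<in> {0..1/2} - {0, 1/2}" for x
      proof -
        have "round x = 0" using that by (intro round_unique) auto
        then show ?thesis using that by (simp add: sgnp_def)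
      qed
    qed simp
    have 2: "(?s has_integral - (1/2)) {1/2..1}"
    proof (rule has_integral_spike_finite[of "{1/2, 1}"])
      show "((\<lambda>_. - 1) has_integral (- (1/2) :: real)) {1/2..1 :: real}" using has_integral_const_real[of "- 1 :: real" "1/2" 1] by simp
      show "?s x = - 1" if "x \<in> {1/2..1} - {1/2, 1}" for x
      proof -
        have "round x = 1" using that by (intro round_unique) auto
        then show ?thesis using that by (simp add: sgnp_def)
      qed
    qed simp
    have "(?s has_integral (1/2 + - (1/2))) {0..1}" by (rule has_integral_combine[OF _ _ 1 2]) auto
    then show ?thesis unfolding integral_ivl_bdd(2)[OF bs] by (simp add: integral_unique)
  qed
  have bd: "bdd_borel 1 bc_vort"
  proof (rule bdd_borelI)
    have [measurable]: "fst \<in> borel_measurable (borel :: R2 measure)" "snd \<in> borel_measurable (borel :: R2 measure)"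
      by (intro borel_measurable_continuous_onI continuous_intros)+
    have "(\<lambda>p :: R2. ?s (fst p)) \<in> borel_measurable borel" "(\<lambda>p :: R2. ?s (snd p)) \<in> borel_measurable borel"
      by (rule measurable_compose[OF _ ms]; measurable)+
    then show "bc_vort \<in> borel_measurable borel" unfolding bc_vort_def[abs_def] by (intro borel_measurable_times)
    show "\<bar>bc_vort p\<bar> \<le> 1" for p unfolding bc_vort_def abs_mult using sb by (intro mult_le_one) auto
  qed
  have "(LINT p|sqm 0 1. bc_vort p) = (LINT x|ivl 0 1. LINT y|ivl 0 1. ?s x * ?s y)"
    using integral_sqm[OF bdd_borel_sqm_integrable[OF bd]] by (simp add: bc_vort_def)
  also have "\<dots> = 0" using int0 by simp
  finally show ?thesis
    using bd rs unfolding mean0_def periodic2_def bc_vort_def by simp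
qed

lemma psi0_eq: "psi0 = ilap bc_vort"
  unfolding psi0_def by (rule inv_lap_eq[OF mean0_bc_vort])

section \<open>Norm estimates\<close>

lemma Bop_head:
  assumes g: "mean0 B g"
  shows "Bop g p = g p + Bop (H.av g) p"
  using suminf_split_head[OF summable_Bop[OF g, of p]] unfolding Bop_def
  by (simp add: funpow_swap1 del: funpow.simps add: funpow_Suc_right)

text \<open>The kernel is at most 2, and the square of side 2 consists of four cells.\<close>

lemma abs_H_le_L1:
  assumes g: "bdd_borel B g" "periodic2 g" and m: "(LINT p|sqm 0 1. \<bar>g p\<bar>) \<le> m"
  shows "\<bar>H.av g p\<bar> \<le> 8 * m"
proof -
  have [measurable]: "g \<in> borel_measurable borel" using g bdd_borelD by blast
  have ga: "bdd_borel B (\<lambda>p. \<bar>g p\<bar>)" by (rule bdd_borelI) (auto simp: bdd_borelD(2)[OF g(1)])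
  have pa: "periodic2 (\<lambda>p. \<bar>g p\<bar>)" using g(2) by (simp add: periodic2_def)
  have gs: "bdd_borel B (\<lambda>z. \<bar>g (p + z)\<bar>)" by (rule bdd_borel_compose[OF ga]) measurable
  have "\<bar>H.av g p\<bar> \<le> (LINT z|sqm (-1) 1. \<bar>hker z * g (p + z)\<bar>)"
    unfolding H.av_def using integral_norm_bound[of "sqm (-1) 1" "\<lambda>z. hker z * g (p + z)"] by simp
  also have "\<dots> \<le> (LINT z|sqm (-1) 1. 2 * \<bar>g (p + z)\<bar>)"
    by (intro integral_mono integrable_abs integrable_mult_right H.integrable_av[OF g(1)] bdd_borel_sqm_integrable[OF gs])
       (auto simp: abs_mult hker_bounds intro!: mult_right_mono)
  also have "\<dots> = 2 * (LINT z|sqm (-1) 1. \<bar>g (p + 1 *\<^sub>R z)\<bar>)" by simp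
  also have "\<dots> \<le> 2 * (4 / 1\<^sup>2 * (LINT p|sqm 0 1. \<bar>g p\<bar>))"
    by (intro mult_left_mono integral_cell_scaled_le[OF ga pa]) auto
  finally show ?thesis using m by simp
qed

text \<open>Split off the first Neumann term. For g itself the \<open>L^1\<close> norm yields the
  square root; the tail is \<open>Bop (H.av g)\<close>, where \<open>H.av g\<close> has sup norm at
  most 8 m, so the crude bounds 8 for \<open>Bop\<close> and 4 W for the average give 256 W m. A
  general scaled kernel covers the potential and both partials.\<close>

lemma scaled_split_bound:
  assumes "scaled \<omega> k W"
    and g: "mean0 B g" "1 \<le> B" and m: "0 < m" "(LINT p|sqm 0 1. \<bar>g p\<bar>) \<le> m"
  shows "\<bar>averaging.av svm (\<lambda>t. \<omega> (fst t) * k (snd t)) (\<lambda>t. fst t *\<^sub>R snd t) (Bop g) p\<bar>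
    \<le> 16 * W * B * sqrt m + 256 * W * m"
proof -
  interpret scaled \<omega> k W by fact
  have Hg: "mean0 (8 * m) (H.av g)"
    by (rule mean0_bound[OF mean0_H[OF g(1)] abs_H_le_L1[OF mean0D(1,2)[OF g(1)] m(2)]])
  note r = mean0D(1)[OF mean0_Bop[OF Hg]]
  have "Bop g = (\<lambda>p. g p + Bop (H.av g) p)" using Bop_head[OF g(1)] by blast
  then have "av (Bop g) p = av g p + av (Bop (H.av g)) p"
    using av_add[OF mean0D(1)[OF g(1)] r, of p] by simp
  moreover have "\<bar>av g p\<bar> \<le> 16 * W * B * sqrt m"
    by (rule av_sqrt_bound[OF mean0D(1,2)[OF g(1)] g(2) m])
  moreover have "\<bar>av (Bop (H.av g)) p\<bar> \<le> 256 * W * m"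
  proof -
    have "\<bar>av (Bop (H.av g)) p\<bar> \<le> wmass * (8 * (8 * m))" by (rule abs_av_le[OF r])
    also have "\<dots> \<le> 4 * W * (8 * (8 * m))" using wmass_le m by (intro mult_right_mono) auto
    finally show ?thesis by simp
  qed
  ultimately show ?thesis by linarith
qed

text \<open>The linear term is absorbed by \<open>m <= sqrt C * sqrt m\<close>; 64 and 512 are the
  constants for sup bound 2 and kernel bound at most 2.\<close>

lemma ilap_C1_bound:
  assumes g: "mean0 2 g" and m: "0 < m" "m \<le> C" "(LINT p|sqm 0 1. \<bar>g p\<bar>) \<le> m"
  shows "\<bar>ilap g p\<bar> \<le> (64 + 512 * sqrt C) * sqrt m"
    "\<bar>px (ilap g) p\<bar> \<le> (64 + 512 * sqrt C) * sqrt m"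
    "\<bar>py (ilap g) p\<bar> \<le> (64 + 512 * sqrt C) * sqrt m"
proof -
  note b = mean0D(1)[OF mean0_Bop[OF g]]
  have mm: "m \<le> sqrt C * sqrt m"
  proof -
    have "m = sqrt m * sqrt m" using m by simp
    also have "\<dots> \<le> sqrt C * sqrt m" using m by (intro mult_right_mono) auto
    finally show ?thesis .
  qed
  have bound: "16 * W * 2 * sqrt m + 256 * W * m \<le> (64 + 512 * sqrt C) * sqrt m" if "0 \<le> W" "W \<le> 2" for W
  proof -
    have "32 * W * sqrt m \<le> 64 * sqrt m" using that m by (intro mult_right_mono) auto
    moreover have "256 * W * m \<le> 512 * (sqrt C * sqrt m)"
      using that m mm by (intro mult_mono) auto
    ultimately show ?thesis by (simp add: distrib_right mult.assoc)
  qed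
  have e: "norm ((1, 0) :: R2) = 1" "norm ((0, 1) :: R2) = 1" by (simp_all add: norm_Pair)
  have "\<bar>U.av (Bop g) p\<bar> \<le> 16 * 1 * 2 * sqrt m + 256 * 1 * m"
    by (rule scaled_split_bound[OF U.scaled_axioms g _ m(1,3)]) simp
  then show "\<bar>ilap g p\<bar> \<le> (64 + 512 * sqrt C) * sqrt m"
    unfolding ilap_def using bound[of 1] by linarith
  have "\<bar>V (1, 0) (Bop g) p\<bar> \<le> 16 * 2 * 2 * sqrt m + 256 * 2 * m"
    unfolding V_def by (rule scaled_split_bound[OF scaled_kern[OF e(1)] g _ m(1,3)]) simp
  then show "\<bar>px (ilap g) p\<bar> \<le> (64 + 512 * sqrt C) * sqrt m"
    unfolding ilap_def U_C1(1)[OF b] using bound[of 2] by linarith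
  have "\<bar>V (0, 1) (Bop g) p\<bar> \<le> 16 * 2 * 2 * sqrt m + 256 * 2 * m"
    unfolding V_def by (rule scaled_split_bound[OF scaled_kern[OF e(2)] g _ m(1,3)]) simp
  then show "\<bar>py (ilap g) p\<bar> \<le> (64 + 512 * sqrt C) * sqrt m"
    unfolding ilap_def U_C1(2)[OF b] using bound[of 2] by linarith
qed

lemma ilap_Holder:
  assumes g: "mean0 B g" and \<beta>: "0 \<le> \<beta>" "\<beta> < 1"
  shows "\<bar>px (ilap g) p - px (ilap g) q\<bar> \<le> 8 * B * (36 * ball2) / (1 - \<beta>) * dist p q powr \<beta>"
    "\<bar>py (ilap g) p - py (ilap g) q\<bar> \<le> 8 * B * (36 * ball2) / (1 - \<beta>) * dist p q powr \<beta>"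
proof -
  note b = mean0D(1)[OF mean0_Bop[OF g]]
  have e: "norm ((1, 0) :: R2) = 1" "norm ((0, 1) :: R2) = 1" by (simp_all add: norm_Pair)
  show "\<bar>px (ilap g) p - px (ilap g) q\<bar> \<le> 8 * B * (36 * ball2) / (1 - \<beta>) * dist p q powr \<beta>"
    unfolding ilap_def U_C1(1)[OF b] by (rule V_Holder[OF e(1) b \<beta>])
  show "\<bar>py (ilap g) p - py (ilap g) q\<bar> \<le> 8 * B * (36 * ball2) / (1 - \<beta>) * dist p q powr \<beta>"
    unfolding ilap_def U_C1(2)[OF b] by (rule V_Holder[OF e(2) b \<beta>])
qed

lemma c1_norm_le:
  assumes "\<And>p. \<bar>u p\<bar> \<le> S" "\<And>p. \<bar>px u p\<bar> \<le> S" "\<And>p. \<bar>py u p\<bar> \<le> S"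
  shows "c1_norm u \<le> ereal (3 * S)"
proof -
  have "(SUP p. ereal \<bar>u p\<bar>) \<le> ereal S" "(SUP p. ereal \<bar>px u p\<bar>) \<le> ereal S" "(SUP p. ereal \<bar>py u p\<bar>) \<le> ereal S"
    using assms by (intro SUP_least; simp)+
  then have "c1_norm u \<le> ereal S + ereal S + ereal S"
    unfolding c1_norm_def by (intro add_mono)
  then show ?thesis by simp
qed

text \<open>Factor the increment into its powers \<open>1 - \<alpha> / \<beta>\<close> and
  \<open>\<alpha> / \<beta>\<close>; bound the first by means of \<open>2 S\<close> and the second
  by the Hoelder estimate of order \<beta>, whose distance factor becomes exactly
  \<open>d powr \<alpha>\<close>.\<close>

lemma holder_semi_interpolate:
  assumes S: "\<And>p. \<bar>v p\<bar> \<le> S" and L: "\<And>p q. \<bar>v p - v q\<bar> \<le> L * dist p q powr \<beta>" "0 \<le> L"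
    and \<alpha>: "0 \<le> \<alpha>" "\<alpha> < \<beta>"
  shows "holder_semi \<alpha> v \<le> ereal ((2 * S) powr (1 - \<alpha> / \<beta>) * L powr (\<alpha> / \<beta>))"
  unfolding holder_semi_def
proof (rule SUP_least)
  fix pq :: "R2 \<times> R2" assume "pq \<in> {pq. fst pq \<noteq> snd pq}"
  moreover obtain p q where pq: "pq = (p, q)" by (cases pq)
  ultimately have ne: "p \<noteq> q" by simp
  define d where "d = dist p q"
  have d: "0 < d" using ne by (simp add: d_def)
  define X where "X = \<bar>v p - v q\<bar>"
  define t where "t = \<alpha> / \<beta>"
  have t: "0 \<le> t" "t < 1" "\<beta> * t = \<alpha>" using \<alpha> by (auto simp: t_def)
  have S0: "0 \<le> S" using S[of p] by linarith
  have X1: "X \<le> 2 * S" unfolding X_def using S[of p] S[of q] by linarith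
  have X2: "X \<le> L * d powr \<beta>" unfolding X_def d_def by (rule L(1))
  have "X \<le> (2 * S) powr (1 - t) * L powr t * d powr \<alpha>"
  proof (cases "X = 0")
    case False
    then have X: "0 < X" by (simp add: X_def)
    then have "X = X powr (1 - t) * X powr t" by (simp add: powr_add[symmetric])
    also have "\<dots> \<le> (2 * S) powr (1 - t) * (L * d powr \<beta>) powr t"
      using X X1 X2 t by (intro mult_mono powr_mono2) auto
    also have "(L * d powr \<beta>) powr t = L powr t * d powr \<alpha>"
      using L(2) t(3) by (simp add: powr_mult powr_powr)
    finally show ?thesis by (simp add: mult.assoc)
  qed simp
  then have "X / d powr \<alpha> \<le> (2 * S) powr (1 - t) * L powr t"
    using d by (simp add: divide_le_eq)
  then show "ereal (\<bar>v (fst pq) - v (snd pq)\<bar> / dist (fst pq) (snd pq) powr \<alpha>)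
      \<le> ereal ((2 * S) powr (1 - \<alpha> / \<beta>) * L powr (\<alpha> / \<beta>))"
    by (simp add: pq X_def d_def t_def)
qed

lemma c1a_norm_nonneg: "0 \<le> c1a_norm \<alpha> u"
proof -
  have s: "0 \<le> (SUP p. ereal \<bar>f p\<bar>)" for f :: "R2 \<Rightarrow> real"
    by (rule SUP_upper2[of "(0, 0)"]) auto
  have h: "0 \<le> holder_semi \<alpha> v" for v
    unfolding holder_semi_def by (rule SUP_upper2[of "((0, 0), (1, 0))"]) auto
  show ?thesis unfolding c1a_norm_def c1_norm_def by (intro add_nonneg_nonneg s h)
qed

text \<open>Both upper bounds come from \<open>- ln y <= 1 / y\<close>, at y = x and at y = sqrt
  x.\<close>

lemma neg_x_ln_x_bounds:
  fixes x :: real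
  assumes "0 < x" "x < 1"
  shows "0 < x * (- ln x)" "x * (- ln x) \<le> 1" "x * (- ln x) \<le> 2 * sqrt x"
proof -
  show "0 < x * (- ln x)" using assms ln_less_zero[of x] by (intro mult_pos_pos) auto
  have l: "- ln y \<le> 1 / y" if "0 < y" for y :: real
    using ln_le_minus_one[of "1 / y"] that by (simp add: ln_div)
  have "x * (- ln x) \<le> x * (1 / x)" using l[of x] assms by (intro mult_left_mono) auto
  then show "x * (- ln x) \<le> 1" using assms by simp
  have "- ln x = 2 * (- ln (sqrt x))" using assms by (simp add: ln_sqrt)
  also have "\<dots> \<le> 2 * (1 / sqrt x)" using l[of "sqrt x"] assms by simp
  finally have "x * (- ln x) \<le> x * (2 * (1 / sqrt x))" using assms by (intro mult_left_mono) auto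
  also have "\<dots> = 2 * (x / sqrt x)" by simp
  also have "\<dots> = 2 * sqrt x" using assms by (simp only: real_div_sqrt less_imp_le)
  finally show "x * (- ln x) \<le> 2 * sqrt x" .
qed

text \<open>288 = 2 * 72 * 2: the size of the vorticity difference, the measure of the critical set,
  and \<open>1 - ln (6 e / amp) <= 2 (- ln e)\<close>.\<close>

definition mconst :: real where "mconst = 288 / amp"

lemma mconst_pos: "0 < mconst" using amp_pos by (simp add: mconst_def)

context mollifier
begin

text \<open>Outside the critical set the folded point has \<open>\<psi> <= - e\<close>, where
  \<open>Feps\<close> is exactly 1; oddness then produces the sign of the quadrant, which is the
  Bahouri-Chemin vorticity. The lines where \<open>sgnp\<close> and \<open>fold_sgn\<close> disagree
  lie inside the critical set.\<close>

lemma vorticity_difference: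
  assumes e: "0 < e" and \<psi>: "odd2 \<psi>" "periodic2 \<psi>"
    and up: "\<And>x y. 0 \<le> x \<Longrightarrow> x \<le> 1/2 \<Longrightarrow> 0 \<le> y \<Longrightarrow> y \<le> 1/2 \<Longrightarrow> \<psi> (x, y) \<le> - (amp * (sn x * sn y))"
  shows "\<bar>Feps K e (\<psi> p) - bc_vort p\<bar> \<le> 2 * indicator {p. \<bar>sn (fst p) * sn (snd p)\<bar> < e / amp} p"
proof -
  obtain x y where p: "p = (x, y)" by fastforce
  have bv: "\<bar>bc_vort p\<bar> \<le> 1" by (simp add: bc_vort_def sgnp_def)
  show ?thesis
  proof (cases "\<bar>sn x * sn y\<bar> < e / amp")
    case True
    then show ?thesis using abs_Feps_le[OF e, of "\<psi> p"] bv by (simp add: p abs_le_iff)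
  next
    case False
    have sf: "\<bar>sn x\<bar> = sn (fold_abs x)" for x
    proof -
      have "sn (x - of_int (round x)) = sn x"
        using periodic_int[of sn x "- round x"] sn_shift by simp
      then have "\<bar>sn x\<bar> = \<bar>sn (fold_abs x)\<bar>"
        unfolding fold_abs_def using sn_odd[of "x - of_int (round x)"] by (cases "0 \<le> x - of_int (round x)") auto
      then show ?thesis using sn_nonneg[OF fold_abs_bounds] by simp
    qed
    have "e \<le> amp * \<bar>sn x * sn y\<bar>" using False amp_pos by (simp add: field_simps)
    also have "\<dots> = amp * (sn (fold_abs x) * sn (fold_abs y))" by (simp add: abs_mult sf)
    finally have l: "e \<le> amp * (sn (fold_abs x) * sn (fold_abs y))" .
    then have "\<psi> (fold_abs x, fold_abs y) \<le> - e"
      using up[OF fold_abs_bounds fold_abs_bounds, of x y] by linarith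
    then have 1: "Feps K e (\<psi> (fold_abs x, fold_abs y)) = 1" by (rule Feps_le[OF e])
    have fs: "fold_sgn x \<in> {1, - 1}" for x by (simp add: fold_sgn_def)
    have "Feps K e (\<psi> p) = fold_sgn x * fold_sgn y"
      using fs[of x] fs[of y] 1 Feps_odd[OF e] unfolding p fold_odd2[OF \<psi>, of x y] by auto
    moreover have "bc_vort p = fold_sgn x * fold_sgn y"
    proof -
      have nz: "sn (fold_abs x) \<noteq> 0" "sn (fold_abs y) \<noteq> 0" using l e by auto
      have "fold_abs x \<noteq> 0" "fold_abs y \<noteq> 0" using nz by (auto simp: sn_def)
      then have "x - of_int (round x) \<noteq> 0" "y - of_int (round y) \<noteq> 0" by (auto simp: fold_abs_def)
      then show ?thesis by (auto simp: p bc_vort_def sgnp_def fold_sgn_def)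
    qed
    ultimately show ?thesis by simp
  qed
qed

lemma vorticity_difference_L1:
  assumes e: "0 < e" "e \<le> amp / 6" "e \<le> exp (- 1)" and \<psi>: "odd2 \<psi>" "periodic2 \<psi>"
    and m: "mean0 B (\<lambda>p. Feps K e (\<psi> p) - bc_vort p)"
    and up: "\<And>x y. 0 \<le> x \<Longrightarrow> x \<le> 1/2 \<Longrightarrow> 0 \<le> y \<Longrightarrow> y \<le> 1/2 \<Longrightarrow> \<psi> (x, y) \<le> - (amp * (sn x * sn y))"
  shows "(LINT p|sqm 0 1. \<bar>Feps K e (\<psi> p) - bc_vort p\<bar>) \<le> mconst * (e * (- ln e))"
proof -
  let ?E = "{p. \<bar>sn (fst p) * sn (snd p)\<bar> < e / amp} :: R2 set"
  have cE: "continuous_on UNIV (\<lambda>p :: R2. \<bar>sn (fst p) * sn (snd p)\<bar>)"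
    by (intro continuous_intros continuous_on_compose2[OF continuous_sn[of UNIV]]) auto
  have "open ?E" by (rule open_Collect_less[OF cE continuous_on_const])
  then have bE: "bdd_borel 1 (indicator ?E :: R2 \<Rightarrow> real)" by (intro bdd_borel_indicator) simp
  have d: "0 < e / amp" "6 * (e / amp) \<le> 1" using e amp_pos by (auto simp: field_simps)
  have "(LINT p|sqm 0 1. \<bar>Feps K e (\<psi> p) - bc_vort p\<bar>) \<le> (LINT p|sqm 0 1. 2 * indicator ?E p)"
    by (intro integral_mono integrable_abs integrable_mult_right bdd_borel_sqm_integrable[OF mean0D(1)[OF m]]
          bdd_borel_sqm_integrable[OF bE] vorticity_difference[OF e(1) \<psi> up])
  also have "\<dots> = 2 * (LINT p|sqm 0 1. indicator ?E p)" by simp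
  also have "\<dots> \<le> 2 * (72 * (e / amp) * (1 - ln (6 * (e / amp))))"
    by (intro mult_left_mono sublevel_product_le[OF d]) auto
  also have "\<dots> \<le> 2 * (72 * (e / amp) * (2 * (- ln e)))"
  proof (intro mult_left_mono)
    \<comment> \<open>\<open>amp <= 1/64\<close> makes \<open>6 / amp\<close> larger than 1, and
      \<open>e <= exp (- 1)\<close> gives \<open>1 <= - ln e\<close>; together they absorb the
      constants in the logarithm.\<close>
    have "e \<le> 6 * (e / amp)" using e amp_pos amp_le by (simp add: field_simps)
    then have "ln e \<le> ln (6 * (e / amp))" using e by simp
    moreover have "ln e \<le> - 1" using e ln_mono[of e "exp (- 1)"] by simp
    ultimately show "1 - ln (6 * (e / amp)) \<le> 2 * (- ln e)" by simp
  qed (use d in auto)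
  also have "\<dots> = mconst * (e * (- ln e))" by (simp add: mconst_def)
  finally show ?thesis .
qed

end

section \<open>The family of solutions and its convergence to the Bahouri-Chemin stream
  function\<close>

theorem theorem2p1:
  fixes K :: "real \<Rightarrow> real"
  assumes "smooth1 K"
    and "\<And>x. K x \<ge> 0"
    and "\<And>x. K (- x) = K x"
    and "closure {x. K x \<noteq> 0} \<subseteq> {-1<..<1}"
    and "(K has_integral 1) UNIV"
  shows "\<exists>\<epsilon>0 > 0. \<exists>C1 > 0. \<exists>\<psi> :: real \<Rightarrow> R2 \<Rightarrow> real.
           (\<forall>\<epsilon>. 0 < \<epsilon> \<and> \<epsilon> < \<epsilon>0 \<longrightarrow>
              smooth2 (\<psi> \<epsilon>) \<and> periodic2 (\<psi> \<epsilon>) \<and>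
              \<psi> \<epsilon> = inv_lap (\<lambda>p. Feps K \<epsilon> (\<psi> \<epsilon> p)) \<and>
              c1_norm (\<lambda>p. \<psi> \<epsilon> p - psi0 p) \<le> ereal (C1 * sqrt \<epsilon> * sqrt (- ln \<epsilon>))) \<and>
           (\<forall>\<alpha>. 0 \<le> \<alpha> \<and> \<alpha> < 1 \<longrightarrow>
              ((\<lambda>\<epsilon>. c1a_norm \<alpha> (\<lambda>p. \<psi> \<epsilon> p - psi0 p)) \<longlongrightarrow> 0) (at_right 0))"
proof -
  interpret mollifier K by standard (use assms in auto)
  \<comment> \<open>\<open>amp / 6\<close> is the condition \<open>6 \<delta> <= 1\<close> on the
    critical set with \<open>\<delta> = e / amp\<close>, and it implies the condition
    \<open>e <= amp / 4\<close> of the barrier.\<close>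
  define e0 where "e0 = min (amp / 6) (exp (- 1))"
  have e0: "0 < e0" using amp_pos by (simp add: e0_def)
  \<comment> \<open>The constant of \<open>ilap_C1_bound\<close> at \<open>C = mconst\<close>; the
    last square root comes from \<open>m = mconst * (e * (- ln e))\<close>.\<close>
  define S0 where "S0 = (64 + 512 * sqrt mconst) * sqrt mconst"
  have S0: "0 < S0" using mconst_pos unfolding S0_def by (intro mult_pos_pos add_pos_nonneg) auto
  \<comment> \<open>The source g of the difference is kept in the predicate, so that one choice of
    \<open>\<psi>\<close> serves both the \<open>C^1\<close> rate and the Hoelder limit.\<close>
  define P where "P e \<psi> \<longleftrightarrow> smooth2 \<psi> \<and> periodic2 \<psi> \<and> \<psi> = inv_lap (\<lambda>p. Feps K e (\<psi> p)) \<and>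
      (\<exists>g. mean0 2 g \<and> (\<lambda>p. \<psi> p - psi0 p) = ilap g \<and>
        (\<forall>p. \<bar>ilap g p\<bar> \<le> S0 * sqrt (e * (- ln e)) \<and> \<bar>px (ilap g) p\<bar> \<le> S0 * sqrt (e * (- ln e))
          \<and> \<bar>py (ilap g) p\<bar> \<le> S0 * sqrt (e * (- ln e))))" for e \<psi>
  have "\<exists>\<psi>. P e \<psi>" if e: "0 < e" "e < e0" for e
  proof -
    have e': "e \<le> amp / 4" "e \<le> amp / 6" "e \<le> exp (- 1)" using e amp_pos by (auto simp: e0_def)
    have e1: "e < 1" using e' amp_le by linarith
    obtain \<psi> where \<psi>: "\<psi> = ilap (\<lambda>p. Feps K e (\<psi> p))" "mean0 1 (\<lambda>p. Feps K e (\<psi> p))"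
      "periodic2 \<psi>" "odd2 \<psi>" "smooth2 \<psi>"
      "\<And>x y. 0 \<le> x \<Longrightarrow> x \<le> 1/2 \<Longrightarrow> 0 \<le> y \<Longrightarrow> y \<le> 1/2 \<Longrightarrow> \<psi> (x, y) \<le> - (amp * (sn x * sn y))"
      using solution_exists[OF e(1) e'(1)] by metis
    define g where "g = (\<lambda>p. Feps K e (\<psi> p) - bc_vort p)"
    have g: "mean0 2 g" using mean0_diff[OF \<psi>(2) mean0_bc_vort] by (simp add: g_def)
    have "ilap g = (\<lambda>p. ilap (\<lambda>p. Feps K e (\<psi> p)) p - psi0 p)"
      unfolding g_def psi0_eq by (rule ilap_diff[OF \<psi>(2) mean0_bc_vort])
    then have eq: "(\<lambda>p. \<psi> p - psi0 p) = ilap g" using \<psi>(1) by simp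
    note x = neg_x_ln_x_bounds[OF e(1) e1]
    have m0: "0 < mconst * (e * (- ln e))" using x(1) mconst_pos by (rule mult_pos_pos[rotated])
    have m1: "mconst * (e * (- ln e)) \<le> mconst"
      using mult_left_mono[OF x(2), of mconst] mconst_pos by simp
    have m2: "(LINT p|sqm 0 1. \<bar>g p\<bar>) \<le> mconst * (e * (- ln e))"
      unfolding g_def by (rule vorticity_difference_L1[OF e(1) e'(2,3) \<psi>(4,3) g[unfolded g_def] \<psi>(6)])
    have sq: "(64 + 512 * sqrt mconst) * sqrt (mconst * (e * (- ln e))) = S0 * sqrt (e * (- ln e))"
      by (simp only: S0_def real_sqrt_mult mult.assoc)
    note bounds = ilap_C1_bound[OF g m0 m1 m2, unfolded sq]
    have inv: "\<psi> = inv_lap (\<lambda>p. Feps K e (\<psi> p))" unfolding inv_lap_eq[OF \<psi>(2)] by (rule \<psi>(1))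
    show ?thesis unfolding P_def using \<psi>(3,5) inv g eq bounds by blast
  qed
  then obtain \<psi> where \<psi>: "\<And>e. 0 < e \<Longrightarrow> e < e0 \<Longrightarrow> P e (\<psi> e)" by metis
  have C1b: "c1_norm (\<lambda>p. \<psi> e p - psi0 p) \<le> ereal (3 * (S0 * sqrt (e * (- ln e))))" if e: "0 < e" "e < e0" for e
  proof -
    obtain g where g: "(\<lambda>p. \<psi> e p - psi0 p) = ilap g"
      "\<And>p. \<bar>ilap g p\<bar> \<le> S0 * sqrt (e * (- ln e))" "\<And>p. \<bar>px (ilap g) p\<bar> \<le> S0 * sqrt (e * (- ln e))"
      "\<And>p. \<bar>py (ilap g) p\<bar> \<le> S0 * sqrt (e * (- ln e))"
      using \<psi>[OF e] unfolding P_def by blast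
    show ?thesis unfolding g(1) by (rule c1_norm_le[OF g(2-4)])
  qed
  have S3: "0 < 3 * S0" using S0 by simp
  show ?thesis
  proof (rule exI[of _ e0], rule conjI[OF e0], rule exI[of _ "3 * S0"], rule conjI[OF S3],
      rule exI[of _ \<psi>], intro conjI allI impI)
    fix e assume e: "0 < e \<and> e < e0"
    then have Pe: "P e (\<psi> e)" using \<psi> by blast
    then show "smooth2 (\<psi> e)" "periodic2 (\<psi> e)" "\<psi> e = inv_lap (\<lambda>p. Feps K e (\<psi> e p))"
      unfolding P_def by blast+
    show "c1_norm (\<lambda>p. \<psi> e p - psi0 p) \<le> ereal (3 * S0 * sqrt e * sqrt (- ln e))"
      using C1b[of e] e by (simp only: real_sqrt_mult mult.assoc)
  next
    fix \<alpha> :: real assume "0 \<le> \<alpha> \<and> \<alpha> < 1"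
    then have \<alpha>: "0 \<le> \<alpha>" "\<alpha> < 1" by auto
    \<comment> \<open>Midpoint between \<alpha> and 1: \<open>\<beta> < 1\<close> gives a Hoelder
      bound uniform in e, and \<open>\<alpha> < \<beta>\<close> leaves a positive power of the
      \<open>C^1\<close> size.\<close>
    define \<beta> where "\<beta> = (1 + \<alpha>) / 2"
    have \<beta>: "0 \<le> \<beta>" "\<beta> < 1" "\<alpha> < \<beta>" using \<alpha> by (auto simp: \<beta>_def)
    define L where "L = 8 * 2 * (36 * ball2) / (1 - \<beta>)"
    have L: "0 \<le> L" using \<beta> ball2_nonneg by (simp add: L_def)
    define s where "s e = S0 * sqrt (e * (- ln e))" for e
    define f where "f e = 3 * s e + 2 * ((2 * s e) powr (1 - \<alpha> / \<beta>) * L powr (\<alpha> / \<beta>))" for e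
    have le: "c1a_norm \<alpha> (\<lambda>p. \<psi> e p - psi0 p) \<le> ereal (f e)" if e: "0 < e" "e < e0" for e
    proof -
      obtain g where g: "mean0 2 g" "(\<lambda>p. \<psi> e p - psi0 p) = ilap g"
        "\<And>p. \<bar>px (ilap g) p\<bar> \<le> s e" "\<And>p. \<bar>py (ilap g) p\<bar> \<le> s e"
        using \<psi>[OF e] unfolding P_def s_def by blast
      note H = ilap_Holder[OF g(1) \<beta>(1,2), folded L_def]
      have "holder_semi \<alpha> (px (ilap g)) \<le> ereal ((2 * s e) powr (1 - \<alpha> / \<beta>) * L powr (\<alpha> / \<beta>))"
        by (rule holder_semi_interpolate[OF g(3) H(1) L \<alpha>(1) \<beta>(3)])
      moreover have "holder_semi \<alpha> (py (ilap g)) \<le> ereal ((2 * s e) powr (1 - \<alpha> / \<beta>) * L powr (\<alpha> / \<beta>))"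
        by (rule holder_semi_interpolate[OF g(4) H(2) L \<alpha>(1) \<beta>(3)])
      moreover have "c1_norm (ilap g) \<le> ereal (3 * s e)"
        using C1b[OF e] unfolding g(2) s_def .
      ultimately have "c1a_norm \<alpha> (ilap g) \<le> ereal (3 * s e) + ereal ((2 * s e) powr (1 - \<alpha> / \<beta>) * L powr (\<alpha> / \<beta>))
          + ereal ((2 * s e) powr (1 - \<alpha> / \<beta>) * L powr (\<alpha> / \<beta>))"
        unfolding c1a_norm_def by (intro add_mono)
      then show ?thesis unfolding g(2) f_def by (simp add: mult.commute add.commute)
    qed
    have ev: "eventually (\<lambda>e. 0 < e \<and> e < min e0 1) (at_right 0)"
      using eventually_at_right_real[of 0 "min e0 1"] e0 by (auto elim!: eventually_mono)
    have sl: "(s \<longlongrightarrow> 0) (at_right 0)"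
    proof -
      have "((\<lambda>e. e * (- ln e)) \<longlongrightarrow> 0) (at_right (0::real))"
      proof (rule tendsto_sandwich)
        show "eventually (\<lambda>e. 0 \<le> e * (- ln e)) (at_right (0::real))"
          using ev by eventually_elim (use neg_x_ln_x_bounds(1) in \<open>auto intro: less_imp_le\<close>)
        show "eventually (\<lambda>e. e * (- ln e) \<le> 2 * sqrt e) (at_right (0::real))"
          using ev by eventually_elim (use neg_x_ln_x_bounds(3) in auto)
        have "((\<lambda>e. 2 * sqrt e) \<longlongrightarrow> 2 * sqrt 0) (at_right 0)" by (intro tendsto_intros)
        then show "((\<lambda>e. 2 * sqrt e) \<longlongrightarrow> 0) (at_right 0)" by simp
      qed simp
      then have "((\<lambda>e. S0 * sqrt (e * (- ln e))) \<longlongrightarrow> S0 * sqrt 0) (at_right 0)" by (intro tendsto_intros)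
      then show ?thesis unfolding s_def[abs_def] by simp
    qed
    have fl: "(f \<longlongrightarrow> 0) (at_right 0)"
    proof -
      have pw: "((\<lambda>e. (2 * s e) powr (1 - \<alpha> / \<beta>)) \<longlongrightarrow> (2 * 0) powr (1 - \<alpha> / \<beta>)) (at_right 0)"
      \<comment> \<open>The base tends to 0, which is admissible because it is eventually
        nonnegative and the exponent is positive.\<close>
      proof (rule tendsto_powr2)
        show "((\<lambda>e. 2 * s e) \<longlongrightarrow> 2 * 0) (at_right 0)" by (intro tendsto_intros sl)
        show "eventually (\<lambda>e. 0 \<le> 2 * s e) (at_right 0)"
          using ev
        proof eventually_elim
          case (elim e)
          then have "0 < e * (- ln e)" by (intro neg_x_ln_x_bounds(1)) auto
          then show ?case using S0 by (simp add: s_def)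
        qed
        show "((\<lambda>e. 1 - \<alpha> / \<beta>) \<longlongrightarrow> 1 - \<alpha> / \<beta>) (at_right 0)" by (rule tendsto_const)
        show "0 < 1 - \<alpha> / \<beta>" using \<beta> \<alpha> by (simp add: divide_less_eq)
      qed
      have "((\<lambda>e. 3 * s e + 2 * ((2 * s e) powr (1 - \<alpha> / \<beta>) * L powr (\<alpha> / \<beta>)))
          \<longlongrightarrow> 3 * 0 + 2 * ((2 * 0) powr (1 - \<alpha> / \<beta>) * L powr (\<alpha> / \<beta>))) (at_right 0)"
        by (intro tendsto_add tendsto_mult tendsto_const sl pw)
      then show ?thesis unfolding f_def[abs_def] by simp
    qed
    show "((\<lambda>e. c1a_norm \<alpha> (\<lambda>p. \<psi> e p - psi0 p)) \<longlongrightarrow> 0) (at_right 0)"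
    proof (rule tendsto_sandwich)
      show "eventually (\<lambda>e. 0 \<le> c1a_norm \<alpha> (\<lambda>p. \<psi> e p - psi0 p)) (at_right 0)"
        by (simp add: c1a_norm_nonneg)
      show "eventually (\<lambda>e. c1a_norm \<alpha> (\<lambda>p. \<psi> e p - psi0 p) \<le> ereal (f e)) (at_right 0)"
        using ev by eventually_elim (rule le, auto)
      show "((\<lambda>e. ereal (f e)) \<longlongrightarrow> 0) (at_right 0)"
        using fl by (simp add: zero_ereal_def)
    qed simp
  qed
qed

end
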